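(* Let $\mathbf{k}$ be a commutative ring with identity, let $\lambda\in\mathbf{k}$, and let $R$ be a commutative $\mathbf{k}$-algebra with a partially defined Rota--Baxter operator $P$ of weight $\lambda$. Let $k\ge1$ be an integer and let $A$ be an iteratedly summable filtered subalgebra of $R$ of level $k$. Let $\mathfrak{A}_k\subseteq R$, $\mathfrak{M}(A)_k\subseteq Ш(\tilde{A})$ and the map $\mathfrak{P}_k:\mathfrak{M}(A)_k\to\mathfrak{A}_k$, $1\otimes f_1\otimes\cdots\otimes f_n\mapsto P_{(f_1,\dots,f_n)}$, be as defined in the context, and let $\nu:\mathfrak{A}_k\to\mathbf{k}$ be an algebra homomorphism. If elements $x_1,\dots,x_n\in\mathfrak{M}(A)_k$ satisfy an algebraic relation $F(x_1,\dots,x_n)=0$, where $F\in\mathbf{k}[X_1,\dots,X_n]$ is a polynomial with zero constant term, then $$F(\mathfrak{P}_k(x_1),\dots,\mathfrak{P}_k(x_n))=0\ \text{ in }\mathfrak{A}_k\qquad\text{and}\qquad F\big((\nu\circ\mathfrak{P}_k)(x_1),\dots,(\nu\circ\mathfrak{P}_k)(x_n)\big)=0\ \text{ in }\mathbf{k}.$$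
   Context: All rings and algebras are commutative; algebras, subalgebras and homomorphisms are not required to be unitary unless stated. Partially defined Rota--Baxter operator. Let $R$ be a $\mathbf{k}$-algebra. A partially defined Rota--Baxter operator of weight $\lambda\in\mathbf{k}$ on $R$ is a $\mathbf{k}$-linear map $P$ from a $\mathbf{k}$-submodule of $R$ (its domain) to $R$ such that $$P(f)P(g)=P(fP(g))+P(P(f)g)+\lambda P(fg)$$ whenever all terms are defined (i.e. $f,\ g,\ fP(g),\ P(f)g,\ fg$ all lie in the domain of $P$). For $\mathbf{f}=(f_1,\dots,f_n)\in R^n$, $n\ge 1$, one formally puts $$P_{\mathbf{f}}=P_{(f_1,\dots,f_n)}:=P(f_1P(f_2\cdots P(f_n)\cdots)).$$ It is well-defined if each successive application of $P$ is to an element of its domain. Filtered algebra. A filtered $\mathbf{k}$-algebra is a nonunitary $\mathbf{k}$-algebra $A$ with a decreasing sequence $A_n$, $n\ge 0$, of ideals such that $A_mA_n\subseteq A_{m+n}$. A filtered subalgebra of $R$ is a subalgebra $A$ of $R$ equipped with such a filtration. Iteratedly summable. A filtered subalgebra $A$ of $R$ is iteratedly summable of level $k$ if $P_{\mathbf{f}}$ is well-defined for all $n\ge1$ and all $\mathbf{f}=(f_1,\dots,f_n)\in A^n$ with $f_n\in A_k$. MZV algebra generated by $A$. For $A$ iteratedly summable of level $k$, $\mathfrak{A}_k$ is the $\mathbf{k}$-submodule of $R$ spanned by all $P_{(f_1,\dots,f_n)}$ with $n\ge1$, $f_1,\dots,f_n\in A$, $f_n\in A_k$; it is a subalgebra of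 $R$. Unitarization. $\tilde{A}=\mathbf{k}\oplus A$ with componentwise addition and product $(m,a)(n,b)=(mn,\,mb+na+ab)$. Free commutative Rota--Baxter algebra. For a commutative unitary $\mathbf{k}$-algebra $B$, let $Ш^+(B)=\bigoplus_{n\ge1}B^{\otimes n}$ (tensor products over $\mathbf{k}$) with the mixable shuffle product $\diamond^+$ of weight $\lambda$: the bilinear product determined recursively on pure tensors $a=a_1\otimes a'$ and $b=b_1\otimes b'$ (with $a_1,b_1\in B$) by $$a\diamond^+b=a_1\otimes(a'\diamond^+b)+b_1\otimes(a\diamond^+b')+\lambda(a_1b_1)\otimes(a'\diamond^+b'),$$ where an empty tensor $a'$ or $b'$ is treated as the identity for $\diamond^+$ (and $c\otimes(\text{empty tensor})=c$). This is a commutative nonunitary algebra; let $\mathbf{k}\oplusШ^+(B)$ be its unitarization, and let $Ш(B)=B\otimes(\mathbf{k}\oplusШ^+(B))$ be the tensor product algebra. Explicitly, its product is $$(a\otimes(u+a'))\diamond(b\otimes(v+b'))=(ab)\otimes(uv+va'+ub'+a'\diamond^+b')$$ for $a,b\in B$, $u,v\in\mathbf{k}$, $a',b'\inШ^+(B)$. With the operator $x\mapsto 1\otimes x$, $Ш(B)$ is the free commutative unitary Rota--Baxter algebra of weight $\lambda$ over $B$. The abstract MZV algebra. $\mathfrak{M}(A)_k$ is the $\mathbf{k}$-submodule of $Ш(\tilde{A})$ generated by all pure tensors $1\otimes a_1\otimes\cdots\otimes a_n$ with $n\ge1$, $a_1,\dots,a_n\in A$ and $a_n\in A_k$; it is a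 subalgebra of $Ш(\tilde{A})$. The map $\mathfrak{P}_k:\mathfrak{M}(A)_k\to\mathfrak{A}_k$ is the $\mathbf{k}$-linear map sending $1\otimes f_1\otimes\cdots\otimes f_n$ to $P_{(f_1,\dots,f_n)}$ for $f_1,\dots,f_n\in A$ with $f_n\in A_k$.
   Formalization: The map 𝔓_k is taken as a given k-linear map with the stated values on 1⊗f_1⊗⋯⊗f_n; over a general ring k such a map need not exist (torsion can make a generator vanish while its P-value does not), so its existence is assumed. *)

theory Defs
  imports "HOL-Algebra.Module" "HOL-Algebra.QuotRing" "HOL-Algebra.Indexed_Polynomials"
begin

section \<open>Nonunitary commutative algebras\<close>

text \<open>The field \<open>one\<close> of the record \<open>R\<close> is irrelevant: \<open>R\<close> need not have a unit. The base ring
  \<open>K\<close> is a commutative unital ring (possibly the zero ring).\<close>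

locale nonunital_comm_algebra = module K R for K (structure) and R (structure) +
  assumes mult_closed: "x \<in> carrier R \<Longrightarrow> y \<in> carrier R \<Longrightarrow> x \<otimes>\<^bsub>R\<^esub> y \<in> carrier R"
    and mult_assoc: "x \<in> carrier R \<Longrightarrow> y \<in> carrier R \<Longrightarrow> z \<in> carrier R \<Longrightarrow>
      (x \<otimes>\<^bsub>R\<^esub> y) \<otimes>\<^bsub>R\<^esub> z = x \<otimes>\<^bsub>R\<^esub> (y \<otimes>\<^bsub>R\<^esub> z)"
    and mult_comm: "x \<in> carrier R \<Longrightarrow> y \<in> carrier R \<Longrightarrow> x \<otimes>\<^bsub>R\<^esub> y = y \<otimes>\<^bsub>R\<^esub> x"
    and mult_l_distr: "x \<in> carrier R \<Longrightarrow> y \<in> carrier R \<Longrightarrow> z \<in> carrier R \<Longrightarrow>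
      (x \<oplus>\<^bsub>R\<^esub> y) \<otimes>\<^bsub>R\<^esub> z = x \<otimes>\<^bsub>R\<^esub> z \<oplus>\<^bsub>R\<^esub> y \<otimes>\<^bsub>R\<^esub> z"
    and smult_mult: "c \<in> carrier K \<Longrightarrow> x \<in> carrier R \<Longrightarrow> y \<in> carrier R \<Longrightarrow>
      (c \<odot>\<^bsub>R\<^esub> x) \<otimes>\<^bsub>R\<^esub> y = c \<odot>\<^bsub>R\<^esub> (x \<otimes>\<^bsub>R\<^esub> y)"

definition module_hom ::
  "('a, 'k) ring_scheme \<Rightarrow> ('a, 'b, 'm) module_scheme \<Rightarrow> ('a, 'c, 'n) module_scheme \<Rightarrow> ('b \<Rightarrow> 'c) set"
  where "module_hom K M N = {h \<in> carrier M \<rightarrow> carrier N.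
    (\<forall>x\<in>carrier M. \<forall>y\<in>carrier M. h (x \<oplus>\<^bsub>M\<^esub> y) = h x \<oplus>\<^bsub>N\<^esub> h y) \<and>
    (\<forall>c\<in>carrier K. \<forall>x\<in>carrier M. h (c \<odot>\<^bsub>M\<^esub> x) = c \<odot>\<^bsub>N\<^esub> h x)}"

definition alg_hom ::
  "('a, 'k) ring_scheme \<Rightarrow> ('a, 'b, 'm) module_scheme \<Rightarrow> ('a, 'c, 'n) module_scheme \<Rightarrow> ('b \<Rightarrow> 'c) set"
  where "alg_hom K M N = {h \<in> module_hom K M N.
    \<forall>x\<in>carrier M. \<forall>y\<in>carrier M. h (x \<otimes>\<^bsub>M\<^esub> y) = h x \<otimes>\<^bsub>N\<^esub> h y}"

definition span_of ::
  "('a, 'k) ring_scheme \<Rightarrow> ('a, 'b, 'm) module_scheme \<Rightarrow> 'b set \<Rightarrow> 'b set"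
  where "span_of K M S = (\<lambda>N. submodule N K M) hull S"

definition self_algebra :: "('a, 'k) ring_scheme \<Rightarrow> ('a, 'a) module"
  where "self_algebra K =
    \<lparr>carrier = carrier K, monoid.mult = monoid.mult K, one = \<one>\<^bsub>K\<^esub>,
     zero = \<zero>\<^bsub>K\<^esub>, add = add K, smult = monoid.mult K\<rparr>"

definition unitarization ::
  "('a, 'k) ring_scheme \<Rightarrow> ('a, 'b, 'm) module_scheme \<Rightarrow> ('a, 'a \<times> 'b) module"
  where "unitarization K A =
    \<lparr>carrier = carrier K \<times> carrier A,
     monoid.mult = (\<lambda>(m, a) (n, b). (m \<otimes>\<^bsub>K\<^esub> n, m \<odot>\<^bsub>A\<^esub> b \<oplus>\<^bsub>A\<^esub> n \<odot>\<^bsub>A\<^esub> a \<oplus>\<^bsub>A\<^esub> a \<otimes>\<^bsub>A\<^esub> b)),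
     one = (\<one>\<^bsub>K\<^esub>, \<zero>\<^bsub>A\<^esub>),
     zero = (\<zero>\<^bsub>K\<^esub>, \<zero>\<^bsub>A\<^esub>),
     add = (\<lambda>(m, a) (n, b). (m \<oplus>\<^bsub>K\<^esub> n, a \<oplus>\<^bsub>A\<^esub> b)),
     smult = (\<lambda>c (m, a). (c \<otimes>\<^bsub>K\<^esub> m, c \<odot>\<^bsub>A\<^esub> a))\<rparr>"


section \<open>Free modules with a bilinear product, and quotients\<close>

definition delta :: "('a, 'k) ring_scheme \<Rightarrow> 's \<Rightarrow> ('s \<Rightarrow> 'a)"
  where "delta K s = (\<lambda>t. if t = s then \<one>\<^bsub>K\<^esub> else \<zero>\<^bsub>K\<^esub>)"

text \<open>The free \<open>K\<close>-module on \<open>S\<close> (finitely supported functions), with the bilinear product whose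
  value on two basis elements \<open>s\<close>, \<open>t\<close> is \<open>\<mu> s t\<close>.\<close>

definition free_algebra ::
  "('a, 'k) ring_scheme \<Rightarrow> 's set \<Rightarrow> ('s \<Rightarrow> 's \<Rightarrow> ('s \<Rightarrow> 'a)) \<Rightarrow> ('s \<Rightarrow> 'a) \<Rightarrow> ('a, 's \<Rightarrow> 'a) module"
  where "free_algebra K S \<mu> e =
    \<lparr>carrier = {f. (\<forall>s. f s \<in> carrier K) \<and> (\<forall>s. s \<notin> S \<longrightarrow> f s = \<zero>\<^bsub>K\<^esub>) \<and> finite {s. f s \<noteq> \<zero>\<^bsub>K\<^esub>}},
     monoid.mult = (\<lambda>f g r. \<Oplus>\<^bsub>K\<^esub>p \<in> {s. f s \<noteq> \<zero>\<^bsub>K\<^esub>} \<times> {t. g t \<noteq> \<zero>\<^bsub>K\<^esub>}.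
       f (fst p) \<otimes>\<^bsub>K\<^esub> g (snd p) \<otimes>\<^bsub>K\<^esub> \<mu> (fst p) (snd p) r),
     one = e,
     zero = (\<lambda>_. \<zero>\<^bsub>K\<^esub>),
     add = (\<lambda>f g r. f r \<oplus>\<^bsub>K\<^esub> g r),
     smult = (\<lambda>c f r. c \<otimes>\<^bsub>K\<^esub> f r)\<rparr>"

text \<open>\<^const>\<open>FactRing\<close> together with the induced scalar multiplication; as in the product
  \<^const>\<open>rcoset_mult\<close> of cosets, the union is over equal cosets.\<close>

definition alg_quot :: "('a, 'b, 'm) module_scheme \<Rightarrow> 'b set \<Rightarrow> ('a, 'b set) module"
  where "alg_quot M I =
    \<lparr>carrier = carrier (M Quot I), monoid.mult = monoid.mult (M Quot I), one = \<one>\<^bsub>M Quot I\<^esub>,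
     zero = \<zero>\<^bsub>M Quot I\<^esub>, add = add (M Quot I),
     smult = (\<lambda>c C. \<Union>x\<in>C. I +>\<^bsub>M\<^esub> (c \<odot>\<^bsub>M\<^esub> x))\<rparr>"


section \<open>Tensor product of two unital algebras\<close>

definition tensor_free ::
  "('a, 'k) ring_scheme \<Rightarrow> ('a, 'b, 'm) module_scheme \<Rightarrow> ('a, 'c, 'n) module_scheme
    \<Rightarrow> ('a, 'b \<times> 'c \<Rightarrow> 'a) module"
  where "tensor_free K A B = free_algebra K (carrier A \<times> carrier B)
    (\<lambda>(a, b) (a', b'). delta K (a \<otimes>\<^bsub>A\<^esub> a', b \<otimes>\<^bsub>B\<^esub> b')) (delta K (\<one>\<^bsub>A\<^esub>, \<one>\<^bsub>B\<^esub>))"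

definition tensor_rels ::
  "('a, 'k) ring_scheme \<Rightarrow> ('a, 'b, 'm) module_scheme \<Rightarrow> ('a, 'c, 'n) module_scheme
    \<Rightarrow> ('b \<times> 'c \<Rightarrow> 'a) set"
  where "tensor_rels K A B = (let T = tensor_free K A B in span_of K T (
    {delta K (a \<oplus>\<^bsub>A\<^esub> a', b) \<ominus>\<^bsub>T\<^esub> (delta K (a, b) \<oplus>\<^bsub>T\<^esub> delta K (a', b)) | a a' b.
      a \<in> carrier A \<and> a' \<in> carrier A \<and> b \<in> carrier B} \<union>
    {delta K (a, b \<oplus>\<^bsub>B\<^esub> b') \<ominus>\<^bsub>T\<^esub> (delta K (a, b) \<oplus>\<^bsub>T\<^esub> delta K (a, b')) | a b b'.
      a \<in> carrier A \<and> b \<in> carrier B \<and> b' \<in> carrier B} \<union>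
    {delta K (c \<odot>\<^bsub>A\<^esub> a, b) \<ominus>\<^bsub>T\<^esub> c \<odot>\<^bsub>T\<^esub> delta K (a, b) | c a b.
      c \<in> carrier K \<and> a \<in> carrier A \<and> b \<in> carrier B} \<union>
    {delta K (a, c \<odot>\<^bsub>B\<^esub> b) \<ominus>\<^bsub>T\<^esub> c \<odot>\<^bsub>T\<^esub> delta K (a, b) | c a b.
      c \<in> carrier K \<and> a \<in> carrier A \<and> b \<in> carrier B}))"

definition tensor_alg ::
  "('a, 'k) ring_scheme \<Rightarrow> ('a, 'b, 'm) module_scheme \<Rightarrow> ('a, 'c, 'n) module_scheme
    \<Rightarrow> ('a, ('b \<times> 'c \<Rightarrow> 'a) set) module"
  where "tensor_alg K A B = alg_quot (tensor_free K A B) (tensor_rels K A B)"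

definition tensor ::
  "('a, 'k) ring_scheme \<Rightarrow> ('a, 'b, 'm) module_scheme \<Rightarrow> ('a, 'c, 'n) module_scheme
    \<Rightarrow> 'b \<Rightarrow> 'c \<Rightarrow> ('b \<times> 'c \<Rightarrow> 'a) set"
  where "tensor K A B a b = tensor_rels K A B +>\<^bsub>tensor_free K A B\<^esub> delta K (a, b)"


section \<open>The mixable shuffle algebra\<close>

text \<open>A pure tensor of length \<open>n\<close> over \<open>B\<close> is represented by a list of length \<open>n\<close>. Linear extension
  of \<open>w \<mapsto> b \<otimes> w\<close>:\<close>

definition prepend :: "('a, 'k) ring_scheme \<Rightarrow> 'b \<Rightarrow> ('b list \<Rightarrow> 'a) \<Rightarrow> ('b list \<Rightarrow> 'a)"
  where "prepend K b f = (\<lambda>w. case w of [] \<Rightarrow> \<zero>\<^bsub>K\<^esub> | b' # w' \<Rightarrow> if b' = b then f w' else \<zero>\<^bsub>K\<^esub>)"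

fun mixable_shuffle ::
  "('a, 'k) ring_scheme \<Rightarrow> 'a \<Rightarrow> ('a, 'b, 'm) module_scheme \<Rightarrow> 'b list \<Rightarrow> 'b list \<Rightarrow> ('b list \<Rightarrow> 'a)"
  where
    "mixable_shuffle K lam B [] v = delta K v"
  | "mixable_shuffle K lam B (a # u) [] = delta K (a # u)"
  | "mixable_shuffle K lam B (a # u) (b # v) = (\<lambda>w.
        prepend K a (mixable_shuffle K lam B u (b # v)) w
      \<oplus>\<^bsub>K\<^esub> prepend K b (mixable_shuffle K lam B (a # u) v) w
      \<oplus>\<^bsub>K\<^esub> lam \<otimes>\<^bsub>K\<^esub> prepend K (a \<otimes>\<^bsub>B\<^esub> b) (mixable_shuffle K lam B u v) w)"

text \<open>The direct sum over \<open>n \<ge> 1\<close> of the \<open>n\<close>-fold tensor powers of \<open>B\<close> is the free module on all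
  nonempty words modulo multilinearity in each letter (the relations preserve word length).
  There is no unit.\<close>

definition word_free ::
  "('a, 'k) ring_scheme \<Rightarrow> 'a \<Rightarrow> ('a, 'b, 'm) module_scheme \<Rightarrow> ('a, 'b list \<Rightarrow> 'a) module"
  where "word_free K lam B =
    free_algebra K {w. w \<noteq> [] \<and> set w \<subseteq> carrier B} (mixable_shuffle K lam B) undefined"

definition word_rels ::
  "('a, 'k) ring_scheme \<Rightarrow> 'a \<Rightarrow> ('a, 'b, 'm) module_scheme \<Rightarrow> ('b list \<Rightarrow> 'a) set"
  where "word_rels K lam B = (let W = word_free K lam B in span_of K W (
    {delta K (u @ [b \<oplus>\<^bsub>B\<^esub> b'] @ v) \<ominus>\<^bsub>W\<^esub> (delta K (u @ [b] @ v) \<oplus>\<^bsub>W\<^esub> delta K (u @ [b'] @ v)) | u b b' v.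
      set u \<subseteq> carrier B \<and> b \<in> carrier B \<and> b' \<in> carrier B \<and> set v \<subseteq> carrier B} \<union>
    {delta K (u @ [c \<odot>\<^bsub>B\<^esub> b] @ v) \<ominus>\<^bsub>W\<^esub> c \<odot>\<^bsub>W\<^esub> delta K (u @ [b] @ v) | c u b v.
      c \<in> carrier K \<and> set u \<subseteq> carrier B \<and> b \<in> carrier B \<and> set v \<subseteq> carrier B}))"

definition Sh_plus ::
  "('a, 'k) ring_scheme \<Rightarrow> 'a \<Rightarrow> ('a, 'b, 'm) module_scheme \<Rightarrow> ('a, ('b list \<Rightarrow> 'a) set) module"
  where "Sh_plus K lam B = alg_quot (word_free K lam B) (word_rels K lam B)"

definition word_tensor ::
  "('a, 'k) ring_scheme \<Rightarrow> 'a \<Rightarrow> ('a, 'b, 'm) module_scheme \<Rightarrow> 'b list \<Rightarrow> ('b list \<Rightarrow> 'a) set"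
  where "word_tensor K lam B w = word_rels K lam B +>\<^bsub>word_free K lam B\<^esub> delta K w"

definition Sh ::
  "('a, 'k) ring_scheme \<Rightarrow> 'a \<Rightarrow> ('a, 'b, 'm) module_scheme
    \<Rightarrow> ('a, ('b \<times> ('a \<times> ('b list \<Rightarrow> 'a) set) \<Rightarrow> 'a) set) module"
  where "Sh K lam B = tensor_alg K B (unitarization K (Sh_plus K lam B))"

text \<open>\<open>b \<otimes> b\<^sub>1 \<otimes> \<dots> \<otimes> b\<^sub>n\<close> for \<open>n \<ge> 1\<close>:\<close>

definition Sh_tensor ::
  "('a, 'k) ring_scheme \<Rightarrow> 'a \<Rightarrow> ('a, 'b, 'm) module_scheme \<Rightarrow> 'b \<Rightarrow> 'b list
    \<Rightarrow> ('b \<times> ('a \<times> ('b list \<Rightarrow> 'a) set) \<Rightarrow> 'a) set"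
  where "Sh_tensor K lam B b w =
    tensor K B (unitarization K (Sh_plus K lam B)) b (\<zero>\<^bsub>K\<^esub>, word_tensor K lam B w)"


section \<open>Partially defined Rota--Baxter operators\<close>

locale partial_rota_baxter = nonunital_comm_algebra K R for K (structure) and R (structure) +
  fixes lam :: 'a and D :: "'c set" and P :: "'c \<Rightarrow> 'c"
  assumes weight_closed: "lam \<in> carrier K"
    and domain_submodule: "submodule D K R"
    and operator_linear: "P \<in> module_hom K (R\<lparr>carrier := D\<rparr>) R"
    and rota_baxter: "\<lbrakk>f \<in> D; g \<in> D; f \<otimes>\<^bsub>R\<^esub> P g \<in> D; P f \<otimes>\<^bsub>R\<^esub> g \<in> D; f \<otimes>\<^bsub>R\<^esub> g \<in> D\<rbrakk> \<Longrightarrow>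
      P f \<otimes>\<^bsub>R\<^esub> P g = P (f \<otimes>\<^bsub>R\<^esub> P g) \<oplus>\<^bsub>R\<^esub> P (P f \<otimes>\<^bsub>R\<^esub> g) \<oplus>\<^bsub>R\<^esub> lam \<odot>\<^bsub>R\<^esub> P (f \<otimes>\<^bsub>R\<^esub> g)"

fun P_iter :: "('a, 'b, 'm) module_scheme \<Rightarrow> ('b \<Rightarrow> 'b) \<Rightarrow> 'b list \<Rightarrow> 'b"
  where
    "P_iter R P [] = undefined"
  | "P_iter R P [f] = P f"
  | "P_iter R P (f # g # fs) = P (f \<otimes>\<^bsub>R\<^esub> P_iter R P (g # fs))"

fun P_iter_defined :: "('a, 'b, 'm) module_scheme \<Rightarrow> 'b set \<Rightarrow> ('b \<Rightarrow> 'b) \<Rightarrow> 'b list \<Rightarrow> bool"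
  where
    "P_iter_defined R D P [] = False"
  | "P_iter_defined R D P [f] = (f \<in> D)"
  | "P_iter_defined R D P (f # g # fs) =
      (P_iter_defined R D P (g # fs) \<and> f \<otimes>\<^bsub>R\<^esub> P_iter R P (g # fs) \<in> D)"

text \<open>Subalgebras and ideals of \<open>K\<close>-algebras are \<open>K\<close>-submodules; \<open>Fil 0 = A\<close> is not required.\<close>

locale filtered_subalgebra =
  fixes K :: "('a, 'k) ring_scheme" and R :: "('a, 'b, 'm) module_scheme"
    and A :: "'b set" and Fil :: "nat \<Rightarrow> 'b set"
  assumes sub_submodule: "submodule A K R"
    and sub_mult: "a \<in> A \<Longrightarrow> b \<in> A \<Longrightarrow> a \<otimes>\<^bsub>R\<^esub> b \<in> A"
    and Fil_submodule: "submodule (Fil n) K R"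
    and Fil_subset: "Fil n \<subseteq> A"
    and Fil_ideal: "a \<in> A \<Longrightarrow> b \<in> Fil n \<Longrightarrow> a \<otimes>\<^bsub>R\<^esub> b \<in> Fil n"
    and Fil_decreasing: "Fil (Suc n) \<subseteq> Fil n"
    and Fil_mult: "a \<in> Fil m \<Longrightarrow> b \<in> Fil n \<Longrightarrow> a \<otimes>\<^bsub>R\<^esub> b \<in> Fil (m + n)"

definition admissible :: "'b set \<Rightarrow> (nat \<Rightarrow> 'b set) \<Rightarrow> nat \<Rightarrow> 'b list set"
  where "admissible A Fil k = {fs. fs \<noteq> [] \<and> set fs \<subseteq> A \<and> last fs \<in> Fil k}"

definition iteratedly_summable ::
  "('a, 'b, 'm) module_scheme \<Rightarrow> 'b set \<Rightarrow> ('b \<Rightarrow> 'b) \<Rightarrow> 'b set \<Rightarrow> (nat \<Rightarrow> 'b set) \<Rightarrow> nat \<Rightarrow> bool"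
  where "iteratedly_summable R D P A Fil k \<longleftrightarrow> (\<forall>fs\<in>admissible A Fil k. P_iter_defined R D P fs)"

definition MZV_alg ::
  "('a, 'k) ring_scheme \<Rightarrow> ('a, 'b, 'm) module_scheme \<Rightarrow> ('b \<Rightarrow> 'b) \<Rightarrow> 'b set \<Rightarrow> (nat \<Rightarrow> 'b set) \<Rightarrow> nat
    \<Rightarrow> ('a, 'b, 'm) module_scheme"
  where "MZV_alg K R P A Fil k =
    R\<lparr>carrier := span_of K R (P_iter R P ` admissible A Fil k)\<rparr>"


section \<open>The abstract MZV algebra\<close>

abbreviation unitarized_subalgebra ::
  "('a, 'k) ring_scheme \<Rightarrow> ('a, 'b, 'm) module_scheme \<Rightarrow> 'b set \<Rightarrow> ('a, 'a \<times> 'b) module"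
  where "unitarized_subalgebra K R A \<equiv> unitarization K (R\<lparr>carrier := A\<rparr>)"

text \<open>\<open>1 \<otimes> f\<^sub>1 \<otimes> \<dots> \<otimes> f\<^sub>n\<close> with \<open>f\<^sub>i\<close> in \<open>A\<close>, viewed in the unitarization of \<open>A\<close> as \<open>(0, f\<^sub>i)\<close>:\<close>

definition one_tensor ::
  "('a, 'k) ring_scheme \<Rightarrow> 'a \<Rightarrow> ('a, 'b, 'm) module_scheme \<Rightarrow> 'b set \<Rightarrow> 'b list
    \<Rightarrow> (('a \<times> 'b) \<times> ('a \<times> (('a \<times> 'b) list \<Rightarrow> 'a) set) \<Rightarrow> 'a) set"
  where "one_tensor K lam R A fs =
    Sh_tensor K lam (unitarized_subalgebra K R A)
      \<one>\<^bsub>unitarized_subalgebra K R A\<^esub> (map (\<lambda>f. (\<zero>\<^bsub>K\<^esub>, f)) fs)"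

definition abstract_MZV_alg ::
  "('a, 'k) ring_scheme \<Rightarrow> 'a \<Rightarrow> ('a, 'b, 'm) module_scheme \<Rightarrow> 'b set \<Rightarrow> (nat \<Rightarrow> 'b set) \<Rightarrow> nat
    \<Rightarrow> ('a, (('a \<times> 'b) \<times> ('a \<times> (('a \<times> 'b) list \<Rightarrow> 'a) set) \<Rightarrow> 'a) set) module"
  where "abstract_MZV_alg K lam R A Fil k = (let S = Sh K lam (unitarized_subalgebra K R A) in
    S\<lparr>carrier := span_of K S (one_tensor K lam R A ` admissible A Fil k)\<rparr>)"

text \<open>The linear map \<open>1 \<otimes> f\<^sub>1 \<otimes> \<dots> \<otimes> f\<^sub>n \<mapsto> P (f\<^sub>1 P (f\<^sub>2 \<dots> P f\<^sub>n))\<close> is characterised by a predicate.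
  It is unique, but for general \<open>K\<close> its existence is an additional datum: a sum of tensors
  with last entries in \<open>Fil k\<close> may vanish in a tensor power of \<open>A\<close> without vanishing when the last
  tensor factor is taken to be \<open>Fil k\<close> (e.g. \<open>f \<otimes> 2g = 0\<close> over the integers if \<open>2f = 0\<close>, where
  \<open>2g\<close> is in \<open>Fil k\<close> and \<open>g\<close> is not), and \<open>P\<close> need not be defined outside \<open>Fil k\<close>.\<close>

definition is_MZV_map ::
  "('a, 'k) ring_scheme \<Rightarrow> 'a \<Rightarrow> ('a, 'b, 'm) module_scheme \<Rightarrow> ('b \<Rightarrow> 'b) \<Rightarrow> 'b set
    \<Rightarrow> (nat \<Rightarrow> 'b set) \<Rightarrow> nat
    \<Rightarrow> ((('a \<times> 'b) \<times> ('a \<times> (('a \<times> 'b) list \<Rightarrow> 'a) set) \<Rightarrow> 'a) set \<Rightarrow> 'b) \<Rightarrow> bool"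
  where "is_MZV_map K lam R P A Fil k PP \<longleftrightarrow>
    PP \<in> module_hom K (abstract_MZV_alg K lam R A Fil k) (MZV_alg K R P A Fil k) \<and>
    (\<forall>fs\<in>admissible A Fil k. PP (one_tensor K lam R A fs) = P_iter R P fs)"


section \<open>Evaluation of polynomials\<close>

text \<open>Multivariate polynomials over \<open>K\<close> are those of \<^theory>\<open>HOL-Algebra.Indexed_Polynomials\<close>:
  finitely supported functions on multisets of variables. For a polynomial without constant term,
  evaluation does not involve the unit of \<open>M\<close>, hence makes sense in a nonunitary algebra.\<close>

fun list_prod :: "('a, 'b, 'm) module_scheme \<Rightarrow> 'b list \<Rightarrow> 'b"
  where
    "list_prod M [] = \<one>\<^bsub>M\<^esub>"
  | "list_prod M [x] = x"
  | "list_prod M (x # y # xs) = x \<otimes>\<^bsub>M\<^esub> list_prod M (y # xs)"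

definition poly_eval ::
  "('a, 'k) ring_scheme \<Rightarrow> ('a, 'b, 'm) module_scheme \<Rightarrow> (nat multiset \<Rightarrow> 'a) \<Rightarrow> (nat \<Rightarrow> 'b) \<Rightarrow> 'b"
  where "poly_eval K M F x = (\<Oplus>\<^bsub>M\<^esub>m \<in> {m. F m \<noteq> \<zero>\<^bsub>K\<^esub>}.
    F m \<odot>\<^bsub>M\<^esub> list_prod M (map x (sorted_list_of_multiset m)))"

end

theory Submission
  imports Defs
begin

text \<open>The point is that \<open>\<PP>\<^sub>k\<close> is multiplicative: then it commutes with the evaluation of
  \<open>F\<close>, and so does \<open>\<nu> \<circ> \<PP>\<^sub>k\<close>. By bilinearity this need only be checked on generators. The
  product of \<open>1 \<otimes> f\<^sub>1 \<otimes> \<dots> \<otimes> f\<^sub>m\<close> and \<open>1 \<otimes> g\<^sub>1 \<otimes> \<dots> \<otimes> g\<^sub>n\<close> is \<open>1\<close> tensored with their mixable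
  shuffle, and the Rota--Baxter identity for \<open>P f P g\<close> with \<open>f = f\<^sub>1 P\<^bsub>(f\<^sub>2, \<dots>, f\<^sub>m)\<^esub>\<close> and
  \<open>g = g\<^sub>1 P\<^bsub>(g\<^sub>2, \<dots>, g\<^sub>n)\<^esub>\<close> is the recursion that defines the shuffle. Associativity of the shuffle
  product is never needed, but the relations that define the tensor powers must be shown to
  form an ideal for it.\<close>

section \<open>Commutative, not necessarily associative algebras\<close>

text \<open>Two obstacles shape the argument. First, \<open>P\<close> obeys the Rota--Baxter
  identity only if five elements lie in \<open>D\<close>, while summability speaks of the arguments
  of admissible words alone. Elements such as a letter times a product of two iterated values are
  not of that form. They are, however, values of linear combinations of admissible words, and
  \<open>D\<close> is a submodule. So domain membership and the value of a shuffle come out of one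
  and the same induction. The ideal property of the filtration enters there as well: when two last
  letters are merged, their product must still lie in \<open>Fil k\<close>. Second,
  \<open>PP\<close> is given only on a span inside a quotient, by its values on generators. The
  recursion is therefore carried out on combinations of words before any relation is imposed, and
  \<open>PP\<close> meets a shuffle only as a whole. That the multilinearity relations form an ideal
  is also proved by recursion: a letter that varies linearly may come first, be multiplied by
  another letter, or stay deep inside the word, and each case must remain linear modulo the
  relations.\<close>

locale comm_nonassoc_algebra = module K M for K (structure) and M (structure) +
  assumes mult_closed: "x \<in> carrier M \<Longrightarrow> y \<in> carrier M \<Longrightarrow> x \<otimes>\<^bsub>M\<^esub> y \<in> carrier M"
    and mult_comm: "x \<in> carrier M \<Longrightarrow> y \<in> carrier M \<Longrightarrow> x \<otimes>\<^bsub>M\<^esub> y = y \<otimes>\<^bsub>M\<^esub> x"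
    and mult_l_distr: "x \<in> carrier M \<Longrightarrow> y \<in> carrier M \<Longrightarrow> z \<in> carrier M \<Longrightarrow>
      (x \<oplus>\<^bsub>M\<^esub> y) \<otimes>\<^bsub>M\<^esub> z = x \<otimes>\<^bsub>M\<^esub> z \<oplus>\<^bsub>M\<^esub> y \<otimes>\<^bsub>M\<^esub> z"
    and smult_mult: "c \<in> carrier K \<Longrightarrow> x \<in> carrier M \<Longrightarrow> y \<in> carrier M \<Longrightarrow>
      (c \<odot>\<^bsub>M\<^esub> x) \<otimes>\<^bsub>M\<^esub> y = c \<odot>\<^bsub>M\<^esub> (x \<otimes>\<^bsub>M\<^esub> y)"
begin

lemma mult_r_distr:
  "x \<in> carrier M \<Longrightarrow> y \<in> carrier M \<Longrightarrow> z \<in> carrier M \<Longrightarrow>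
    z \<otimes>\<^bsub>M\<^esub> (x \<oplus>\<^bsub>M\<^esub> y) = z \<otimes>\<^bsub>M\<^esub> x \<oplus>\<^bsub>M\<^esub> z \<otimes>\<^bsub>M\<^esub> y"
  using mult_l_distr[of x y z] by (simp only: mult_comm[of z] a_closed)

lemma mult_smult:
  "c \<in> carrier K \<Longrightarrow> x \<in> carrier M \<Longrightarrow> y \<in> carrier M \<Longrightarrow>
    x \<otimes>\<^bsub>M\<^esub> (c \<odot>\<^bsub>M\<^esub> y) = c \<odot>\<^bsub>M\<^esub> (x \<otimes>\<^bsub>M\<^esub> y)"
  using smult_mult[of c y x] by (simp only: mult_comm[of x] smult_closed)

lemma zero_mult: "x \<in> carrier M \<Longrightarrow> \<zero>\<^bsub>M\<^esub> \<otimes>\<^bsub>M\<^esub> x = \<zero>\<^bsub>M\<^esub>"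
  using smult_mult[of "\<zero>" "\<zero>\<^bsub>M\<^esub>" x] by (simp add: mult_closed)

lemma mult_zero: "x \<in> carrier M \<Longrightarrow> x \<otimes>\<^bsub>M\<^esub> \<zero>\<^bsub>M\<^esub> = \<zero>\<^bsub>M\<^esub>"
  using mult_comm[of x "\<zero>\<^bsub>M\<^esub>"] zero_mult[of x] by simp

end

lemma comm_nonassoc_algebraI:
  assumes "module K M"
    and "\<And>c x y z. c \<in> carrier K \<Longrightarrow> x \<in> carrier M \<Longrightarrow> y \<in> carrier M \<Longrightarrow> z \<in> carrier M \<Longrightarrow>
      x \<otimes>\<^bsub>M\<^esub> y \<in> carrier M \<and> x \<otimes>\<^bsub>M\<^esub> y = y \<otimes>\<^bsub>M\<^esub> x \<and>
      (x \<oplus>\<^bsub>M\<^esub> y) \<otimes>\<^bsub>M\<^esub> z = x \<otimes>\<^bsub>M\<^esub> z \<oplus>\<^bsub>M\<^esub> y \<otimes>\<^bsub>M\<^esub> z \<and>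
      (c \<odot>\<^bsub>M\<^esub> x) \<otimes>\<^bsub>M\<^esub> y = c \<odot>\<^bsub>M\<^esub> (x \<otimes>\<^bsub>M\<^esub> y)"
  shows "comm_nonassoc_algebra K M"
proof -
  interpret module K M by fact
  show ?thesis
    \<comment> \<open>The premise also quantifies over a scalar; the unit of \<open>K\<close> serves
      as one for the laws that mention none.\<close>
    using assms(2) R.one_closed by unfold_locales blast+
qed

lemma (in comm_nonassoc_algebra) subalgebra:
  assumes "submodule N K M" "\<And>x y. x \<in> N \<Longrightarrow> y \<in> N \<Longrightarrow> x \<otimes>\<^bsub>M\<^esub> y \<in> N"
  shows "comm_nonassoc_algebra K (M\<lparr>carrier := N\<rparr>)"
proof (rule comm_nonassoc_algebraI)
  show "module K (M\<lparr>carrier := N\<rparr>)"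
    by (rule submodule.submodule_is_module[OF assms(1)]) (rule module_axioms)
  fix c x y z
  assume c: "c \<in> carrier K" and "x \<in> carrier (M\<lparr>carrier := N\<rparr>)"
    "y \<in> carrier (M\<lparr>carrier := N\<rparr>)" "z \<in> carrier (M\<lparr>carrier := N\<rparr>)"
  then have xyz: "x \<in> N" "y \<in> N" "x \<in> carrier M" "y \<in> carrier M" "z \<in> carrier M"
    using submoduleE(1)[OF assms(1)] by auto
  show "x \<otimes>\<^bsub>M\<lparr>carrier := N\<rparr>\<^esub> y \<in> carrier (M\<lparr>carrier := N\<rparr>) \<and>
      x \<otimes>\<^bsub>M\<lparr>carrier := N\<rparr>\<^esub> y = y \<otimes>\<^bsub>M\<lparr>carrier := N\<rparr>\<^esub> x \<and>
      (x \<oplus>\<^bsub>M\<lparr>carrier := N\<rparr>\<^esub> y) \<otimes>\<^bsub>M\<lparr>carrier := N\<rparr>\<^esub> z =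
        x \<otimes>\<^bsub>M\<lparr>carrier := N\<rparr>\<^esub> z \<oplus>\<^bsub>M\<lparr>carrier := N\<rparr>\<^esub> y \<otimes>\<^bsub>M\<lparr>carrier := N\<rparr>\<^esub> z \<and>
      (c \<odot>\<^bsub>M\<lparr>carrier := N\<rparr>\<^esub> x) \<otimes>\<^bsub>M\<lparr>carrier := N\<rparr>\<^esub> y =
        c \<odot>\<^bsub>M\<lparr>carrier := N\<rparr>\<^esub> (x \<otimes>\<^bsub>M\<lparr>carrier := N\<rparr>\<^esub> y)"
    using mult_comm[OF xyz(3,4)] mult_l_distr[OF xyz(3-5)] smult_mult[OF c xyz(3,4)] assms(2)[OF xyz(1,2)]
    by simp
qed

lemma (in nonunital_comm_algebra) comm_nonassoc_algebra: "comm_nonassoc_algebra K R"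
  by (intro comm_nonassoc_algebraI conjI module_axioms mult_closed mult_comm mult_l_distr smult_mult)

section \<open>Linear maps\<close>

lemma module_homI:
  assumes "\<And>x. x \<in> carrier M \<Longrightarrow> h x \<in> carrier N"
    and "\<And>x y. x \<in> carrier M \<Longrightarrow> y \<in> carrier M \<Longrightarrow> h (x \<oplus>\<^bsub>M\<^esub> y) = h x \<oplus>\<^bsub>N\<^esub> h y"
    and "\<And>c x. c \<in> carrier K \<Longrightarrow> x \<in> carrier M \<Longrightarrow> h (c \<odot>\<^bsub>M\<^esub> x) = c \<odot>\<^bsub>N\<^esub> h x"
  shows "h \<in> module_hom K M N"
  using assms by (auto simp: module_hom_def)

lemma module_homD:
  assumes "h \<in> module_hom K M N"
  shows "x \<in> carrier M \<Longrightarrow> h x \<in> carrier N"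
    and "x \<in> carrier M \<Longrightarrow> y \<in> carrier M \<Longrightarrow> h (x \<oplus>\<^bsub>M\<^esub> y) = h x \<oplus>\<^bsub>N\<^esub> h y"
    and "c \<in> carrier K \<Longrightarrow> x \<in> carrier M \<Longrightarrow> h (c \<odot>\<^bsub>M\<^esub> x) = c \<odot>\<^bsub>N\<^esub> h x"
  using assms by (auto simp: module_hom_def)

lemma module_hom_zero:
  assumes "module K M" "module K N" "h \<in> module_hom K M N"
  shows "h \<zero>\<^bsub>M\<^esub> = \<zero>\<^bsub>N\<^esub>"
proof -
  interpret M: module K M by fact
  interpret N: module K N by fact
  show ?thesis
    using module_homD(3)[OF assms(3), of "\<zero>\<^bsub>K\<^esub>" "\<zero>\<^bsub>M\<^esub>"] module_homD(1)[OF assms(3), of "\<zero>\<^bsub>M\<^esub>"]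
    by simp
qed

lemma module_hom_minus:
  assumes "module K M" "module K N" "h \<in> module_hom K M N" "x \<in> carrier M" "y \<in> carrier M"
  shows "h (x \<ominus>\<^bsub>M\<^esub> y) = h x \<ominus>\<^bsub>N\<^esub> h y"
proof -
  interpret M: module K M by fact
  interpret N: module K N by fact
  have "\<ominus>\<^bsub>M\<^esub> y = (\<ominus>\<^bsub>K\<^esub> \<one>\<^bsub>K\<^esub>) \<odot>\<^bsub>M\<^esub> y"
    using assms by (simp add: M.smult_l_minus)
  moreover have "\<ominus>\<^bsub>N\<^esub> h y = (\<ominus>\<^bsub>K\<^esub> \<one>\<^bsub>K\<^esub>) \<odot>\<^bsub>N\<^esub> h y"
    using assms by (simp add: N.smult_l_minus module_homD[OF assms(3)])
  ultimately show ?thesis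
    using assms by (simp add: a_minus_def module_homD[OF assms(3)])
qed

lemma module_hom_compose:
  "g \<in> module_hom K M N \<Longrightarrow> h \<in> module_hom K N Q \<Longrightarrow> (\<lambda>x. h (g x)) \<in> module_hom K M Q"
  by (rule module_homI) (simp_all add: module_homD)

lemma module_hom_add:
  assumes "module K N" "g \<in> module_hom K M N" "h \<in> module_hom K M N"
  shows "(\<lambda>x. g x \<oplus>\<^bsub>N\<^esub> h x) \<in> module_hom K M N"
proof -
  interpret N: module K N by fact
  note gh = module_homD[OF assms(2)] module_homD[OF assms(3)]
  show ?thesis
    by (rule module_homI) (simp_all add: gh N.M.a_ac N.smult_r_distr)
qed

lemma module_hom_smult:
  assumes "module K N" "a \<in> carrier K" "h \<in> module_hom K M N"
  shows "(\<lambda>x. a \<odot>\<^bsub>N\<^esub> h x) \<in> module_hom K M N"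
proof -
  interpret N: module K N by fact
  note h = module_homD[OF assms(3)]
  show ?thesis
    by (rule module_homI)
      (simp_all add: h assms(2) N.smult_r_distr N.R.m_comm flip: N.smult_assoc1)
qed

text \<open>\<open>module_hom\<close> constrains a function on the carrier only, so linearity passes
  along an equality that is known just there. Explicit formulas on basis elements hold only for
  arguments in the carrier, hence this form.\<close>

lemma module_hom_cong:
  assumes "\<And>x. x \<in> carrier M \<Longrightarrow> g x = h x" "module K M" "h \<in> module_hom K M N"
  shows "g \<in> module_hom K M N"
proof -
  interpret M: module K M by fact
  show ?thesis
    by (rule module_homI) (simp_all add: assms(1) module_homD[OF assms(3)])
qed

section \<open>Spans, submodules and quotients by ideals\<close>

lemma span_of_superset: "S \<subseteq> span_of K M S"
  by (simp add: span_of_def hull_subset)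

lemma span_of_minimal: "submodule N K M \<Longrightarrow> S \<subseteq> N \<Longrightarrow> span_of K M S \<subseteq> N"
  by (simp add: span_of_def hull_minimal)

context module
begin

lemma submodule_zero: "submodule H R M \<Longrightarrow> \<zero>\<^bsub>M\<^esub> \<in> H"
  using subgroup.one_closed[OF submodule.axioms(1)] by fastforce

lemma submoduleI_smult:
  assumes "H \<subseteq> carrier M" "\<zero>\<^bsub>M\<^esub> \<in> H"
    and "\<And>a b. a \<in> H \<Longrightarrow> b \<in> H \<Longrightarrow> a \<oplus>\<^bsub>M\<^esub> b \<in> H"
    and smult: "\<And>c x. c \<in> carrier R \<Longrightarrow> x \<in> H \<Longrightarrow> c \<odot>\<^bsub>M\<^esub> x \<in> H"
  shows "submodule H R M"
proof (rule submoduleI)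
  \<comment> \<open>Inverses come from multiplication by the scalar minus one.\<close>
  fix a assume "a \<in> H"
  then show "\<ominus>\<^bsub>M\<^esub> a \<in> H"
    using smult[of "\<ominus> \<one>" a] assms(1) by (auto simp: smult_l_minus subset_iff)
qed (use assms in auto)

text \<open>The hull is an intersection of submodules. The carrier belongs to the family, which
  bounds the intersection; each closure property is then inherited from the members.\<close>

lemma span_of_submodule:
  assumes "S \<subseteq> carrier M"
  shows "submodule (span_of R M S) R M"
proof -
  have eq: "span_of R M S = \<Inter>{N. submodule N R M \<and> S \<subseteq> N}"
    by (simp add: span_of_def hull_def)
  have "carrier M \<in> {N. submodule N R M \<and> S \<subseteq> N}"
    using assms carrier_is_submodule by simp
  then have "span_of R M S \<subseteq> carrier M"
    unfolding eq by blast
  then show ?thesis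
    by (rule submoduleI_smult) (auto simp: eq submodule_zero submoduleE)
qed

text \<open>The kernel of \<open>h\<close> is a submodule, so it contains the span as soon as it
  contains the generators. This is how linear maps are shown to kill all relations.\<close>

lemma span_of_kernel:
  assumes "module R N" "h \<in> module_hom R M N" "S \<subseteq> carrier M"
    and "\<And>s. s \<in> S \<Longrightarrow> h s = \<zero>\<^bsub>N\<^esub>" and "x \<in> span_of R M S"
  shows "h x = \<zero>\<^bsub>N\<^esub>"
proof -
  interpret N: module R N by fact
  have "submodule {x \<in> carrier M. h x = \<zero>\<^bsub>N\<^esub>} R M"
    by (rule submoduleI_smult)
      (auto simp: module_homD[OF assms(2)] module_hom_zero[OF module_axioms assms(1,2)])
  from span_of_minimal[OF this, of S] show ?thesis
    using assms(3-5) by auto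
qed

lemma submodule_abelian_subgroup: "submodule I R M \<Longrightarrow> abelian_subgroup I M"
  by (intro abelian_subgroupI2 submodule.axioms(1)) (rule M.a_comm_group)

lemma coset_eq_iff:
  assumes "submodule I R M" "x \<in> carrier M" "y \<in> carrier M"
  shows "I +>\<^bsub>M\<^esub> x = I +>\<^bsub>M\<^esub> y \<longleftrightarrow> x \<ominus>\<^bsub>M\<^esub> y \<in> I"
proof -
  interpret I: abelian_subgroup I M
    by (rule submodule_abelian_subgroup) fact
  have sub: "subgroup I (add_monoid M)"
    using assms(1) by (rule submodule.axioms(1))
  note minus = M.minus_closed[OF assms(2,3)]
  show ?thesis
  proof
    assume "I +>\<^bsub>M\<^esub> x = I +>\<^bsub>M\<^esub> y"
    from M.a_coset_add_inv2[OF this assms(2,3) I.a_subset] show "x \<ominus>\<^bsub>M\<^esub> y \<in> I"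
      using M.a_coset_join1[OF _ minus sub] unfolding a_minus_def by blast
  next
    assume "x \<ominus>\<^bsub>M\<^esub> y \<in> I"
    from M.a_coset_join2[OF minus sub this] show "I +>\<^bsub>M\<^esub> x = I +>\<^bsub>M\<^esub> y"
      unfolding a_minus_def by (rule M.a_coset_add_inv1) (use assms I.a_subset in auto)
  qed
qed

lemma coset_eq_zero_iff:
  assumes "submodule I R M" "x \<in> carrier M"
  shows "I +>\<^bsub>M\<^esub> x = I \<longleftrightarrow> x \<in> I"
  using M.a_coset_join1[OF _ assms(2) submodule.axioms(1)[OF assms(1)]]
    M.a_coset_join2[OF assms(2) submodule.axioms(1)[OF assms(1)]] by (rule iffI)

lemma alg_quot_carrier: "carrier (alg_quot M I) = (\<lambda>x. I +>\<^bsub>M\<^esub> x) ` carrier M"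
  by (auto simp: alg_quot_def FactRing_def A_RCOSETS_def')

lemma alg_quot_zero: "\<zero>\<^bsub>alg_quot M I\<^esub> = I"
  by (simp add: alg_quot_def FactRing_def)

lemma alg_quot_add:
  assumes "submodule I R M" "x \<in> carrier M" "y \<in> carrier M"
  shows "(I +>\<^bsub>M\<^esub> x) \<oplus>\<^bsub>alg_quot M I\<^esub> (I +>\<^bsub>M\<^esub> y) = I +>\<^bsub>M\<^esub> (x \<oplus>\<^bsub>M\<^esub> y)"
  using abelian_subgroup.a_rcos_sum[OF submodule_abelian_subgroup] assms
  by (simp add: alg_quot_def FactRing_def)

lemma mem_cosetD:
  assumes "submodule I R M" "x \<in> carrier M" "y \<in> I +>\<^bsub>M\<^esub> x"
  shows "y \<in> carrier M" "I +>\<^bsub>M\<^esub> y = I +>\<^bsub>M\<^esub> x"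
  using M.a_r_coset_subset_G[OF submoduleE(1)[OF assms(1)] assms(2)] assms(3)
    M.a_repr_independence[OF assms(3,2) submodule.axioms(1)[OF assms(1)]]
  by auto

lemma mem_coset_self:
  "submodule I R M \<Longrightarrow> x \<in> carrier M \<Longrightarrow> x \<in> I +>\<^bsub>M\<^esub> x"
  by (rule abelian_subgroup.a_rcos_self[OF submodule_abelian_subgroup])

text \<open>The scalar action on a coset is defined as a union over its members. All members yield
  the same coset, since \<open>c\<close> times a difference in \<open>I\<close> stays in
  \<open>I\<close>, so the union collapses to it.\<close>

lemma alg_quot_smult:
  assumes I: "submodule I R M" and c: "c \<in> carrier R" and x: "x \<in> carrier M"
  shows "c \<odot>\<^bsub>alg_quot M I\<^esub> (I +>\<^bsub>M\<^esub> x) = I +>\<^bsub>M\<^esub> (c \<odot>\<^bsub>M\<^esub> x)"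
proof -
  have *: "I +>\<^bsub>M\<^esub> (c \<odot>\<^bsub>M\<^esub> y) = I +>\<^bsub>M\<^esub> (c \<odot>\<^bsub>M\<^esub> x)" if "y \<in> I +>\<^bsub>M\<^esub> x" for y
  proof -
    note y = mem_cosetD[OF I x that]
    have "c \<odot>\<^bsub>M\<^esub> (y \<ominus>\<^bsub>M\<^esub> x) \<in> I"
      using y x c I by (simp add: coset_eq_iff submoduleE)
    then show ?thesis
      using y(1) x c I by (simp add: coset_eq_iff a_minus_def smult_r_distr smult_r_minus)
  qed
  have "(\<Union>y\<in>I +>\<^bsub>M\<^esub> x. I +>\<^bsub>M\<^esub> (c \<odot>\<^bsub>M\<^esub> y)) = I +>\<^bsub>M\<^esub> (c \<odot>\<^bsub>M\<^esub> x)"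
    by (rule SUP_eq_const[OF _ *]) (use mem_coset_self[OF I x] in auto)
  then show ?thesis
    by (simp add: alg_quot_def)
qed

lemma alg_quot_module:
  assumes I: "submodule I R M"
  shows "module R (alg_quot M I)"
proof -
  have zero: "\<zero>\<^bsub>alg_quot M I\<^esub> = I +>\<^bsub>M\<^esub> \<zero>\<^bsub>M\<^esub>"
    using submoduleE(1)[OF I] by (simp add: alg_quot_zero)
  note simps = alg_quot_carrier alg_quot_add[OF I] alg_quot_smult[OF I] zero
  have inv: "\<exists>z\<in>carrier M. I +>\<^bsub>M\<^esub> (x \<oplus>\<^bsub>M\<^esub> z) = I +>\<^bsub>M\<^esub> \<zero>\<^bsub>M\<^esub>" if "x \<in> carrier M" for x
    using that by (intro bexI[of _ "\<ominus>\<^bsub>M\<^esub> x"]) (simp_all add: M.r_neg)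
  show ?thesis
  proof (rule moduleI)
    show "cring R" by unfold_locales
    show "abelian_group (alg_quot M I)"
      by (rule abelian_groupI) (auto simp: simps M.a_ac inv)
  qed (auto simp: simps smult_l_distr smult_r_distr smult_assoc1)
qed

lemma alg_quot_hom: "submodule I R M \<Longrightarrow> (\<lambda>x. I +>\<^bsub>M\<^esub> x) \<in> module_hom R M (alg_quot M I)"
  by (rule module_homI) (auto simp: alg_quot_carrier alg_quot_add alg_quot_smult)

end

context comm_nonassoc_algebra
begin

text \<open>Independence of representatives is shown for one factor at a time: \<open>*\<close>
  exchanges the left one, and commutativity turns the same fact into a statement about the right
  one. Hence an ideal condition on left factors suffices.\<close>

lemma alg_quot_mult:
  assumes I: "submodule I K M" and ideal: "\<And>x y. x \<in> I \<Longrightarrow> y \<in> carrier M \<Longrightarrow> x \<otimes>\<^bsub>M\<^esub> y \<in> I"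
    and x: "x \<in> carrier M" and y: "y \<in> carrier M"
  shows "(I +>\<^bsub>M\<^esub> x) \<otimes>\<^bsub>alg_quot M I\<^esub> (I +>\<^bsub>M\<^esub> y) = I +>\<^bsub>M\<^esub> (x \<otimes>\<^bsub>M\<^esub> y)"
proof -
  have *: "I +>\<^bsub>M\<^esub> (x' \<otimes>\<^bsub>M\<^esub> z) = I +>\<^bsub>M\<^esub> (x \<otimes>\<^bsub>M\<^esub> z)"
    if "x' \<in> I +>\<^bsub>M\<^esub> x" "x \<in> carrier M" "z \<in> carrier M" for x x' z
  proof -
    note x' = mem_cosetD[OF I that(2,1)]
    have "x' = (x' \<ominus>\<^bsub>M\<^esub> x) \<oplus>\<^bsub>M\<^esub> x"
      using x'(1) that by (simp add: a_minus_def M.a_assoc M.l_neg)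
    then have "x' \<otimes>\<^bsub>M\<^esub> z = (x' \<ominus>\<^bsub>M\<^esub> x) \<otimes>\<^bsub>M\<^esub> z \<oplus>\<^bsub>M\<^esub> x \<otimes>\<^bsub>M\<^esub> z"
      using mult_l_distr[of "x' \<ominus>\<^bsub>M\<^esub> x" x z] x'(1) that by simp
    moreover have "(x' \<ominus>\<^bsub>M\<^esub> x) \<otimes>\<^bsub>M\<^esub> z \<in> I"
      using x' that by (intro ideal) (simp_all add: coset_eq_iff[OF I])
    ultimately have "x' \<otimes>\<^bsub>M\<^esub> z \<ominus>\<^bsub>M\<^esub> x \<otimes>\<^bsub>M\<^esub> z \<in> I"
      using x'(1) that by (simp add: a_minus_def M.a_assoc M.r_neg mult_closed)
    then show ?thesis
      using x'(1) that by (simp add: coset_eq_iff[OF I] mult_closed)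
  qed
  have **: "I +>\<^bsub>M\<^esub> (x' \<otimes>\<^bsub>M\<^esub> y') = I +>\<^bsub>M\<^esub> (x \<otimes>\<^bsub>M\<^esub> y)"
    if "x' \<in> I +>\<^bsub>M\<^esub> x" "y' \<in> I +>\<^bsub>M\<^esub> y" for x' y'
    using *[OF that(1) x mem_cosetD(1)[OF I y that(2)]] *[OF that(2) y x]
      mult_comm[OF x mem_cosetD(1)[OF I y that(2)]] mult_comm[OF x y] by simp
  have "(\<Union>x'\<in>I +>\<^bsub>M\<^esub> x. \<Union>y'\<in>I +>\<^bsub>M\<^esub> y. I +>\<^bsub>M\<^esub> (x' \<otimes>\<^bsub>M\<^esub> y')) = I +>\<^bsub>M\<^esub> (x \<otimes>\<^bsub>M\<^esub> y)"
    by (rule SUP_eq_const[OF _ SUP_eq_const[OF _ **]])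
      (use mem_coset_self[OF I x] mem_coset_self[OF I y] in auto)
  then show ?thesis
    by (simp add: alg_quot_def FactRing_def rcoset_mult_def)
qed

lemma alg_quot_algebra:
  assumes I: "submodule I K M" and ideal: "\<And>x y. x \<in> I \<Longrightarrow> y \<in> carrier M \<Longrightarrow> x \<otimes>\<^bsub>M\<^esub> y \<in> I"
  shows "comm_nonassoc_algebra K (alg_quot M I)"
proof -
  show ?thesis
  proof (intro comm_nonassoc_algebraI conjI)
    show "module K (alg_quot M I)"
      by (rule alg_quot_module) fact
    fix U V W c
    assume c: "c \<in> carrier K" and "U \<in> carrier (alg_quot M I)" "V \<in> carrier (alg_quot M I)"
      "W \<in> carrier (alg_quot M I)"
    then obtain x y z where [simp]: "U = I +>\<^bsub>M\<^esub> x" "V = I +>\<^bsub>M\<^esub> y" "W = I +>\<^bsub>M\<^esub> z"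
        "x \<in> carrier M" "y \<in> carrier M" "z \<in> carrier M"
      by (auto simp: alg_quot_carrier)
    note simps = alg_quot_add[OF I] alg_quot_smult[OF I] alg_quot_mult[OF I ideal] mult_closed
    show "U \<otimes>\<^bsub>alg_quot M I\<^esub> V \<in> carrier (alg_quot M I)"
      by (simp add: simps) (simp add: alg_quot_carrier mult_closed)
    show "U \<otimes>\<^bsub>alg_quot M I\<^esub> V = V \<otimes>\<^bsub>alg_quot M I\<^esub> U"
      using mult_comm[of x y] by (simp add: simps)
    show "(U \<oplus>\<^bsub>alg_quot M I\<^esub> V) \<otimes>\<^bsub>alg_quot M I\<^esub> W =
        U \<otimes>\<^bsub>alg_quot M I\<^esub> W \<oplus>\<^bsub>alg_quot M I\<^esub> V \<otimes>\<^bsub>alg_quot M I\<^esub> W"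
      by (simp add: simps mult_l_distr)
    show "(c \<odot>\<^bsub>alg_quot M I\<^esub> U) \<otimes>\<^bsub>alg_quot M I\<^esub> V = c \<odot>\<^bsub>alg_quot M I\<^esub> (U \<otimes>\<^bsub>alg_quot M I\<^esub> V)"
      using c by (simp add: simps smult_mult)
  qed
qed

end

section \<open>Unitarization\<close>

lemma unitarization_algebra:
  assumes "comm_nonassoc_algebra K M"
  shows "comm_nonassoc_algebra K (unitarization K M)"
proof -
  interpret M: comm_nonassoc_algebra K M by fact
  have inv: "\<exists>c\<in>carrier K. \<exists>y\<in>carrier M. c \<oplus>\<^bsub>K\<^esub> a = \<zero>\<^bsub>K\<^esub> \<and> y \<oplus>\<^bsub>M\<^esub> x = \<zero>\<^bsub>M\<^esub>"
    if "a \<in> carrier K" "x \<in> carrier M" for a x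
    using that by (intro bexI[of _ "\<ominus>\<^bsub>K\<^esub> a"] bexI[of _ "\<ominus>\<^bsub>M\<^esub> x"]) (simp_all add: M.R.l_neg M.M.l_neg)
  have "module K (unitarization K M)"
  proof (rule moduleI)
    show "cring K" by unfold_locales
    show "abelian_group (unitarization K M)"
      by (rule abelian_groupI) (auto simp: unitarization_def M.R.a_ac M.M.a_ac inv)
  qed (auto simp: unitarization_def M.R.l_distr M.R.r_distr M.R.m_assoc M.smult_l_distr
      M.smult_r_distr M.smult_assoc1)
  then show ?thesis
  proof (intro comm_nonassoc_algebraI conjI)
    fix u v w c
    assume c: "c \<in> carrier K" and "u \<in> carrier (unitarization K M)"
      "v \<in> carrier (unitarization K M)" "w \<in> carrier (unitarization K M)"
    then obtain k l m x y z where [simp]: "u = (k, x)" "v = (l, y)" "w = (m, z)"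
        "k \<in> carrier K" "l \<in> carrier K" "m \<in> carrier K"
        "x \<in> carrier M" "y \<in> carrier M" "z \<in> carrier M"
      by (auto simp: unitarization_def)
    show "u \<otimes>\<^bsub>unitarization K M\<^esub> v \<in> carrier (unitarization K M)"
      by (simp add: unitarization_def M.mult_closed)
    show "u \<otimes>\<^bsub>unitarization K M\<^esub> v = v \<otimes>\<^bsub>unitarization K M\<^esub> u"
      using M.mult_comm[of x y] M.R.m_comm[of k l] M.M.a_comm[of "k \<odot>\<^bsub>M\<^esub> y" "l \<odot>\<^bsub>M\<^esub> x"]
      by (simp add: unitarization_def)
    show "(u \<oplus>\<^bsub>unitarization K M\<^esub> v) \<otimes>\<^bsub>unitarization K M\<^esub> w =
        u \<otimes>\<^bsub>unitarization K M\<^esub> w \<oplus>\<^bsub>unitarization K M\<^esub> v \<otimes>\<^bsub>unitarization K M\<^esub> w"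
      by (simp add: unitarization_def M.mult_closed M.mult_l_distr M.R.l_distr M.smult_l_distr
        M.smult_r_distr M.M.a_ac)
    \<comment> \<open>In the mixed term of the product the scalars occur in the opposite order on
      the two sides; commutativity of \<open>K\<close> exchanges them.\<close>
    have "l \<odot>\<^bsub>M\<^esub> (c \<odot>\<^bsub>M\<^esub> x) = c \<odot>\<^bsub>M\<^esub> (l \<odot>\<^bsub>M\<^esub> x)"
      using c M.smult_assoc1[of l c x] M.smult_assoc1[of c l x] M.R.m_comm[of l c] by simp
    then show "(c \<odot>\<^bsub>unitarization K M\<^esub> u) \<otimes>\<^bsub>unitarization K M\<^esub> v =
        c \<odot>\<^bsub>unitarization K M\<^esub> (u \<otimes>\<^bsub>unitarization K M\<^esub> v)"
      using c by (simp add: unitarization_def M.mult_closed M.smult_mult[OF c] M.smult_assoc1 M.R.m_assoc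
        M.smult_r_distr)
  qed
qed

lemma (in comm_nonassoc_algebra) unitarization_mult:
  assumes "x \<in> carrier M" "y \<in> carrier M"
  shows "(\<zero>\<^bsub>K\<^esub>, x) \<otimes>\<^bsub>unitarization K M\<^esub> (\<zero>\<^bsub>K\<^esub>, y) = (\<zero>\<^bsub>K\<^esub>, x \<otimes>\<^bsub>M\<^esub> y)"
  using assms mult_closed[OF assms] by (simp add: unitarization_def)

section \<open>Free modules with a bilinear product\<close>

lemma free_algebra_simps [simp]:
  "f \<in> carrier (free_algebra K S \<mu> e) \<longleftrightarrow> (\<forall>s. f s \<in> carrier K) \<and>
    (\<forall>s. s \<notin> S \<longrightarrow> f s = \<zero>\<^bsub>K\<^esub>) \<and> finite {s. f s \<noteq> \<zero>\<^bsub>K\<^esub>}"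
  "\<zero>\<^bsub>free_algebra K S \<mu> e\<^esub> = (\<lambda>_. \<zero>\<^bsub>K\<^esub>)"
  "f \<oplus>\<^bsub>free_algebra K S \<mu> e\<^esub> g = (\<lambda>r. f r \<oplus>\<^bsub>K\<^esub> g r)"
  "c \<odot>\<^bsub>free_algebra K S \<mu> e\<^esub> f = (\<lambda>r. c \<otimes>\<^bsub>K\<^esub> f r)"
  by (simp_all add: free_algebra_def)

context cring
begin

lemma free_module:
  fixes S :: "'s set"
  shows "module R (free_algebra R S \<mu> e)"
proof (rule moduleI)
  show "cring R" by (rule is_cring)
  have fin: "finite {s. f s \<oplus> g s \<noteq> \<zero>}" if "finite {s. f s \<noteq> \<zero>}" "finite {s. g s \<noteq> \<zero>}"
    for f g :: "'s \<Rightarrow> 'a"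
    by (rule finite_subset[OF _ finite_UnI[OF that]]) auto
  show "abelian_group (free_algebra R S \<mu> e)"
  proof (rule abelian_groupI)
    fix f assume f: "f \<in> carrier (free_algebra R S \<mu> e)"
    have "(\<lambda>s. \<ominus> f s) \<in> carrier (free_algebra R S \<mu> e)"
      using f by (auto intro: finite_subset[of _ "{s. f s \<noteq> \<zero>}"])
    moreover have "(\<lambda>s. \<ominus> f s) \<oplus>\<^bsub>free_algebra R S \<mu> e\<^esub> f = \<zero>\<^bsub>free_algebra R S \<mu> e\<^esub>"
      using f by (auto simp: l_neg)
    ultimately show "\<exists>g\<in>carrier (free_algebra R S \<mu> e).
        g \<oplus>\<^bsub>free_algebra R S \<mu> e\<^esub> f = \<zero>\<^bsub>free_algebra R S \<mu> e\<^esub>"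
      by (intro bexI[of _ "\<lambda>s. \<ominus> f s"])
  qed (auto simp: fin a_ac)
  show "c \<odot>\<^bsub>free_algebra R S \<mu> e\<^esub> f \<in> carrier (free_algebra R S \<mu> e)"
    if "c \<in> carrier R" "f \<in> carrier (free_algebra R S \<mu> e)" for c f
    using that by (auto intro: finite_subset[of _ "{s. f s \<noteq> \<zero>}"])
qed (auto simp: l_distr r_distr m_assoc)

lemma delta_closed: "s \<in> S \<Longrightarrow> delta R s \<in> carrier (free_algebra R S \<mu> e)"
  by (auto simp: delta_def)

text \<open>A finitely supported function is built by adding multiples of basis elements. The
  induction runs over a finite set bounding the support, with \<open>f\<close> quantified inside, so
  that \<open>f(u := \<zero>)\<close> falls under the hypothesis.\<close>

lemma free_algebra_induct:
  fixes S :: "'s set"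
  assumes N: "submodule N R (free_algebra R S \<mu> e)" and delta: "\<And>s. s \<in> S \<Longrightarrow> delta R s \<in> N"
    and "f \<in> carrier (free_algebra R S \<mu> e)"
  shows "f \<in> N"
proof -
  interpret F: module R "free_algebra R S \<mu> e" by (rule free_module)
  have "\<forall>f\<in>carrier (free_algebra R S \<mu> e). {s. f s \<noteq> \<zero>} \<subseteq> U \<longrightarrow> f \<in> N" if "finite U" for U
    using that
  proof induction
    case empty
    show ?case
    proof (intro ballI impI)
      fix f :: "'s \<Rightarrow> 'a" assume "{s. f s \<noteq> \<zero>} \<subseteq> {}"
      then have "f = \<zero>\<^bsub>free_algebra R S \<mu> e\<^esub>" by auto
      then show "f \<in> N" using F.submodule_zero[OF N] by (simp only:)
    qed
  next
    case (insert u U)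
    show ?case
    proof (intro ballI impI)
      fix f assume f: "f \<in> carrier (free_algebra R S \<mu> e)" "{s. f s \<noteq> \<zero>} \<subseteq> insert u U"
      show "f \<in> N"
      proof (cases "u \<in> S")
        case True
        have "f(u := \<zero>) \<in> carrier (free_algebra R S \<mu> e)" "{s. (f(u := \<zero>)) s \<noteq> \<zero>} \<subseteq> U"
          using f by (auto intro: finite_subset[of _ "{s. f s \<noteq> \<zero>}"])
        with insert.IH have 1: "f(u := \<zero>) \<in> N" by blast
        have 2: "f u \<odot>\<^bsub>free_algebra R S \<mu> e\<^esub> delta R u \<in> N"
          using f(1) by (intro F.submoduleE(4)[OF N] delta True) simp
        have "f = f(u := \<zero>) \<oplus>\<^bsub>free_algebra R S \<mu> e\<^esub> (f u \<odot>\<^bsub>free_algebra R S \<mu> e\<^esub> delta R u)"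
          using f(1) by (auto simp: delta_def)
        then show ?thesis
          using F.submoduleE(5)[OF N 1 2] by simp
      next
        case False
        then have "{s. f s \<noteq> \<zero>} \<subseteq> U" using f by auto
        then show ?thesis using insert.IH f(1) by blast
      qed
    qed
  qed
  from this[of "{s. f s \<noteq> \<zero>}"] assms(3) show ?thesis by simp
qed

\<comment> \<open>Free algebras from a commutative multiplication table\<close>
end

text \<open>Both tables of interest fit here: for the tensor product the entries are single basis
  elements, for the shuffle algebra they are linear combinations of words.\<close>

locale free_algebra_product = cring K for K (structure) +
  fixes S :: "'s set" and \<mu> :: "'s \<Rightarrow> 's \<Rightarrow> ('s \<Rightarrow> 'a)" and e :: "'s \<Rightarrow> 'a"
  assumes product_closed: "s \<in> S \<Longrightarrow> t \<in> S \<Longrightarrow> \<mu> s t \<in> carrier (free_algebra K S \<mu> e)"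
    and product_comm: "s \<in> S \<Longrightarrow> t \<in> S \<Longrightarrow> \<mu> s t = \<mu> t s"
begin

abbreviation T where "T \<equiv> free_algebra K S \<mu> e"

lemma term_closed:
  assumes "f \<in> carrier T" "g \<in> carrier T" "U \<subseteq> S" "V \<subseteq> S"
  shows "(\<lambda>p. f (fst p) \<otimes> g (snd p) \<otimes> \<mu> (fst p) (snd p) r) \<in> U \<times> V \<rightarrow> carrier K"
proof
  fix p assume "p \<in> U \<times> V"
  then have "\<mu> (fst p) (snd p) \<in> carrier T"
    using assms(3,4) by (intro product_closed) auto
  then show "f (fst p) \<otimes> g (snd p) \<otimes> \<mu> (fst p) (snd p) r \<in> carrier K"
    using assms(1,2) by simp
qed

text \<open>The defining sum runs over the exact supports, which change with the factors. Any larger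
  finite rectangle inside \<open>S\<close> gives the same value, as the extra terms contain a zero
  coefficient; so several products can be compared over one index set.\<close>

lemma mult_eq_finsum:
  assumes "f \<in> carrier T" "g \<in> carrier T" "finite U" "finite V" "U \<subseteq> S" "V \<subseteq> S"
    and "{s. f s \<noteq> \<zero>} \<subseteq> U" "{s. g s \<noteq> \<zero>} \<subseteq> V"
  shows "(f \<otimes>\<^bsub>T\<^esub> g) r = (\<Oplus>p\<in>U \<times> V. f (fst p) \<otimes> g (snd p) \<otimes> \<mu> (fst p) (snd p) r)"
proof -
  have "(\<Oplus>p\<in>{s. f s \<noteq> \<zero>} \<times> {s. g s \<noteq> \<zero>}. f (fst p) \<otimes> g (snd p) \<otimes> \<mu> (fst p) (snd p) r)
      = (\<Oplus>p\<in>U \<times> V. f (fst p) \<otimes> g (snd p) \<otimes> \<mu> (fst p) (snd p) r)"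
  proof (rule add.finprod_mono_neutral_cong_left)
    fix p assume p: "p \<in> U \<times> V - {s. f s \<noteq> \<zero>} \<times> {s. g s \<noteq> \<zero>}"
    then have "\<mu> (fst p) (snd p) \<in> carrier T"
      using assms(5,6) by (intro product_closed) auto
    moreover have "f (fst p) = \<zero> \<or> g (snd p) = \<zero>"
      using p by auto
    ultimately show "f (fst p) \<otimes> g (snd p) \<otimes> \<mu> (fst p) (snd p) r = \<zero>"
      using assms(1,2) by auto
  qed (use assms(3,4,7,8) in \<open>auto intro!: term_closed[OF assms(1,2,5,6)]\<close>)
  then show ?thesis
    by (simp add: free_algebra_def)
qed

lemma support:
  assumes "f \<in> carrier T"
  shows "finite {s. f s \<noteq> \<zero>}" "{s. f s \<noteq> \<zero>} \<subseteq> S"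
  using assms by auto

lemma free_mult_closed:
  assumes f: "f \<in> carrier T" and g: "g \<in> carrier T"
  shows "f \<otimes>\<^bsub>T\<^esub> g \<in> carrier T"
proof -
  let ?U = "{s. f s \<noteq> \<zero>}" and ?V = "{s. g s \<noteq> \<zero>}"
  note eq = mult_eq_finsum[OF f g support(1)[OF f] support(1)[OF g] support(2)[OF f] support(2)[OF g]
      subset_refl subset_refl]
  \<comment> \<open>A coefficient vanishes where no entry of the table reaches. This yields both the
    finite support of the product and its vanishing outside \<open>S\<close>.\<close>
  have zero: "(f \<otimes>\<^bsub>T\<^esub> g) r = \<zero>" if "\<And>s t. s \<in> ?U \<Longrightarrow> t \<in> ?V \<Longrightarrow> \<mu> s t r = \<zero>" for r
  proof -
    have "(\<Oplus>p\<in>?U \<times> ?V. f (fst p) \<otimes> g (snd p) \<otimes> \<mu> (fst p) (snd p) r) = (\<Oplus>p\<in>?U \<times> ?V. \<zero>)"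
      using that f g by (intro add.finprod_cong') auto
    then show ?thesis unfolding eq by simp
  qed
  have "{r. (f \<otimes>\<^bsub>T\<^esub> g) r \<noteq> \<zero>} \<subseteq> (\<Union>s\<in>?U. \<Union>t\<in>?V. {r. \<mu> s t r \<noteq> \<zero>})"
    using zero by blast
  moreover have "finite (\<Union>s\<in>?U. \<Union>t\<in>?V. {r. \<mu> s t r \<noteq> \<zero>})"
  proof (intro finite_UN_I support(1) f g)
    fix s t assume "s \<in> ?U" "t \<in> ?V"
    then show "\<mu> s t \<in> carrier T"
      using support(2)[OF f] support(2)[OF g] by (intro product_closed) blast+
  qed
  ultimately have "finite {r. (f \<otimes>\<^bsub>T\<^esub> g) r \<noteq> \<zero>}"
    by (rule finite_subset)
  moreover have "(f \<otimes>\<^bsub>T\<^esub> g) r \<in> carrier K" for r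
    unfolding eq by (rule finsum_closed[OF term_closed[OF f g support(2)[OF f] support(2)[OF g]]])
  moreover have "(f \<otimes>\<^bsub>T\<^esub> g) r = \<zero>" if "r \<notin> S" for r
  proof (rule zero)
    fix s t assume "s \<in> ?U" "t \<in> ?V"
    then have "\<mu> s t \<in> carrier T"
      using support(2)[OF f] support(2)[OF g] by (intro product_closed) blast+
    then show "\<mu> s t r = \<zero>" using that by simp
  qed
  ultimately show ?thesis by (simp only: free_algebra_simps) blast
qed

lemma free_mult_comm:
  assumes f: "f \<in> carrier T" and g: "g \<in> carrier T"
  shows "f \<otimes>\<^bsub>T\<^esub> g = g \<otimes>\<^bsub>T\<^esub> f"
proof
  fix r
  let ?U = "{s. f s \<noteq> \<zero>}" and ?V = "{s. g s \<noteq> \<zero>}"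
  note sf = support[OF f] and sg = support[OF g]
  have "(g \<otimes>\<^bsub>T\<^esub> f) r = (\<Oplus>p\<in>prod.swap ` (?U \<times> ?V). g (fst p) \<otimes> f (snd p) \<otimes> \<mu> (fst p) (snd p) r)"
    unfolding product_swap by (rule mult_eq_finsum[OF g f sg(1) sf(1) sg(2) sf(2)]) auto
  also have "\<dots> = (\<Oplus>p\<in>?U \<times> ?V. g (snd p) \<otimes> f (fst p) \<otimes> \<mu> (snd p) (fst p) r)"
    using term_closed[OF g f sg(2) sf(2), of r] by (subst finsum_reindex) (auto simp: inj_on_def)
  also have "\<dots> = (\<Oplus>p\<in>?U \<times> ?V. f (fst p) \<otimes> g (snd p) \<otimes> \<mu> (fst p) (snd p) r)"
  proof (rule finsum_cong'[OF refl term_closed[OF f g sf(2) sg(2)]])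
    fix p assume "p \<in> ?U \<times> ?V"
    then have "fst p \<in> S" "snd p \<in> S" using sf sg by auto
    then show "g (snd p) \<otimes> f (fst p) \<otimes> \<mu> (snd p) (fst p) r = f (fst p) \<otimes> g (snd p) \<otimes> \<mu> (fst p) (snd p) r"
      using f g product_comm[of "fst p" "snd p"] m_comm[of "f (fst p)" "g (snd p)"] by simp
  qed
  also have "\<dots> = (f \<otimes>\<^bsub>T\<^esub> g) r"
    by (rule mult_eq_finsum[OF f g sf(1) sg(1) sf(2) sg(2), symmetric]) auto
  finally show "(f \<otimes>\<^bsub>T\<^esub> g) r = (g \<otimes>\<^bsub>T\<^esub> f) r" ..
qed

lemma free_mult_distr:
  assumes f: "f \<in> carrier T" and g: "g \<in> carrier T" and h: "h \<in> carrier T"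
  shows "(f \<oplus>\<^bsub>T\<^esub> g) \<otimes>\<^bsub>T\<^esub> h = f \<otimes>\<^bsub>T\<^esub> h \<oplus>\<^bsub>T\<^esub> g \<otimes>\<^bsub>T\<^esub> h"
proof
  fix r
  interpret F: module K T by (rule free_module)
  \<comment> \<open>Cancellation can make the support of the sum smaller than this union, so all
    three products are expanded over the union.\<close>
  let ?U = "{s. f s \<noteq> \<zero>} \<union> {s. g s \<noteq> \<zero>}" and ?V = "{s. h s \<noteq> \<zero>}"
  have fg: "f \<oplus>\<^bsub>T\<^esub> g \<in> carrier T" using f g by (rule F.M.a_closed)
  have U: "finite ?U" "?U \<subseteq> S" using support[OF f] support[OF g] by auto
  note V = support[OF h]
  note eq = mult_eq_finsum[OF _ h U(1) V(1) U(2) V(2) _ subset_refl, of _ r]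
  note closed = term_closed[OF _ h U(2) V(2), of _ r]
  have "((f \<oplus>\<^bsub>T\<^esub> g) \<otimes>\<^bsub>T\<^esub> h) r =
      (\<Oplus>p\<in>?U \<times> ?V. (f \<oplus>\<^bsub>T\<^esub> g) (fst p) \<otimes> h (snd p) \<otimes> \<mu> (fst p) (snd p) r)"
    using f g by (intro eq[OF fg]) auto
  also have "\<dots> = (\<Oplus>p\<in>?U \<times> ?V. f (fst p) \<otimes> h (snd p) \<otimes> \<mu> (fst p) (snd p) r \<oplus>
      g (fst p) \<otimes> h (snd p) \<otimes> \<mu> (fst p) (snd p) r)"
  proof (rule finsum_cong'[OF refl])
    show "(\<lambda>p. f (fst p) \<otimes> h (snd p) \<otimes> \<mu> (fst p) (snd p) r \<oplus>
        g (fst p) \<otimes> h (snd p) \<otimes> \<mu> (fst p) (snd p) r) \<in> ?U \<times> ?V \<rightarrow> carrier K"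
      using closed[OF f] closed[OF g] by blast
    fix p assume "p \<in> ?U \<times> ?V"
    then have "\<mu> (fst p) (snd p) \<in> carrier T"
      using U(2) V(2) by (intro product_closed) auto
    then show "(f \<oplus>\<^bsub>T\<^esub> g) (fst p) \<otimes> h (snd p) \<otimes> \<mu> (fst p) (snd p) r =
        f (fst p) \<otimes> h (snd p) \<otimes> \<mu> (fst p) (snd p) r \<oplus>
        g (fst p) \<otimes> h (snd p) \<otimes> \<mu> (fst p) (snd p) r"
      using f g h by (simp add: l_distr)
  qed
  also have "\<dots> = (f \<otimes>\<^bsub>T\<^esub> h) r \<oplus> (g \<otimes>\<^bsub>T\<^esub> h) r"
    unfolding eq[OF f Un_upper1] eq[OF g Un_upper2] by (rule finsum_addf[OF closed[OF f] closed[OF g]])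
  finally show "((f \<oplus>\<^bsub>T\<^esub> g) \<otimes>\<^bsub>T\<^esub> h) r = (f \<otimes>\<^bsub>T\<^esub> h \<oplus>\<^bsub>T\<^esub> g \<otimes>\<^bsub>T\<^esub> h) r"
    by simp
qed

lemma free_smult_mult:
  assumes c: "c \<in> carrier K" and f: "f \<in> carrier T" and h: "h \<in> carrier T"
  shows "(c \<odot>\<^bsub>T\<^esub> f) \<otimes>\<^bsub>T\<^esub> h = c \<odot>\<^bsub>T\<^esub> (f \<otimes>\<^bsub>T\<^esub> h)"
proof
  fix r
  interpret F: module K T by (rule free_module)
  let ?U = "{s. f s \<noteq> \<zero>}" and ?V = "{s. h s \<noteq> \<zero>}"
  note U = support[OF f] and V = support[OF h]
  note eq = mult_eq_finsum[OF _ h U(1) V(1) U(2) V(2) _ subset_refl, of _ r]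
  note closed = term_closed[OF _ h U(2) V(2), of _ r]
  have "((c \<odot>\<^bsub>T\<^esub> f) \<otimes>\<^bsub>T\<^esub> h) r =
      (\<Oplus>p\<in>?U \<times> ?V. (c \<odot>\<^bsub>T\<^esub> f) (fst p) \<otimes> h (snd p) \<otimes> \<mu> (fst p) (snd p) r)"
    using c f by (intro eq[OF F.smult_closed[OF c f]]) auto
  also have "\<dots> = (\<Oplus>p\<in>?U \<times> ?V. c \<otimes> (f (fst p) \<otimes> h (snd p) \<otimes> \<mu> (fst p) (snd p) r))"
  proof (rule finsum_cong'[OF refl])
    show "(\<lambda>p. c \<otimes> (f (fst p) \<otimes> h (snd p) \<otimes> \<mu> (fst p) (snd p) r)) \<in> ?U \<times> ?V \<rightarrow> carrier K"
      using closed[OF f] c by blast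
    fix p assume "p \<in> ?U \<times> ?V"
    then have "\<mu> (fst p) (snd p) \<in> carrier T"
      using U(2) V(2) by (intro product_closed) auto
    then show "(c \<odot>\<^bsub>T\<^esub> f) (fst p) \<otimes> h (snd p) \<otimes> \<mu> (fst p) (snd p) r =
        c \<otimes> (f (fst p) \<otimes> h (snd p) \<otimes> \<mu> (fst p) (snd p) r)"
      using c f h by (simp add: m_assoc)
  qed
  also have "\<dots> = c \<otimes> (f \<otimes>\<^bsub>T\<^esub> h) r"
    unfolding eq[OF f subset_refl]
    by (rule finsum_rdistr[symmetric, OF _ c closed[OF f]]) (use U V in simp)
  finally show "((c \<odot>\<^bsub>T\<^esub> f) \<otimes>\<^bsub>T\<^esub> h) r = (c \<odot>\<^bsub>T\<^esub> (f \<otimes>\<^bsub>T\<^esub> h)) r"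
    by simp
qed

lemma free_algebra: "comm_nonassoc_algebra K T"
  by (intro comm_nonassoc_algebraI conjI free_module free_mult_closed free_mult_comm free_mult_distr
      free_smult_mult)

lemma delta_mult:
  assumes "s \<in> S" "t \<in> S"
  shows "delta K s \<otimes>\<^bsub>T\<^esub> delta K t = \<mu> s t"
proof
  fix r
  have \<mu>: "\<mu> s t r \<in> carrier K"
    using product_closed[OF assms] by simp
  \<comment> \<open>Singletons are used in place of the supports, which are empty if
    \<open>K\<close> is the zero ring.\<close>
  have "(delta K s \<otimes>\<^bsub>T\<^esub> delta K t) r =
      (\<Oplus>p\<in>{s} \<times> {t}. delta K s (fst p) \<otimes> delta K t (snd p) \<otimes> \<mu> (fst p) (snd p) r)"
    using assms by (intro mult_eq_finsum delta_closed) (auto simp: delta_def)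
  also have "\<dots> = \<mu> s t r"
    using \<mu> by (simp add: delta_def finsum_insert)
  finally show "(delta K s \<otimes>\<^bsub>T\<^esub> delta K t) r = \<mu> s t r" .
qed

text \<open>Bilinearity is used twice. For a fixed basis element, the left factors whose product
  stays in the span form a submodule containing \<open>G\<close>; then, for a fixed element of the
  span, the admissible right factors form a submodule containing all basis elements.\<close>

lemma span_ideal:
  assumes G: "G \<subseteq> carrier T"
    and ideal: "\<And>g s. g \<in> G \<Longrightarrow> s \<in> S \<Longrightarrow> g \<otimes>\<^bsub>T\<^esub> delta K s \<in> span_of K T G"
    and x: "x \<in> span_of K T G" and y: "y \<in> carrier T"
  shows "x \<otimes>\<^bsub>T\<^esub> y \<in> span_of K T G"
proof -
  interpret T: comm_nonassoc_algebra K T by (rule free_algebra)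
  let ?I = "span_of K T G"
  have I: "submodule ?I K T" by (rule T.span_of_submodule[OF G])
  note IE = T.submoduleE[OF I]
  have *: "x \<otimes>\<^bsub>T\<^esub> delta K s \<in> ?I" if x: "x \<in> ?I" and s: "s \<in> S" for x s
  proof -
    note d = delta_closed[OF s]
    have "submodule {x \<in> carrier T. x \<otimes>\<^bsub>T\<^esub> delta K s \<in> ?I} K T"
    proof (rule T.submoduleI_smult)
      show "\<zero>\<^bsub>T\<^esub> \<in> {x \<in> carrier T. x \<otimes>\<^bsub>T\<^esub> delta K s \<in> ?I}"
        using T.submodule_zero[OF I] T.zero_mult[OF d] T.M.zero_closed by (simp only: mem_Collect_eq)
      fix a b assume "a \<in> {x \<in> carrier T. x \<otimes>\<^bsub>T\<^esub> delta K s \<in> ?I}"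
        "b \<in> {x \<in> carrier T. x \<otimes>\<^bsub>T\<^esub> delta K s \<in> ?I}"
      then show "a \<oplus>\<^bsub>T\<^esub> b \<in> {x \<in> carrier T. x \<otimes>\<^bsub>T\<^esub> delta K s \<in> ?I}"
        using T.mult_l_distr[OF _ _ d, of a b] IE(5) T.M.a_closed by (simp only: mem_Collect_eq)
    next
      fix c x assume c: "c \<in> carrier K" and "x \<in> {x \<in> carrier T. x \<otimes>\<^bsub>T\<^esub> delta K s \<in> ?I}"
      then show "c \<odot>\<^bsub>T\<^esub> x \<in> {x \<in> carrier T. x \<otimes>\<^bsub>T\<^esub> delta K s \<in> ?I}"
        using T.smult_mult[OF c _ d, of x] IE(4)[OF c] T.smult_closed[OF c] by (simp only: mem_Collect_eq)
    qed blast
    from span_of_minimal[OF this, of G] show ?thesis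
      using G ideal[OF _ s] x by blast
  qed
  have x': "x \<in> carrier T" using IE(1) x by blast
  have "submodule {y \<in> carrier T. x \<otimes>\<^bsub>T\<^esub> y \<in> ?I} K T"
  proof (rule T.submoduleI_smult)
    show "\<zero>\<^bsub>T\<^esub> \<in> {y \<in> carrier T. x \<otimes>\<^bsub>T\<^esub> y \<in> ?I}"
      using T.submodule_zero[OF I] T.mult_zero[OF x'] T.M.zero_closed by (simp only: mem_Collect_eq)
    fix a b assume "a \<in> {y \<in> carrier T. x \<otimes>\<^bsub>T\<^esub> y \<in> ?I}" "b \<in> {y \<in> carrier T. x \<otimes>\<^bsub>T\<^esub> y \<in> ?I}"
    then show "a \<oplus>\<^bsub>T\<^esub> b \<in> {y \<in> carrier T. x \<otimes>\<^bsub>T\<^esub> y \<in> ?I}"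
      using T.mult_r_distr[OF _ _ x', of a b] IE(5) T.M.a_closed by (simp only: mem_Collect_eq)
  next
    fix c y assume c: "c \<in> carrier K" and "y \<in> {y \<in> carrier T. x \<otimes>\<^bsub>T\<^esub> y \<in> ?I}"
    then show "c \<odot>\<^bsub>T\<^esub> y \<in> {y \<in> carrier T. x \<otimes>\<^bsub>T\<^esub> y \<in> ?I}"
      using T.mult_smult[OF c x', of y] IE(4)[OF c] T.smult_closed[OF c] by (simp only: mem_Collect_eq)
  qed blast
  then have "y \<in> {y \<in> carrier T. x \<otimes>\<^bsub>T\<^esub> y \<in> ?I}"
  proof (rule free_algebra_induct[OF _ _ y])
    fix s assume "s \<in> S"
    then show "delta K s \<in> {y \<in> carrier T. x \<otimes>\<^bsub>T\<^esub> y \<in> ?I}"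
      using *[OF x, of s] delta_closed[of s] by (simp only: mem_Collect_eq)
  qed
  then show ?thesis by (simp only: mem_Collect_eq)
qed

end

section \<open>Tensor products\<close>

lemma (in comm_nonassoc_algebra) mult_hom:
  "y \<in> carrier M \<Longrightarrow> (\<lambda>x. x \<otimes>\<^bsub>M\<^esub> y) \<in> module_hom K M M"
  by (rule module_homI) (simp_all add: mult_closed mult_l_distr smult_mult)

text \<open>Every relation is the defect of an additivity or of a homogeneity law on basis elements.
  If \<open>h\<close> obeys the law there, then it kills the defect.\<close>

lemma module_hom_relation_add:
  assumes "module K M" "module K N" and h: "h \<in> module_hom K M N"
    and x: "x \<in> carrier M" and y: "y \<in> carrier M" and z: "z \<in> carrier M"
    and eq: "h x = h y \<oplus>\<^bsub>N\<^esub> h z"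
  shows "h (x \<ominus>\<^bsub>M\<^esub> (y \<oplus>\<^bsub>M\<^esub> z)) = \<zero>\<^bsub>N\<^esub>"
proof -
  interpret M: module K M by fact
  interpret N: module K N by fact
  have yz: "y \<oplus>\<^bsub>M\<^esub> z \<in> carrier M" using y z by simp
  show ?thesis
    using module_hom_minus[OF assms(1,2) h x yz] module_homD(2)[OF h y z] module_homD(1)[OF h x] eq
    by (simp add: a_minus_def N.M.r_neg)
qed

lemma module_hom_relation_smult:
  assumes "module K M" "module K N" and h: "h \<in> module_hom K M N"
    and c: "c \<in> carrier K" and x: "x \<in> carrier M" and y: "y \<in> carrier M"
    and eq: "h x = c \<odot>\<^bsub>N\<^esub> h y"
  shows "h (x \<ominus>\<^bsub>M\<^esub> c \<odot>\<^bsub>M\<^esub> y) = \<zero>\<^bsub>N\<^esub>"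
proof -
  interpret M: module K M by fact
  interpret N: module K N by fact
  have cy: "c \<odot>\<^bsub>M\<^esub> y \<in> carrier M" using c y by simp
  show ?thesis
    using module_hom_minus[OF assms(1,2) h x cy] module_homD(3)[OF h c y] module_homD(1)[OF h x] eq
    by (simp add: a_minus_def N.M.r_neg)
qed

text \<open>The reverse passage: a defect that lies in \<open>I\<close> makes the law hold between
  cosets.\<close>

lemma (in module) coset_relation_add:
  assumes I: "submodule I R M" and x: "x \<in> carrier M" and y: "y \<in> carrier M" and z: "z \<in> carrier M"
    and mem: "x \<ominus>\<^bsub>M\<^esub> (y \<oplus>\<^bsub>M\<^esub> z) \<in> I"
  shows "I +>\<^bsub>M\<^esub> x = (I +>\<^bsub>M\<^esub> y) \<oplus>\<^bsub>alg_quot M I\<^esub> (I +>\<^bsub>M\<^esub> z)"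
  using coset_eq_iff[OF I x M.a_closed[OF y z]] mem alg_quot_add[OF I y z] by simp

lemma (in module) coset_relation_smult:
  assumes I: "submodule I R M" and c: "c \<in> carrier R" and x: "x \<in> carrier M" and y: "y \<in> carrier M"
    and mem: "x \<ominus>\<^bsub>M\<^esub> c \<odot>\<^bsub>M\<^esub> y \<in> I"
  shows "I +>\<^bsub>M\<^esub> x = c \<odot>\<^bsub>alg_quot M I\<^esub> (I +>\<^bsub>M\<^esub> y)"
  using coset_eq_iff[OF I x smult_closed[OF c y]] mem alg_quot_smult[OF I c y] by simp

locale tensor_product = A: comm_nonassoc_algebra K A + B: comm_nonassoc_algebra K B
  for K (structure) and A and B
begin

abbreviation T where "T \<equiv> tensor_free K A B"
abbreviation rels where "rels \<equiv> tensor_rels K A B"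
abbreviation Q where "Q \<equiv> tensor_alg K A B"
abbreviation pure where "pure \<equiv> tensor K A B"

text \<open>The generating set gets a name because \<open>tensor_rels\<close> exposes only its span,
  whereas linear maps are tested on the generators themselves.\<close>

definition rel_gens where
  "rel_gens =
    {delta K (a \<oplus>\<^bsub>A\<^esub> a', b) \<ominus>\<^bsub>T\<^esub> (delta K (a, b) \<oplus>\<^bsub>T\<^esub> delta K (a', b)) | a a' b.
      a \<in> carrier A \<and> a' \<in> carrier A \<and> b \<in> carrier B} \<union>
    {delta K (a, b \<oplus>\<^bsub>B\<^esub> b') \<ominus>\<^bsub>T\<^esub> (delta K (a, b) \<oplus>\<^bsub>T\<^esub> delta K (a, b')) | a b b'.
      a \<in> carrier A \<and> b \<in> carrier B \<and> b' \<in> carrier B} \<union>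
    {delta K (c \<odot>\<^bsub>A\<^esub> a, b) \<ominus>\<^bsub>T\<^esub> c \<odot>\<^bsub>T\<^esub> delta K (a, b) | c a b.
      c \<in> carrier K \<and> a \<in> carrier A \<and> b \<in> carrier B} \<union>
    {delta K (a, c \<odot>\<^bsub>B\<^esub> b) \<ominus>\<^bsub>T\<^esub> c \<odot>\<^bsub>T\<^esub> delta K (a, b) | c a b.
      c \<in> carrier K \<and> a \<in> carrier A \<and> b \<in> carrier B}"

lemma rels_eq: "rels = span_of K T rel_gens"
  by (simp add: tensor_rels_def rel_gens_def Let_def)

lemma product: "free_algebra_product K (carrier A \<times> carrier B)
    (\<lambda>(a, b) (a', b'). delta K (a \<otimes>\<^bsub>A\<^esub> a', b \<otimes>\<^bsub>B\<^esub> b')) (delta K (\<one>\<^bsub>A\<^esub>, \<one>\<^bsub>B\<^esub>))"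
proof
  fix s t assume st: "s \<in> carrier A \<times> carrier B" "t \<in> carrier A \<times> carrier B"
  then obtain a b a' b' where [simp]: "s = (a, b)" "t = (a', b')"
      and ab: "a \<in> carrier A" "a' \<in> carrier A" "b \<in> carrier B" "b' \<in> carrier B"
    by blast
  have "(a \<otimes>\<^bsub>A\<^esub> a', b \<otimes>\<^bsub>B\<^esub> b') \<in> carrier A \<times> carrier B"
    using ab by (simp add: A.mult_closed B.mult_closed)
  from A.R.delta_closed[OF this]
  show "(case s of (a, b) \<Rightarrow> \<lambda>(a', b'). delta K (a \<otimes>\<^bsub>A\<^esub> a', b \<otimes>\<^bsub>B\<^esub> b')) t
      \<in> carrier (free_algebra K (carrier A \<times> carrier B)
        (\<lambda>(a, b) (a', b'). delta K (a \<otimes>\<^bsub>A\<^esub> a', b \<otimes>\<^bsub>B\<^esub> b')) (delta K (\<one>\<^bsub>A\<^esub>, \<one>\<^bsub>B\<^esub>)))"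
    by (simp only: \<open>s = (a, b)\<close> \<open>t = (a', b')\<close> prod.case)
  show "(case s of (a, b) \<Rightarrow> \<lambda>(a', b'). delta K (a \<otimes>\<^bsub>A\<^esub> a', b \<otimes>\<^bsub>B\<^esub> b')) t =
      (case t of (a, b) \<Rightarrow> \<lambda>(a', b'). delta K (a \<otimes>\<^bsub>A\<^esub> a', b \<otimes>\<^bsub>B\<^esub> b')) s"
    using A.mult_comm[OF ab(1,2)] B.mult_comm[OF ab(3,4)] by simp
qed

lemma free_alg: "comm_nonassoc_algebra K T"
  unfolding tensor_free_def by (rule free_algebra_product.free_algebra[OF product])

sublocale T: comm_nonassoc_algebra K T
  by (rule free_alg)

lemma delta_in: "a \<in> carrier A \<Longrightarrow> b \<in> carrier B \<Longrightarrow> delta K (a, b) \<in> carrier T"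
  unfolding tensor_free_def by (rule A.R.delta_closed) simp

lemma delta_mult:
  assumes "a \<in> carrier A" "b \<in> carrier B" "a' \<in> carrier A" "b' \<in> carrier B"
  shows "delta K (a, b) \<otimes>\<^bsub>T\<^esub> delta K (a', b') = delta K (a \<otimes>\<^bsub>A\<^esub> a', b \<otimes>\<^bsub>B\<^esub> b')"
proof -
  have "(a, b) \<in> carrier A \<times> carrier B" "(a', b') \<in> carrier A \<times> carrier B"
    using assms by simp_all
  from free_algebra_product.delta_mult[OF product this] show ?thesis
    by (simp add: tensor_free_def)
qed

lemma gens_closed: "rel_gens \<subseteq> carrier T"
  unfolding rel_gens_def
  by (intro Un_least subsetI; elim CollectE exE conjE; hypsubst;
      intro T.M.minus_closed T.M.a_closed T.smult_closed delta_in A.M.a_closed B.M.a_closed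
        A.smult_closed B.smult_closed; assumption)

lemma rels_submodule: "submodule rels K T"
  unfolding rels_eq by (rule T.span_of_submodule[OF gens_closed])

lemma gens_subset: "rel_gens \<subseteq> rels"
  unfolding rels_eq by (rule span_of_superset)

lemma quot_module: "module K Q"
  unfolding tensor_alg_def by (rule T.alg_quot_module[OF rels_submodule])

lemma tensor_eq: "pure a b = rels +>\<^bsub>T\<^esub> delta K (a, b)"
  by (simp add: tensor_def)

lemma quot_hom: "(\<lambda>x. rels +>\<^bsub>T\<^esub> x) \<in> module_hom K T Q"
  unfolding tensor_alg_def by (rule T.alg_quot_hom[OF rels_submodule])

lemma tensor_hom_left:
  assumes b: "b \<in> carrier B"
  shows "(\<lambda>a. pure a b) \<in> module_hom K A Q"
proof (rule module_homI)
  fix a assume a: "a \<in> carrier A"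
  show "pure a b \<in> carrier Q"
    unfolding tensor_eq by (rule module_homD(1)[OF quot_hom delta_in[OF a b]])
  fix c assume c: "c \<in> carrier K"
  have "delta K (c \<odot>\<^bsub>A\<^esub> a, b) \<ominus>\<^bsub>T\<^esub> c \<odot>\<^bsub>T\<^esub> delta K (a, b) \<in> rels"
    using gens_subset a b c unfolding rel_gens_def by blast
  from T.coset_relation_smult[OF rels_submodule c delta_in[OF A.smult_closed[OF c a] b] delta_in[OF a b] this]
  show "pure (c \<odot>\<^bsub>A\<^esub> a) b = c \<odot>\<^bsub>Q\<^esub> pure a b"
    unfolding tensor_eq tensor_alg_def .
next
  fix a a' assume a: "a \<in> carrier A" and a': "a' \<in> carrier A"
  have "delta K (a \<oplus>\<^bsub>A\<^esub> a', b) \<ominus>\<^bsub>T\<^esub> (delta K (a, b) \<oplus>\<^bsub>T\<^esub> delta K (a', b)) \<in> rels"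
    using gens_subset a a' b unfolding rel_gens_def by blast
  from T.coset_relation_add[OF rels_submodule delta_in[OF A.M.a_closed[OF a a'] b] delta_in[OF a b]
      delta_in[OF a' b] this]
  show "pure (a \<oplus>\<^bsub>A\<^esub> a') b = pure a b \<oplus>\<^bsub>Q\<^esub> pure a' b"
    unfolding tensor_eq tensor_alg_def .
qed

lemma tensor_hom_right:
  assumes a: "a \<in> carrier A"
  shows "pure a \<in> module_hom K B Q"
proof (rule module_homI)
  fix b assume b: "b \<in> carrier B"
  show "pure a b \<in> carrier Q"
    unfolding tensor_eq by (rule module_homD(1)[OF quot_hom delta_in[OF a b]])
  fix c assume c: "c \<in> carrier K"
  have "delta K (a, c \<odot>\<^bsub>B\<^esub> b) \<ominus>\<^bsub>T\<^esub> c \<odot>\<^bsub>T\<^esub> delta K (a, b) \<in> rels"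
    using gens_subset a b c unfolding rel_gens_def by blast
  from T.coset_relation_smult[OF rels_submodule c delta_in[OF a B.smult_closed[OF c b]] delta_in[OF a b] this]
  show "pure a (c \<odot>\<^bsub>B\<^esub> b) = c \<odot>\<^bsub>Q\<^esub> pure a b"
    unfolding tensor_eq tensor_alg_def .
next
  fix b b' assume b: "b \<in> carrier B" and b': "b' \<in> carrier B"
  have "delta K (a, b \<oplus>\<^bsub>B\<^esub> b') \<ominus>\<^bsub>T\<^esub> (delta K (a, b) \<oplus>\<^bsub>T\<^esub> delta K (a, b')) \<in> rels"
    using gens_subset a b b' unfolding rel_gens_def by blast
  from T.coset_relation_add[OF rels_submodule delta_in[OF a B.M.a_closed[OF b b']] delta_in[OF a b]
      delta_in[OF a b'] this]
  show "pure a (b \<oplus>\<^bsub>B\<^esub> b') = pure a b \<oplus>\<^bsub>Q\<^esub> pure a b'"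
    unfolding tensor_eq tensor_alg_def .
qed

text \<open>Multiplication by a basis element followed by the quotient map sends a basis element to
  a pure tensor of products. That expression is linear in each slot, so the composite kills all four
  kinds of generators, which means that the products lie in \<open>rels\<close>.\<close>

lemma gens_ideal:
  assumes g: "g \<in> rel_gens" and s: "s \<in> carrier A \<times> carrier B"
  shows "g \<otimes>\<^bsub>T\<^esub> delta K s \<in> rels"
proof -
  obtain x y where s_eq: "s = (x, y)" and x: "x \<in> carrier A" and y: "y \<in> carrier B"
    using s by blast
  define h where "h = (\<lambda>f. rels +>\<^bsub>T\<^esub> (f \<otimes>\<^bsub>T\<^esub> delta K s))"
  have h: "h \<in> module_hom K T Q"
    unfolding h_def s_eq by (rule module_hom_compose[OF T.mult_hom[OF delta_in[OF x y]] quot_hom])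
  have hd: "h (delta K (a, b)) = pure (a \<otimes>\<^bsub>A\<^esub> x) (b \<otimes>\<^bsub>B\<^esub> y)"
    if "a \<in> carrier A" "b \<in> carrier B" for a b
    unfolding h_def s_eq tensor_eq delta_mult[OF that x y] ..
  have hA: "(\<lambda>a. h (delta K (a, b))) \<in> module_hom K A Q" if b: "b \<in> carrier B" for b
    by (rule module_hom_cong[OF hd[OF _ b] A.module_axioms
          module_hom_compose[OF A.mult_hom[OF x] tensor_hom_left[OF B.mult_closed[OF b y]]]])
  have hB: "(\<lambda>b. h (delta K (a, b))) \<in> module_hom K B Q" if a: "a \<in> carrier A" for a
    by (rule module_hom_cong[OF hd[OF a] B.module_axioms
          module_hom_compose[OF B.mult_hom[OF y] tensor_hom_right[OF A.mult_closed[OF a x]]]])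
  note add = module_hom_relation_add[OF T.module_axioms quot_module h]
  note smult = module_hom_relation_smult[OF T.module_axioms quot_module h]
  have "h g = \<zero>\<^bsub>Q\<^esub>"
    using g unfolding rel_gens_def
    by (elim UnE CollectE exE conjE;
        simp only: add smult delta_in A.M.a_closed B.M.a_closed A.smult_closed B.smult_closed
          module_homD(2)[OF hA] module_homD(2)[OF hB] module_homD(3)[OF hA] module_homD(3)[OF hB])
  moreover have "g \<otimes>\<^bsub>T\<^esub> delta K s \<in> carrier T"
    using g gens_closed s_eq delta_in[OF x y] by (auto intro!: T.mult_closed)
  ultimately show ?thesis
    using T.coset_eq_zero_iff[OF rels_submodule] by (simp only: h_def tensor_alg_def T.alg_quot_zero)
qed

lemma rels_ideal:
  assumes "x \<in> rels" "y \<in> carrier T"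
  shows "x \<otimes>\<^bsub>T\<^esub> y \<in> rels"
  unfolding rels_eq
  by (rule free_algebra_product.span_ideal[OF product, folded tensor_free_def, OF gens_closed
        gens_ideal[unfolded rels_eq] assms[unfolded rels_eq]])

lemma quot_algebra: "comm_nonassoc_algebra K Q"
  unfolding tensor_alg_def by (rule T.alg_quot_algebra[OF rels_submodule rels_ideal])

lemma tensor_mult:
  assumes "a \<in> carrier A" "b \<in> carrier B" "a' \<in> carrier A" "b' \<in> carrier B"
  shows "pure a b \<otimes>\<^bsub>Q\<^esub> pure a' b' = pure (a \<otimes>\<^bsub>A\<^esub> a') (b \<otimes>\<^bsub>B\<^esub> b')"
  unfolding tensor_eq tensor_alg_def
  using T.alg_quot_mult[OF rels_submodule rels_ideal delta_in[OF assms(1,2)] delta_in[OF assms(3,4)]]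
  by (simp only: delta_mult[OF assms])

end

section \<open>The mixable shuffle algebra\<close>

locale mixable_shuffle_algebra = B: comm_nonassoc_algebra K B for K (structure) and B +
  fixes lam
  assumes lam_closed: "lam \<in> carrier K"
begin

abbreviation words where "words \<equiv> {w. set w \<subseteq> carrier B}"
abbreviation sh where "sh \<equiv> mixable_shuffle K lam B"
abbreviation W where "W \<equiv> word_free K lam B"

text \<open>The unital version, in which the empty word is admitted, is only needed as a domain for
  \<^const>\<open>prepend\<close>.\<close>

abbreviation W\<^sub>0 where "W\<^sub>0 \<equiv> free_algebra K words sh undefined"
abbreviation rels where "rels \<equiv> word_rels K lam B"
abbreviation Q where "Q \<equiv> Sh_plus K lam B"
abbreviation cls where "cls f \<equiv> rels +>\<^bsub>W\<^esub> f"

lemma W_simps [simp]: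
  "f \<in> carrier W \<longleftrightarrow> (\<forall>w. f w \<in> carrier K) \<and>
    (\<forall>w. w \<notin> {w. w \<noteq> [] \<and> set w \<subseteq> carrier B} \<longrightarrow> f w = \<zero>) \<and> finite {w. f w \<noteq> \<zero>}"
  "\<zero>\<^bsub>W\<^esub> = (\<lambda>_. \<zero>)"
  "f \<oplus>\<^bsub>W\<^esub> g = (\<lambda>w. f w \<oplus> g w)"
  "c \<odot>\<^bsub>W\<^esub> f = (\<lambda>w. c \<otimes> f w)"
  by (simp_all only: word_free_def free_algebra_simps)

lemma W_subset: "f \<in> carrier W \<Longrightarrow> f \<in> carrier W\<^sub>0"
  by auto

text \<open>A word with a prepended letter is nonempty, so the result lies in \<open>W\<close> even
  if the empty word occurs in \<open>f\<close>.\<close>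

lemma prepend_closed:
  assumes b: "b \<in> carrier B" and f: "f \<in> carrier W\<^sub>0"
  shows "prepend K b f \<in> carrier W"
proof -
  have "{w. prepend K b f w \<noteq> \<zero>} \<subseteq> (#) b ` {w. f w \<noteq> \<zero>}"
  proof
    fix w assume "w \<in> {w. prepend K b f w \<noteq> \<zero>}"
    then show "w \<in> (#) b ` {w. f w \<noteq> \<zero>}"
      by (cases w) (auto simp: prepend_def split: if_splits)
  qed
  then have "finite {w. prepend K b f w \<noteq> \<zero>}"
    using f by (auto intro: finite_subset)
  moreover have "prepend K b f w \<in> carrier K" for w
    using f by (auto simp: prepend_def split: list.split)
  moreover have "prepend K b f w = \<zero>" if "w \<notin> {w. w \<noteq> [] \<and> set w \<subseteq> carrier B}" for w
    using f b that by (cases w) (auto simp: prepend_def)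
  ultimately show ?thesis by (simp only: W_simps) blast
qed

lemma prepend_hom:
  assumes "b \<in> carrier B"
  shows "prepend K b \<in> module_hom K W\<^sub>0 W"
proof (rule module_homI)
  show "prepend K b f \<in> carrier W" if "f \<in> carrier W\<^sub>0" for f
    by (rule prepend_closed[OF assms that])
  show "prepend K b (f \<oplus>\<^bsub>W\<^sub>0\<^esub> g) = prepend K b f \<oplus>\<^bsub>W\<^esub> prepend K b g" for f g
    by (auto simp: prepend_def fun_eq_iff split: list.split)
  show "prepend K b (c \<odot>\<^bsub>W\<^sub>0\<^esub> f) = c \<odot>\<^bsub>W\<^esub> prepend K b f" if "c \<in> carrier K" for c f
    using that by (auto simp: prepend_def fun_eq_iff split: list.split)
qed

lemma prepend_hom_W:
  assumes "b \<in> carrier B"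
  shows "prepend K b \<in> module_hom K W W"
proof (rule module_homI)
  note h = module_homD[OF prepend_hom[OF assms]]
  show "prepend K b f \<in> carrier W" if "f \<in> carrier W" for f
    by (rule h(1)[OF W_subset[OF that]])
  show "prepend K b (f \<oplus>\<^bsub>W\<^esub> g) = prepend K b f \<oplus>\<^bsub>W\<^esub> prepend K b g"
    if "f \<in> carrier W" "g \<in> carrier W" for f g
    using h(2)[OF W_subset[OF that(1)] W_subset[OF that(2)]]
    by (simp only: W_simps free_algebra_simps)
  show "prepend K b (c \<odot>\<^bsub>W\<^esub> f) = c \<odot>\<^bsub>W\<^esub> prepend K b f"
    if "c \<in> carrier K" "f \<in> carrier W" for c f
    using h(3)[OF that(1) W_subset[OF that(2)]]
    by (simp only: W_simps free_algebra_simps)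
qed

lemma prepend_delta: "prepend K b (delta K w) = delta K (b # w)"
  by (auto simp: prepend_def delta_def fun_eq_iff split: list.split)

lemma delta_in: "w \<noteq> [] \<Longrightarrow> set w \<subseteq> carrier B \<Longrightarrow> delta K w \<in> carrier W"
  unfolding word_free_def by (rule B.R.delta_closed) simp

lemma delta_in\<^sub>0: "set w \<subseteq> carrier B \<Longrightarrow> delta K w \<in> carrier W\<^sub>0"
  by (rule B.R.delta_closed) simp

lemma shuffle_Cons:
  "sh (a # u) (b # v) = prepend K a (sh u (b # v)) \<oplus>\<^bsub>W\<^esub> prepend K b (sh (a # u) v)
    \<oplus>\<^bsub>W\<^esub> lam \<odot>\<^bsub>W\<^esub> prepend K (a \<otimes>\<^bsub>B\<^esub> b) (sh u v)"
  by (simp only: mixable_shuffle.simps W_simps)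

lemma shuffle_Nil_right: "sh u [] = delta K u"
  by (cases u) simp_all

sublocale W: module K W
  unfolding word_free_def by (rule B.R.free_module)

text \<open>Two clauses are required because the shuffle of two empty words is the empty word, which
  lives in \<open>W\<^sub>0\<close> only.\<close>

lemma shuffle_closed:
  assumes "set u \<subseteq> carrier B" "set v \<subseteq> carrier B"
  shows "sh u v \<in> carrier W\<^sub>0" and "u \<noteq> [] \<or> v \<noteq> [] \<Longrightarrow> sh u v \<in> carrier W"
proof -
  have *: "set u \<subseteq> carrier B \<longrightarrow> set v \<subseteq> carrier B \<longrightarrow> u \<noteq> [] \<or> v \<noteq> [] \<longrightarrow> sh u v \<in> carrier W" for u v
  proof (induction "length u + length v" arbitrary: u v rule: less_induct)
    case less
    \<comment> \<open>A recursive call may have two empty arguments, so the hypothesis is first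
      weakened to \<open>W\<^sub>0\<close>; the prepended letter leads back to
      \<open>W\<close>.\<close>
    have closed\<^sub>0: "sh u' v' \<in> carrier W\<^sub>0" if "length u' + length v' < length u + length v"
      "set u' \<subseteq> carrier B" "set v' \<subseteq> carrier B" for u' v'
    proof (cases "u' = [] \<and> v' = []")
      case True
      then show ?thesis using delta_in\<^sub>0[of "[]"] by (simp del: free_algebra_simps)
    next
      case False
      with less[OF that(1)] that(2,3) show ?thesis by (intro W_subset) blast
    qed
    show ?case
    proof (intro impI)
      assume uv: "set u \<subseteq> carrier B" "set v \<subseteq> carrier B" "u \<noteq> [] \<or> v \<noteq> []"
      show "sh u v \<in> carrier W"
      proof (cases "u = [] \<or> v = []")
        case True
        then have "sh u v = delta K (u @ v)"
          by (auto simp: shuffle_Nil_right)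
        then show ?thesis using uv delta_in[of "u @ v"] by (simp del: W_simps)
      next
        case False
        then obtain a u' b v' where [simp]: "u = a # u'" "v = b # v'"
          by (meson neq_Nil_conv)
        have ab: "a \<in> carrier B" "b \<in> carrier B" "set u' \<subseteq> carrier B" "set v' \<subseteq> carrier B"
          using uv by auto
        have "sh u' (b # v') \<in> carrier W\<^sub>0" "sh (a # u') v' \<in> carrier W\<^sub>0" "sh u' v' \<in> carrier W\<^sub>0"
          by (rule closed\<^sub>0; use ab in simp)+
        then show ?thesis
          unfolding \<open>u = a # u'\<close> \<open>v = b # v'\<close> shuffle_Cons
          by (intro W.M.a_closed W.smult_closed lam_closed prepend_closed B.mult_closed ab)
      qed
    qed
  qed
  show "sh u v \<in> carrier W\<^sub>0"
  proof (cases "u = [] \<and> v = []")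
    case True
    then show ?thesis using delta_in\<^sub>0[of "[]"] by (simp del: free_algebra_simps)
  next
    case False
    with * assms show ?thesis by (intro W_subset) blast
  qed
  show "sh u v \<in> carrier W" if "u \<noteq> [] \<or> v \<noteq> []"
    using * assms that by blast
qed

text \<open>Exchanging the words swaps the first two terms of the recursion, and commutativity of
  \<open>B\<close> fixes the merged letter in the third.\<close>

lemma shuffle_comm:
  assumes "set u \<subseteq> carrier B" "set v \<subseteq> carrier B"
  shows "sh u v = sh v u"
  using assms
proof (induction "length u + length v" arbitrary: u v rule: less_induct)
  case less
  show ?case
  proof (cases "u = [] \<or> v = []")
    case True
    then show ?thesis by (auto simp: shuffle_Nil_right)
  next
    case False
    then obtain a u' b v' where uv: "u = a # u'" "v = b # v'"
      by (meson neq_Nil_conv)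
    have ab: "a \<in> carrier B" "b \<in> carrier B" "set u' \<subseteq> carrier B" "set v' \<subseteq> carrier B"
      using less.prems uv by auto
    have IH: "sh u' (b # v') = sh (b # v') u'" "sh (a # u') v' = sh v' (a # u')" "sh u' v' = sh v' u'"
      by (rule less.hyps; use ab uv in simp)+
    have cl: "prepend K b (sh v' (a # u')) \<in> carrier W" "prepend K a (sh (b # v') u') \<in> carrier W"
      by (intro prepend_closed shuffle_closed(1) ab; use ab in simp)+
    show ?thesis
      unfolding uv shuffle_Cons IH B.mult_comm[OF ab(1,2)] W.M.a_comm[OF cl] ..
  qed
qed

lemma product:
  "free_algebra_product K {w. w \<noteq> [] \<and> set w \<subseteq> carrier B} sh undefined"
proof
  fix u v assume "u \<in> {w. w \<noteq> [] \<and> set w \<subseteq> carrier B}" "v \<in> {w. w \<noteq> [] \<and> set w \<subseteq> carrier B}"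
  then have u: "u \<noteq> []" "set u \<subseteq> carrier B" "set v \<subseteq> carrier B" by auto
  show "sh u v \<in> carrier (free_algebra K {w. w \<noteq> [] \<and> set w \<subseteq> carrier B} sh undefined)"
    using shuffle_closed(2)[OF u(2,3)] u(1) unfolding word_free_def by blast
  show "sh u v = sh v u"
    by (rule shuffle_comm[OF u(2,3)])
qed

sublocale W: comm_nonassoc_algebra K W
  unfolding word_free_def by (rule free_algebra_product.free_algebra[OF product])

lemma delta_mult:
  assumes "u \<noteq> []" "set u \<subseteq> carrier B" "v \<noteq> []" "set v \<subseteq> carrier B"
  shows "delta K u \<otimes>\<^bsub>W\<^esub> delta K v = sh u v"
  unfolding word_free_def using assms by (intro free_algebra_product.delta_mult[OF product]) auto

section \<open>Multilinearity modulo the relations\<close>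

definition rel_gens where
  "rel_gens =
    {delta K (u @ [b \<oplus>\<^bsub>B\<^esub> b'] @ v) \<ominus>\<^bsub>W\<^esub> (delta K (u @ [b] @ v) \<oplus>\<^bsub>W\<^esub> delta K (u @ [b'] @ v)) | u b b' v.
      set u \<subseteq> carrier B \<and> b \<in> carrier B \<and> b' \<in> carrier B \<and> set v \<subseteq> carrier B} \<union>
    {delta K (u @ [c \<odot>\<^bsub>B\<^esub> b] @ v) \<ominus>\<^bsub>W\<^esub> c \<odot>\<^bsub>W\<^esub> delta K (u @ [b] @ v) | c u b v.
      c \<in> carrier K \<and> set u \<subseteq> carrier B \<and> b \<in> carrier B \<and> set v \<subseteq> carrier B}"

lemma rels_eq: "rels = span_of K W rel_gens"
  by (simp only: word_rels_def rel_gens_def Let_def)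

lemma delta_in_middle:
  "set u \<subseteq> carrier B \<Longrightarrow> b \<in> carrier B \<Longrightarrow> set v \<subseteq> carrier B \<Longrightarrow> delta K (u @ [b] @ v) \<in> carrier W"
  by (rule delta_in) auto

lemma gens_closed: "rel_gens \<subseteq> carrier W"
  unfolding rel_gens_def
  by (intro Un_least subsetI; elim CollectE exE conjE; hypsubst;
      intro W.M.minus_closed W.M.a_closed W.smult_closed delta_in_middle B.M.a_closed
        B.smult_closed; assumption)

lemma rels_submodule: "submodule rels K W"
  unfolding rels_eq by (rule W.span_of_submodule[OF gens_closed])

lemma gens_subset: "rel_gens \<subseteq> rels"
  unfolding rels_eq by (rule span_of_superset)

lemma quot_module: "module K Q"
  unfolding Sh_plus_def by (rule W.alg_quot_module[OF rels_submodule])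

lemma quot_hom: "cls \<in> module_hom K W Q"
  unfolding Sh_plus_def by (rule W.alg_quot_hom[OF rels_submodule])

lemma cls_zero_iff: "f \<in> carrier W \<Longrightarrow> cls f = \<zero>\<^bsub>Q\<^esub> \<longleftrightarrow> f \<in> rels"
  using W.coset_eq_zero_iff[OF rels_submodule] by (simp only: Sh_plus_def W.alg_quot_zero)

lemma letter_hom:
  assumes u: "set u \<subseteq> carrier B" and v: "set v \<subseteq> carrier B"
  shows "(\<lambda>b. cls (delta K (u @ [b] @ v))) \<in> module_hom K B Q"
proof (rule module_homI)
  fix b assume b: "b \<in> carrier B"
  show "cls (delta K (u @ [b] @ v)) \<in> carrier Q"
    by (rule module_homD(1)[OF quot_hom delta_in_middle[OF u b v]])
  fix c assume c: "c \<in> carrier K"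
  have "delta K (u @ [c \<odot>\<^bsub>B\<^esub> b] @ v) \<ominus>\<^bsub>W\<^esub> c \<odot>\<^bsub>W\<^esub> delta K (u @ [b] @ v) \<in> rels"
    using gens_subset u b c v unfolding rel_gens_def by blast
  from W.coset_relation_smult[OF rels_submodule c delta_in_middle[OF u B.smult_closed[OF c b] v]
      delta_in_middle[OF u b v] this]
  show "cls (delta K (u @ [c \<odot>\<^bsub>B\<^esub> b] @ v)) = c \<odot>\<^bsub>Q\<^esub> cls (delta K (u @ [b] @ v))"
    unfolding Sh_plus_def .
next
  fix b b' assume b: "b \<in> carrier B" and b': "b' \<in> carrier B"
  have "delta K (u @ [b \<oplus>\<^bsub>B\<^esub> b'] @ v) \<ominus>\<^bsub>W\<^esub> (delta K (u @ [b] @ v) \<oplus>\<^bsub>W\<^esub> delta K (u @ [b'] @ v)) \<in> rels"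
    using gens_subset u b b' v unfolding rel_gens_def by blast
  from W.coset_relation_add[OF rels_submodule delta_in_middle[OF u B.M.a_closed[OF b b'] v]
      delta_in_middle[OF u b v] delta_in_middle[OF u b' v] this]
  show "cls (delta K (u @ [b \<oplus>\<^bsub>B\<^esub> b'] @ v)) = cls (delta K (u @ [b] @ v)) \<oplus>\<^bsub>Q\<^esub> cls (delta K (u @ [b'] @ v))"
    unfolding Sh_plus_def .
qed

text \<open>The criterion for a linear map to vanish on the relations: on basis words it is linear
  in every letter. It is applied both to prepending a letter and to multiplication by a
  word.\<close>

lemma rels_kernel:
  assumes h: "h \<in> module_hom K W Q"
    and letter: "\<And>u v. set u \<subseteq> carrier B \<Longrightarrow> set v \<subseteq> carrier B \<Longrightarrow>
      (\<lambda>b. h (delta K (u @ [b] @ v))) \<in> module_hom K B Q"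
    and x: "x \<in> rels"
  shows "h x = \<zero>\<^bsub>Q\<^esub>"
proof (rule W.span_of_kernel[OF quot_module h gens_closed _ x[unfolded rels_eq]])
  note add = module_hom_relation_add[OF W.module_axioms quot_module h]
  note smult = module_hom_relation_smult[OF W.module_axioms quot_module h]
  fix g assume "g \<in> rel_gens"
  then show "h g = \<zero>\<^bsub>Q\<^esub>"
    unfolding rel_gens_def
    by (elim UnE CollectE exE conjE;
        simp only: add smult delta_in_middle B.M.a_closed B.smult_closed
          module_homD(2)[OF letter] module_homD(3)[OF letter])
qed

text \<open>A prepended letter merely lengthens the prefix in front of the varying letter, so the
  criterion follows from linearity in a letter of the longer word.\<close>

lemma prepend_rels:
  assumes a: "a \<in> carrier B" and f: "f \<in> rels"
  shows "prepend K a f \<in> rels"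
proof -
  have "(\<lambda>f. cls (prepend K a f)) \<in> module_hom K W Q"
    by (rule module_hom_compose[OF prepend_hom_W[OF a] quot_hom])
  moreover have "(\<lambda>b. cls (prepend K a (delta K (u @ [b] @ v)))) \<in> module_hom K B Q"
    if "set u \<subseteq> carrier B" "set v \<subseteq> carrier B" for u v
    unfolding prepend_delta append_Cons[symmetric] by (rule letter_hom) (use a that in auto)
  ultimately have "cls (prepend K a f) = \<zero>\<^bsub>Q\<^esub>"
    using f by (rule rels_kernel)
  moreover have "f \<in> carrier W"
    using W.submoduleE(1)[OF rels_submodule] f by blast
  ultimately show ?thesis
    using cls_zero_iff prepend_closed[OF a W_subset] by blast
qed

lemma prepend_cong:
  assumes a: "a \<in> carrier B" and f: "f \<in> carrier W" and g: "g \<in> carrier W" and eq: "cls f = cls g"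
  shows "cls (prepend K a f) = cls (prepend K a g)"
proof -
  note h = prepend_hom_W[OF a]
  have "f \<ominus>\<^bsub>W\<^esub> g \<in> rels"
    using W.coset_eq_iff[OF rels_submodule f g] eq by blast
  from prepend_rels[OF a this] have "prepend K a f \<ominus>\<^bsub>W\<^esub> prepend K a g \<in> rels"
    unfolding module_hom_minus[OF W.module_axioms W.module_axioms h f g] .
  then show ?thesis
    using W.coset_eq_iff[OF rels_submodule module_homD(1)[OF h f] module_homD(1)[OF h g]] by blast
qed

lemma prepend_hom_cong:
  assumes a: "a \<in> carrier B" and g: "\<And>x. x \<in> carrier B \<Longrightarrow> g x \<in> carrier W"
    and h: "(\<lambda>x. cls (g x)) \<in> module_hom K B Q"
  shows "(\<lambda>x. cls (prepend K a (g x))) \<in> module_hom K B Q"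
proof (rule module_homI)
  note p = module_homD[OF prepend_hom_W[OF a]] and q = module_homD[OF quot_hom]
  fix x assume x: "x \<in> carrier B"
  show "cls (prepend K a (g x)) \<in> carrier Q"
    by (rule q(1)[OF p(1)[OF g[OF x]]])
  fix c assume c: "c \<in> carrier K"
  have "cls (prepend K a (g (c \<odot>\<^bsub>B\<^esub> x))) = cls (prepend K a (c \<odot>\<^bsub>W\<^esub> g x))"
    by (rule prepend_cong[OF a g[OF B.smult_closed[OF c x]] W.smult_closed[OF c g[OF x]]])
      (simp only: q(3)[OF c g[OF x]] module_homD(3)[OF h c x])
  then show "cls (prepend K a (g (c \<odot>\<^bsub>B\<^esub> x))) = c \<odot>\<^bsub>Q\<^esub> cls (prepend K a (g x))"
    by (simp only: p(3)[OF c g[OF x]] q(3)[OF c p(1)[OF g[OF x]]])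
next
  note p = module_homD[OF prepend_hom_W[OF a]] and q = module_homD[OF quot_hom]
  fix x y assume x: "x \<in> carrier B" and y: "y \<in> carrier B"
  have "cls (prepend K a (g (x \<oplus>\<^bsub>B\<^esub> y))) = cls (prepend K a (g x \<oplus>\<^bsub>W\<^esub> g y))"
    by (rule prepend_cong[OF a g[OF B.M.a_closed[OF x y]] W.M.a_closed[OF g[OF x] g[OF y]]])
      (simp only: q(2)[OF g[OF x] g[OF y]] module_homD(2)[OF h x y])
  then show "cls (prepend K a (g (x \<oplus>\<^bsub>B\<^esub> y))) = cls (prepend K a (g x)) \<oplus>\<^bsub>Q\<^esub> cls (prepend K a (g y))"
    by (simp only: p(2)[OF g[OF x] g[OF y]] q(2)[OF p(1)[OF g[OF x]] p(1)[OF g[OF y]]])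
qed

text \<open>Linearity in the new letter is known for single words; those \<open>f\<close> for which
  it holds form a submodule of \<open>W\<^sub>0\<close>, hence everything. The tail may be the empty
  word, which is why \<open>f\<close> ranges over \<open>W\<^sub>0\<close>.\<close>

lemma first_letter_hom:
  assumes f: "f \<in> carrier W\<^sub>0"
  shows "(\<lambda>b. cls (prepend K b f)) \<in> module_hom K B Q"
proof -
  interpret W\<^sub>0: module K W\<^sub>0 by (rule B.R.free_module)
  let ?N = "{f \<in> carrier W\<^sub>0. (\<lambda>b. cls (prepend K b f)) \<in> module_hom K B Q}"
  note p = module_homD[OF prepend_hom] and q = module_homD[OF quot_hom]
  have "submodule ?N K W\<^sub>0"
  proof (rule W\<^sub>0.submoduleI_smult)
    have "cls (prepend K b \<zero>\<^bsub>W\<^sub>0\<^esub>) = \<zero>\<^bsub>Q\<^esub>" if "b \<in> carrier B" for b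
      using module_hom_zero[OF W\<^sub>0.module_axioms W.module_axioms prepend_hom[OF that]]
        module_hom_zero[OF W.module_axioms quot_module quot_hom] by (simp only:)
    moreover have "(\<lambda>b. \<zero>\<^bsub>Q\<^esub>) \<in> module_hom K B Q"
    proof -
      interpret Q: module K Q by (rule quot_module)
      show ?thesis by (rule module_homI) simp_all
    qed
    ultimately have "(\<lambda>b. cls (prepend K b \<zero>\<^bsub>W\<^sub>0\<^esub>)) \<in> module_hom K B Q"
      by (rule module_hom_cong[OF _ B.module_axioms])
    then show "\<zero>\<^bsub>W\<^sub>0\<^esub> \<in> ?N"
      using W\<^sub>0.M.zero_closed by blast
    fix f g assume f: "f \<in> ?N" and g: "g \<in> ?N"
    have "cls (prepend K b (f \<oplus>\<^bsub>W\<^sub>0\<^esub> g)) = cls (prepend K b f) \<oplus>\<^bsub>Q\<^esub> cls (prepend K b g)"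
      if b: "b \<in> carrier B" for b
    proof -
      have fg: "f \<in> carrier W\<^sub>0" "g \<in> carrier W\<^sub>0" using f g by blast+
      show ?thesis
        unfolding p(2)[OF b fg] by (rule q(2)[OF p(1)[OF b fg(1)] p(1)[OF b fg(2)]])
    qed
    then have "(\<lambda>b. cls (prepend K b (f \<oplus>\<^bsub>W\<^sub>0\<^esub> g))) \<in> module_hom K B Q"
      by (rule module_hom_cong[OF _ B.module_axioms module_hom_add[OF quot_module]]) (use f g in blast)+
    then show "f \<oplus>\<^bsub>W\<^sub>0\<^esub> g \<in> ?N"
      using W\<^sub>0.M.a_closed f g by blast
  next
    fix c f assume c: "c \<in> carrier K" and f: "f \<in> ?N"
    have "cls (prepend K b (c \<odot>\<^bsub>W\<^sub>0\<^esub> f)) = c \<odot>\<^bsub>Q\<^esub> cls (prepend K b f)" if b: "b \<in> carrier B" for b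
    proof -
      have f': "f \<in> carrier W\<^sub>0" using f by blast
      show ?thesis
        unfolding p(3)[OF b c f'] by (rule q(3)[OF c p(1)[OF b f']])
    qed
    then have "(\<lambda>b. cls (prepend K b (c \<odot>\<^bsub>W\<^sub>0\<^esub> f))) \<in> module_hom K B Q"
      by (rule module_hom_cong[OF _ B.module_axioms module_hom_smult[OF quot_module c]]) (use f in blast)+
    then show "c \<odot>\<^bsub>W\<^sub>0\<^esub> f \<in> ?N"
      using W\<^sub>0.smult_closed[OF c] f by blast
  qed blast
  then have "f \<in> ?N"
  proof (rule B.R.free_algebra_induct[OF _ _ f])
    fix w assume "w \<in> words"
    then have w: "set w \<subseteq> carrier B" by simp
    have "(\<lambda>b. cls (prepend K b (delta K w))) \<in> module_hom K B Q"
      unfolding prepend_delta using letter_hom[of "[]", OF _ w] by simp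
    then show "delta K w \<in> ?N"
      using delta_in\<^sub>0[OF w] by blast
  qed
  then show ?thesis by blast
qed

text \<open>The shape of the sum is that of the three-term shuffle recursion.\<close>

lemma cls_sum_hom:
  assumes f: "\<And>x. x \<in> carrier B \<Longrightarrow> f x \<in> carrier W" "(\<lambda>x. cls (f x)) \<in> module_hom K B Q"
    and g: "\<And>x. x \<in> carrier B \<Longrightarrow> g x \<in> carrier W" "(\<lambda>x. cls (g x)) \<in> module_hom K B Q"
    and h: "\<And>x. x \<in> carrier B \<Longrightarrow> h x \<in> carrier W" "(\<lambda>x. cls (h x)) \<in> module_hom K B Q"
  shows "(\<lambda>x. cls (f x \<oplus>\<^bsub>W\<^esub> g x \<oplus>\<^bsub>W\<^esub> lam \<odot>\<^bsub>W\<^esub> h x)) \<in> module_hom K B Q"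
proof (rule module_hom_cong[OF _ B.module_axioms])
  note q = module_homD[OF quot_hom]
  show "(\<lambda>x. cls (f x) \<oplus>\<^bsub>Q\<^esub> cls (g x) \<oplus>\<^bsub>Q\<^esub> lam \<odot>\<^bsub>Q\<^esub> cls (h x)) \<in> module_hom K B Q"
    by (intro module_hom_add module_hom_smult quot_module lam_closed f(2) g(2) h(2))
  fix x assume x: "x \<in> carrier B"
  show "cls (f x \<oplus>\<^bsub>W\<^esub> g x \<oplus>\<^bsub>W\<^esub> lam \<odot>\<^bsub>W\<^esub> h x) = cls (f x) \<oplus>\<^bsub>Q\<^esub> cls (g x) \<oplus>\<^bsub>Q\<^esub> lam \<odot>\<^bsub>Q\<^esub> cls (h x)"
    by (simp only: q(2)[OF W.M.a_closed[OF f(1)[OF x] g(1)[OF x]] W.smult_closed[OF lam_closed h(1)[OF x]]]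
        q(2)[OF f(1)[OF x] g(1)[OF x]] q(3)[OF lam_closed h(1)[OF x]])
qed

text \<open>This makes the relations an ideal. The recursion removes letters from \<open>u\<close>
  and \<open>w\<close> until the varying letter becomes the first one, so the induction is on the
  length of these two, while the suffix \<open>v\<close> stays fixed.\<close>

lemma shuffle_letter_hom:
  assumes "set u \<subseteq> carrier B" "set v \<subseteq> carrier B" "set w \<subseteq> carrier B"
  shows "(\<lambda>x. cls (sh (u @ [x] @ v) w)) \<in> module_hom K B Q"
  using assms
proof (induction "length u + length w" arbitrary: u w rule: less_induct)
  case less
  note v = less.prems(2)
  show ?case
  proof (cases w)
    case Nil
    then show ?thesis
      unfolding Nil shuffle_Nil_right by (intro letter_hom less.prems)
  next
    case w: (Cons c w')
    have c: "c \<in> carrier B" "set w' \<subseteq> carrier B"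
      using less.prems(3) w by auto
    have closed: "sh u\<^sub>1 u\<^sub>2 \<in> carrier W\<^sub>0" "u\<^sub>1 \<noteq> [] \<or> u\<^sub>2 \<noteq> [] \<Longrightarrow> sh u\<^sub>1 u\<^sub>2 \<in> carrier W"
      if "set u\<^sub>1 \<subseteq> carrier B" "set u\<^sub>2 \<subseteq> carrier B" for u\<^sub>1 u\<^sub>2
      using shuffle_closed[OF that] .
    show ?thesis
    proof (cases u)
      case Nil
      \<comment> \<open>The varying letter is now in front. Only the middle term of the recursion
        keeps it inside a shuffle and calls the induction hypothesis; the outer two prepend it, or
        its product with \<open>c\<close>, to a fixed combination.\<close>
      have 2: "(\<lambda>x. cls (prepend K c (sh (x # v) w'))) \<in> module_hom K B Q"
      proof (rule prepend_hom_cong[OF c(1)])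
        show "sh (x # v) w' \<in> carrier W" if "x \<in> carrier B" for x
          by (rule closed(2)) (use that v c in auto)
        show "(\<lambda>x. cls (sh (x # v) w')) \<in> module_hom K B Q"
          using less.hyps[of "[]" w'] v c w by simp
      qed
      have 3: "(\<lambda>x. cls (prepend K (x \<otimes>\<^bsub>B\<^esub> c) (sh v w'))) \<in> module_hom K B Q"
        by (rule module_hom_compose[OF B.mult_hom[OF c(1)] first_letter_hom[OF closed(1)[OF v c(2)]]])
      have 1: "(\<lambda>x. cls (prepend K x (sh v (c # w')))) \<in> module_hom K B Q"
        by (rule first_letter_hom[OF closed(1)[OF v less.prems(3)[unfolded w]]])
      show ?thesis
        unfolding Nil w append_Nil append_Cons shuffle_Cons
      proof (rule cls_sum_hom[OF _ 1 _ 2 _ 3])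
        fix x assume x: "x \<in> carrier B"
        show "prepend K x (sh v (c # w')) \<in> carrier W"
          by (rule prepend_closed[OF x closed(1)[OF v less.prems(3)[unfolded w]]])
        show "prepend K c (sh (x # v) w') \<in> carrier W"
          by (rule prepend_closed[OF c(1) closed(1)[OF _ c(2)]]) (use x v in simp)
        show "prepend K (x \<otimes>\<^bsub>B\<^esub> c) (sh v w') \<in> carrier W"
          by (rule prepend_closed[OF B.mult_closed[OF x c(1)] closed(1)[OF v c(2)]])
      qed
    next
      case u: (Cons a u')
      have a: "a \<in> carrier B" "set u' \<subseteq> carrier B"
        using less.prems(1) u by auto
      have mid: "set (u' @ [x] @ v) \<subseteq> carrier B" "set (a # u' @ [x] @ v) \<subseteq> carrier B"
        if "x \<in> carrier B" for x
        using that a v by auto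
      have cw: "set (c # w') \<subseteq> carrier B" using c by simp
      \<comment> \<open>Here a fixed letter precedes the varying one, so each of the three terms
        prepends a fixed letter to a shorter shuffle of the same kind.\<close>
      have 1: "(\<lambda>x. cls (prepend K a (sh (u' @ [x] @ v) (c # w')))) \<in> module_hom K B Q"
      proof (rule prepend_hom_cong[OF a(1)])
        show "sh (u' @ [x] @ v) (c # w') \<in> carrier W" if "x \<in> carrier B" for x
          by (rule closed(2)[OF mid(1)[OF that] cw]) simp
        show "(\<lambda>x. cls (sh (u' @ [x] @ v) (c # w'))) \<in> module_hom K B Q"
          by (rule less.hyps[OF _ a(2) v cw]) (simp add: u w)
      qed
      have 2: "(\<lambda>x. cls (prepend K c (sh (a # u' @ [x] @ v) w'))) \<in> module_hom K B Q"
      proof (rule prepend_hom_cong[OF c(1)])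
        show "sh (a # u' @ [x] @ v) w' \<in> carrier W" if "x \<in> carrier B" for x
          by (rule closed(2)[OF mid(2)[OF that] c(2)]) simp
        have "(\<lambda>x. cls (sh ((a # u') @ [x] @ v) w')) \<in> module_hom K B Q"
          by (rule less.hyps[OF _ _ v c(2)]) (use a in \<open>simp_all add: u w\<close>)
        then show "(\<lambda>x. cls (sh (a # u' @ [x] @ v) w')) \<in> module_hom K B Q"
          by (simp only: append_Cons)
      qed
      have ac: "a \<otimes>\<^bsub>B\<^esub> c \<in> carrier B" by (rule B.mult_closed[OF a(1) c(1)])
      have 3: "(\<lambda>x. cls (prepend K (a \<otimes>\<^bsub>B\<^esub> c) (sh (u' @ [x] @ v) w'))) \<in> module_hom K B Q"
      proof (rule prepend_hom_cong[OF ac])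
        show "sh (u' @ [x] @ v) w' \<in> carrier W" if "x \<in> carrier B" for x
          by (rule closed(2)[OF mid(1)[OF that] c(2)]) simp
        show "(\<lambda>x. cls (sh (u' @ [x] @ v) w')) \<in> module_hom K B Q"
          by (rule less.hyps[OF _ a(2) v c(2)]) (simp add: u w)
      qed
      have eq: "(a # u') @ [x] @ v = a # (u' @ [x] @ v)" for x by simp
      show ?thesis
        unfolding u w eq shuffle_Cons
      proof (rule cls_sum_hom[OF _ 1 _ 2 _ 3])
        fix x assume x: "x \<in> carrier B"
        show "prepend K a (sh (u' @ [x] @ v) (c # w')) \<in> carrier W"
          by (rule prepend_closed[OF a(1) closed(1)[OF mid(1)[OF x] cw]])
        show "prepend K c (sh (a # u' @ [x] @ v) w') \<in> carrier W"
          by (rule prepend_closed[OF c(1) closed(1)[OF mid(2)[OF x] c(2)]])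
        show "prepend K (a \<otimes>\<^bsub>B\<^esub> c) (sh (u' @ [x] @ v) w') \<in> carrier W"
          by (rule prepend_closed[OF ac closed(1)[OF mid(1)[OF x] c(2)]])
      qed
    qed
  qed
qed

text \<open>A basis word times \<open>w\<close> is their shuffle, whose class is linear in each
  letter; so multiplication by \<open>w\<close> meets the criterion for killing the
  relations.\<close>

lemma gens_ideal:
  assumes g: "g \<in> rel_gens" and w: "w \<in> {w. w \<noteq> [] \<and> set w \<subseteq> carrier B}"
  shows "g \<otimes>\<^bsub>W\<^esub> delta K w \<in> rels"
proof -
  have w': "w \<noteq> []" "set w \<subseteq> carrier B" using w by simp_all
  note dw = delta_in[OF w']
  have g': "g \<in> rels" "g \<in> carrier W" using g gens_subset gens_closed by blast+
  have "cls (g \<otimes>\<^bsub>W\<^esub> delta K w) = \<zero>\<^bsub>Q\<^esub>"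
  proof (rule rels_kernel[OF module_hom_compose[OF W.mult_hom[OF dw] quot_hom] _ g'(1)])
    fix u v assume u: "set u \<subseteq> carrier B" and v: "set v \<subseteq> carrier B"
    show "(\<lambda>b. cls (delta K (u @ [b] @ v) \<otimes>\<^bsub>W\<^esub> delta K w)) \<in> module_hom K B Q"
    proof (rule module_hom_cong[OF _ B.module_axioms shuffle_letter_hom[OF u v w'(2)]])
      fix b assume b: "b \<in> carrier B"
      have "delta K (u @ [b] @ v) \<otimes>\<^bsub>W\<^esub> delta K w = sh (u @ [b] @ v) w"
        by (rule delta_mult[OF _ _ w']) (use u v b in auto)
      then show "cls (delta K (u @ [b] @ v) \<otimes>\<^bsub>W\<^esub> delta K w) = cls (sh (u @ [b] @ v) w)"
        by (simp only:)
    qed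
  qed
  then show ?thesis
    using cls_zero_iff[OF W.mult_closed[OF g'(2) dw]] by blast
qed

lemma rels_ideal:
  assumes "x \<in> rels" "y \<in> carrier W"
  shows "x \<otimes>\<^bsub>W\<^esub> y \<in> rels"
  unfolding rels_eq
  by (rule free_algebra_product.span_ideal[OF product, folded word_free_def, OF gens_closed
        gens_ideal[unfolded rels_eq] assms[unfolded rels_eq]])

lemma quot_algebra: "comm_nonassoc_algebra K Q"
  unfolding Sh_plus_def by (rule W.alg_quot_algebra[OF rels_submodule rels_ideal])

lemma word_tensor_mult:
  assumes "u \<noteq> []" "set u \<subseteq> carrier B" "v \<noteq> []" "set v \<subseteq> carrier B"
  shows "word_tensor K lam B u \<otimes>\<^bsub>Q\<^esub> word_tensor K lam B v = cls (sh u v)"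
  using W.alg_quot_mult[OF rels_submodule rels_ideal delta_in[OF assms(1,2)] delta_in[OF assms(3,4)]]
  by (simp only: word_tensor_def Sh_plus_def delta_mult[OF assms])

end

section \<open>Algebra homomorphisms and evaluation of polynomials\<close>

text \<open>Closure of the span under products is proved together with multiplicativity because
  linearity of \<open>h\<close> is available only on the span. With the identity as
  \<open>h\<close>, the lemma yields closure alone.\<close>

lemma span_mult_hom:
  assumes M: "comm_nonassoc_algebra K M" and N: "comm_nonassoc_algebra K N" and G: "G \<subseteq> carrier M"
    and h: "h \<in> module_hom K (M\<lparr>carrier := span_of K M G\<rparr>) N"
    and gens: "\<And>x y. x \<in> G \<Longrightarrow> y \<in> G \<Longrightarrow>
      x \<otimes>\<^bsub>M\<^esub> y \<in> span_of K M G \<and> h (x \<otimes>\<^bsub>M\<^esub> y) = h x \<otimes>\<^bsub>N\<^esub> h y"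
    and x: "x \<in> span_of K M G" and y: "y \<in> span_of K M G"
  shows "x \<otimes>\<^bsub>M\<^esub> y \<in> span_of K M G \<and> h (x \<otimes>\<^bsub>M\<^esub> y) = h x \<otimes>\<^bsub>N\<^esub> h y"
proof -
  interpret M: comm_nonassoc_algebra K M by fact
  interpret N: comm_nonassoc_algebra K N by fact
  let ?S = "span_of K M G"
  note S = M.span_of_submodule[OF G]
  note SE = M.submoduleE[OF S]
  have closed: "h x \<in> carrier N" if "x \<in> ?S" for x
    using module_homD(1)[OF h, of x] that by simp
  have add: "h (x \<oplus>\<^bsub>M\<^esub> y) = h x \<oplus>\<^bsub>N\<^esub> h y" if "x \<in> ?S" "y \<in> ?S" for x y
    using module_homD(2)[OF h, of x y] that by simp
  have smult: "h (c \<odot>\<^bsub>M\<^esub> x) = c \<odot>\<^bsub>N\<^esub> h x" if "c \<in> carrier K" "x \<in> ?S" for c x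
    using module_homD(3)[OF h, of c x] that by simp
  have zero: "h \<zero>\<^bsub>M\<^esub> = \<zero>\<^bsub>N\<^esub>"
    using smult[OF M.R.zero_closed M.submodule_zero[OF S]] closed[OF M.submodule_zero[OF S]] by simp
  define mult where "mult x y \<longleftrightarrow> x \<otimes>\<^bsub>M\<^esub> y \<in> ?S \<and> h (x \<otimes>\<^bsub>M\<^esub> y) = h x \<otimes>\<^bsub>N\<^esub> h y" for x y
  have sub: "submodule {x \<in> ?S. mult x y} K M" if y: "y \<in> ?S" for y
  proof (rule M.submoduleI_smult)
    have y': "y \<in> carrier M" using SE(1) y by blast
    show "{x \<in> ?S. mult x y} \<subseteq> carrier M" using SE(1) by blast
    have "mult \<zero>\<^bsub>M\<^esub> y"
      unfolding mult_def M.zero_mult[OF y'] zero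
      using M.submodule_zero[OF S] zero N.zero_mult[OF closed[OF y]] by simp
    then show "\<zero>\<^bsub>M\<^esub> \<in> {x \<in> ?S. mult x y}"
      using M.submodule_zero[OF S] by blast
    fix a b assume "a \<in> {x \<in> ?S. mult x y}" "b \<in> {x \<in> ?S. mult x y}"
    then have ab: "a \<in> ?S" "b \<in> ?S" "mult a y" "mult b y" by blast+
    have "a \<in> carrier M" "b \<in> carrier M" using SE(1) ab by blast+
    note eq = M.mult_l_distr[OF this y']
    have "mult (a \<oplus>\<^bsub>M\<^esub> b) y"
      using ab(3,4) SE(5) add N.mult_l_distr[OF closed[OF ab(1)] closed[OF ab(2)] closed[OF y]]
        add[OF ab(1,2)]
      unfolding mult_def eq by simp
    then show "a \<oplus>\<^bsub>M\<^esub> b \<in> {x \<in> ?S. mult x y}"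
      using SE(5)[OF ab(1,2)] by blast
  next
    have y': "y \<in> carrier M" using SE(1) y by blast
    fix c a assume c: "c \<in> carrier K" and "a \<in> {x \<in> ?S. mult x y}"
    then have a: "a \<in> ?S" "mult a y" by blast+
    have "a \<in> carrier M" using SE(1) a by blast
    note eq = M.smult_mult[OF c this y']
    have "mult (c \<odot>\<^bsub>M\<^esub> a) y"
      using a(2) SE(4)[OF c] smult[OF c] N.smult_mult[OF c closed[OF a(1)] closed[OF y]] smult[OF c a(1)]
      unfolding mult_def eq by simp
    then show "c \<odot>\<^bsub>M\<^esub> a \<in> {x \<in> ?S. mult x y}"
      using SE(4)[OF c a(1)] by blast
  qed
  \<comment> \<open>The submodule argument treats the left factor; this symmetry carries it over to
    the right one.\<close>
  have comm: "mult y x" if "mult x y" "x \<in> ?S" "y \<in> ?S" for x y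
  proof -
    have xy: "x \<in> carrier M" "y \<in> carrier M" using SE(1) that by blast+
    show ?thesis
      using that(1) unfolding mult_def M.mult_comm[OF xy] N.mult_comm[OF closed[OF that(2)] closed[OF that(3)]] .
  qed
  have GS: "g \<in> ?S" if "g \<in> G" for g
    using subsetD[OF span_of_superset that] .
  have 1: "mult x g" if x: "x \<in> ?S" and g: "g \<in> G" for x g
  proof -
    have "G \<subseteq> {x \<in> ?S. mult x g}"
    proof
      fix f assume f: "f \<in> G"
      show "f \<in> {x \<in> ?S. mult x g}"
        using gens[OF f g, folded mult_def] GS[OF f] by simp
    qed
    from subsetD[OF span_of_minimal[OF sub[OF GS[OF g]] this] x] show ?thesis by simp
  qed
  have "G \<subseteq> {y \<in> ?S. mult y x}"
  proof
    fix g assume g: "g \<in> G"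
    show "g \<in> {y \<in> ?S. mult y x}"
      using comm[OF 1[OF x g] x GS[OF g]] GS[OF g] by simp
  qed
  from subsetD[OF span_of_minimal[OF sub[OF x] this] y] have "mult y x" by simp
  from comm[OF this y x] show ?thesis unfolding mult_def .
qed

section \<open>Polynomial evaluation\<close>

lemma alg_hom_zero:
  assumes "comm_nonassoc_algebra K M" "comm_nonassoc_algebra K N" "h \<in> alg_hom K M N"
  shows "h \<zero>\<^bsub>M\<^esub> = \<zero>\<^bsub>N\<^esub>"
  using assms by (intro module_hom_zero[of K]) (simp_all add: alg_hom_def comm_nonassoc_algebra_def)

lemma list_prod_closed:
  assumes "comm_nonassoc_algebra K M"
  shows "xs \<noteq> [] \<Longrightarrow> set xs \<subseteq> carrier M \<Longrightarrow> list_prod M xs \<in> carrier M"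
proof (induction xs rule: induct_list012)
  case (3 x y xs)
  then show ?case
    using comm_nonassoc_algebra.mult_closed[OF assms] by simp
qed simp_all

text \<open>\<open>list_prod\<close> fixes the bracketing to the right, so a multiplicative map
  passes through it factor by factor. The empty list is excluded since its product is
  \<open>one\<close>, which \<open>h\<close> need not preserve.\<close>

lemma list_prod_hom:
  assumes "comm_nonassoc_algebra K M" "h \<in> alg_hom K M N"
  shows "xs \<noteq> [] \<Longrightarrow> set xs \<subseteq> carrier M \<Longrightarrow> h (list_prod M xs) = list_prod N (map h xs)"
proof (induction xs rule: induct_list012)
  case (3 x y xs)
  then have "list_prod M (y # xs) \<in> carrier M"
    by (intro list_prod_closed[OF assms(1)]) auto
  then show ?case
    using 3 assms(2) by (simp add: alg_hom_def)
qed simp_all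

lemma finsum_module_hom:
  assumes "module K M" "module K N" "h \<in> module_hom K M N" "finite S"
  shows "f \<in> S \<rightarrow> carrier M \<Longrightarrow> h (\<Oplus>\<^bsub>M\<^esub>s\<in>S. f s) = (\<Oplus>\<^bsub>N\<^esub>s\<in>S. h (f s))"
  using assms(4)
proof induction
  interpret M: module K M by fact
  interpret N: module K N by fact
  {
    case empty
    show ?case
      using module_hom_zero[OF assms(1-3)] by simp
  next
    case (insert s S)
    have f: "f \<in> S \<rightarrow> carrier M" "f s \<in> carrier M"
      using insert.prems by auto
    have hf: "(\<lambda>s. h (f s)) \<in> S \<rightarrow> carrier N" "h (f s) \<in> carrier N"
      using f module_homD(1)[OF assms(3)] by auto
    show ?case
      unfolding M.finsum_insert[OF insert.hyps f] N.finsum_insert[OF insert.hyps hf]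
        module_homD(2)[OF assms(3) f(2) M.finsum_closed[OF f(1)]] insert.IH[OF f(1)] ..
  }
qed

text \<open>Polynomials are an inductive closure under constants, sums and multiplication by a
  variable. The induction recovers from it the pointwise description that a finite sum over
  monomials requires.\<close>

lemma (in ring) indexed_psetD:
  assumes "F \<in> indexed_pset I (carrier R)"
  shows "F m \<in> carrier R" "finite {m. F m \<noteq> \<zero>}" "F m \<noteq> \<zero> \<Longrightarrow> set_mset m \<subseteq> I"
proof -
  have "(\<forall>m. F m \<in> carrier R) \<and> finite {m. F m \<noteq> \<zero>} \<and> (\<forall>m. F m \<noteq> \<zero> \<longrightarrow> set_mset m \<subseteq> I)"
    using assms
  proof induction
    case (indexed_const c)
    then show ?case
      by (auto simp: indexed_const_def intro: finite_subset[of _ "{{#}}"])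
  next
    case (indexed_padd F G)
    have "{m. indexed_padd F G m \<noteq> \<zero>} \<subseteq> {m. F m \<noteq> \<zero>} \<union> {m. G m \<noteq> \<zero>}"
      by (auto simp: indexed_padd_def)
    moreover have "finite \<dots>" using indexed_padd.IH by blast
    ultimately have "finite {m. indexed_padd F G m \<noteq> \<zero>}" by (rule finite_subset)
    moreover have "F m \<noteq> \<zero> \<or> G m \<noteq> \<zero>" if "indexed_padd F G m \<noteq> \<zero>" for m
      using that by (auto simp: indexed_padd_def)
    ultimately show ?case
      using indexed_padd.IH by (auto simp: indexed_padd_def) blast+
  next
    case (indexed_pmult F i)
    \<comment> \<open>Multiplication by a variable shifts the support: each monomial gains one copy
      of \<open>i\<close>.\<close>
    have "{m. indexed_pmult F i m \<noteq> \<zero>} \<subseteq> add_mset i ` {m. F m \<noteq> \<zero>}"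
    proof
      fix m assume "m \<in> {m. indexed_pmult F i m \<noteq> \<zero>}"
      then have "i \<in># m" "F (m - {#i#}) \<noteq> \<zero>"
        by (auto simp: indexed_pmult_def split: if_splits)
      then show "m \<in> add_mset i ` {m. F m \<noteq> \<zero>}"
        by (intro image_eqI[of _ _ "m - {#i#}"]) auto
    qed
    then have "finite {m. indexed_pmult F i m \<noteq> \<zero>}"
      using indexed_pmult.IH by (auto intro: finite_subset)
    moreover have "set_mset m \<subseteq> I" if "indexed_pmult F i m \<noteq> \<zero>" for m
    proof -
      have m: "i \<in># m" "F (m - {#i#}) \<noteq> \<zero>"
        using that by (auto simp: indexed_pmult_def split: if_splits)
      then have "set_mset (m - {#i#}) \<subseteq> I" using indexed_pmult.IH by blast
      moreover have "m = add_mset i (m - {#i#})" using m(1) by simp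
      ultimately show ?thesis
        using indexed_pmult.hyps(2) by (metis insert_subset set_mset_add_mset_insert)
    qed
    moreover have "indexed_pmult F i m \<in> carrier R" for m
      using indexed_pmult.IH by (simp add: indexed_pmult_def)
    ultimately show ?case by blast
  qed
  then show "F m \<in> carrier R" "finite {m. F m \<noteq> \<zero>}" "F m \<noteq> \<zero> \<Longrightarrow> set_mset m \<subseteq> I"
    by blast+
qed

text \<open>The vanishing constant term keeps the empty monomial out of the sum. All remaining
  monomials are nonempty products, which an algebra homomorphism without unit condition
  respects.\<close>

lemma poly_eval_hom:
  assumes M: "comm_nonassoc_algebra K M" and N: "comm_nonassoc_algebra K N"
    and h: "h \<in> alg_hom K M N"
    and F: "F \<in> ring.indexed_pset K I (carrier K)" "F {#} = \<zero>\<^bsub>K\<^esub>"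
    and x: "\<And>i. i \<in> I \<Longrightarrow> x i \<in> carrier M"
  shows "h (poly_eval K M F x) = poly_eval K N F (\<lambda>i. h (x i))"
proof -
  interpret M: comm_nonassoc_algebra K M by fact
  interpret N: comm_nonassoc_algebra K N by fact
  note FD = M.R.indexed_psetD[OF F(1)]
  have hm: "h \<in> module_hom K M N" using h by (simp add: alg_hom_def)
  let ?p = "\<lambda>m. list_prod M (map x (sorted_list_of_multiset m))"
  let ?q = "\<lambda>m. list_prod N (map (\<lambda>i. h (x i)) (sorted_list_of_multiset m))"
  have xs: "map x (sorted_list_of_multiset m) \<noteq> []" "set (map x (sorted_list_of_multiset m)) \<subseteq> carrier M"
    if "F m \<noteq> \<zero>\<^bsub>K\<^esub>" for m
  proof -
    have "m \<noteq> {#}" using that F(2) by blast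
    then show "map x (sorted_list_of_multiset m) \<noteq> []"
      by (metis map_is_Nil_conv mset.simps(1) mset_sorted_list_of_multiset)
    show "set (map x (sorted_list_of_multiset m)) \<subseteq> carrier M"
      using FD(3)[OF that] x by auto
  qed
  have p: "?p m \<in> carrier M" if "F m \<noteq> \<zero>\<^bsub>K\<^esub>" for m
    by (rule list_prod_closed[OF M xs[OF that]])
  have hp: "h (?p m) = ?q m" if "F m \<noteq> \<zero>\<^bsub>K\<^esub>" for m
    using list_prod_hom[OF M h xs[OF that]] by (simp add: comp_def)
  have "h (poly_eval K M F x) = (\<Oplus>\<^bsub>N\<^esub>m\<in>{m. F m \<noteq> \<zero>\<^bsub>K\<^esub>}. h (F m \<odot>\<^bsub>M\<^esub> ?p m))"
    unfolding poly_eval_def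
    by (rule finsum_module_hom[OF M.module_axioms N.module_axioms hm FD(2)])
      (use p FD(1) in auto)
  also have "\<dots> = (\<Oplus>\<^bsub>N\<^esub>m\<in>{m. F m \<noteq> \<zero>\<^bsub>K\<^esub>}. F m \<odot>\<^bsub>N\<^esub> ?q m)"
  proof (rule N.M.finsum_cong'[OF refl])
    have "F m \<odot>\<^bsub>N\<^esub> ?q m \<in> carrier N" if "F m \<noteq> \<zero>\<^bsub>K\<^esub>" for m
      using N.smult_closed[OF FD(1) module_homD(1)[OF hm p[OF that]]] hp[OF that] by simp
    then show "(\<lambda>m. F m \<odot>\<^bsub>N\<^esub> ?q m) \<in> {m. F m \<noteq> \<zero>\<^bsub>K\<^esub>} \<rightarrow> carrier N" by blast
    fix m assume "m \<in> {m. F m \<noteq> \<zero>\<^bsub>K\<^esub>}"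
    then show "h (F m \<odot>\<^bsub>M\<^esub> ?p m) = F m \<odot>\<^bsub>N\<^esub> ?q m"
      using module_homD(3)[OF hm FD(1) p] hp by simp
  qed
  finally show ?thesis unfolding poly_eval_def .
qed

lemma (in cring) self_algebra: "comm_nonassoc_algebra R (self_algebra R)"
proof (rule comm_nonassoc_algebraI)
  show "module R (self_algebra R)"
  proof (rule moduleI)
    show "cring R" by (rule is_cring)
    show "abelian_group (self_algebra R)"
    proof (rule abelian_groupI)
      show "\<exists>y\<in>carrier (self_algebra R). y \<oplus>\<^bsub>self_algebra R\<^esub> x = \<zero>\<^bsub>self_algebra R\<^esub>"
        if "x \<in> carrier (self_algebra R)" for x
        using that by (intro bexI[of _ "\<ominus> x"]) (simp_all add: self_algebra_def l_neg)
    qed (simp_all add: self_algebra_def a_ac)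
  qed (simp_all add: self_algebra_def l_distr r_distr m_assoc)
qed (simp add: self_algebra_def l_distr r_distr m_ac)

section \<open>Multiplicativity of the MZV map\<close>

locale iteratedly_summable_subalgebra =
  partial_rota_baxter K R lam D P + filtered_subalgebra K R A Fil
  for K (structure) and R (structure) and lam D P A Fil +
  fixes k :: nat
  assumes summable: "iteratedly_summable R D P A Fil k"
begin

abbreviation At where "At \<equiv> unitarized_subalgebra K R A"
abbreviation emb where "emb f \<equiv> (\<zero>\<^bsub>K\<^esub>, f)"
abbreviation adm where "adm \<equiv> admissible A Fil k"
abbreviation iter where "iter \<equiv> P_iter R P"

lemma At_algebra: "comm_nonassoc_algebra K At"
  by (rule unitarization_algebra[OF comm_nonassoc_algebra.subalgebra[OF comm_nonassoc_algebra
        sub_submodule sub_mult]])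

sublocale words: mixable_shuffle_algebra K At lam
  by (intro mixable_shuffle_algebra.intro mixable_shuffle_algebra_axioms.intro At_algebra weight_closed)

sublocale ten: tensor_product K At "unitarization K (Sh_plus K lam At)"
  by (intro tensor_product.intro At_algebra unitarization_algebra words.quot_algebra)

lemmas A_submodule = submoduleE[OF sub_submodule]
lemmas D_submodule = submoduleE[OF domain_submodule]

lemma P_closed: "d \<in> D \<Longrightarrow> P d \<in> carrier R"
  using module_homD(1)[OF operator_linear, of d] by simp

lemma P_add: "d \<in> D \<Longrightarrow> e \<in> D \<Longrightarrow> P (d \<oplus>\<^bsub>R\<^esub> e) = P d \<oplus>\<^bsub>R\<^esub> P e"
  using module_homD(2)[OF operator_linear, of d e] by simp

lemma P_smult: "c \<in> carrier K \<Longrightarrow> d \<in> D \<Longrightarrow> P (c \<odot>\<^bsub>R\<^esub> d) = c \<odot>\<^bsub>R\<^esub> P d"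
  using module_homD(3)[OF operator_linear, of c d] by simp

lemma A_carrier: "a \<in> A \<Longrightarrow> a \<in> carrier R"
  using A_submodule(1) by blast

lemma emb_closed: "a \<in> A \<Longrightarrow> emb a \<in> carrier At"
  by (simp add: unitarization_def)

lemma emb_mult:
  assumes "a \<in> A" "b \<in> A"
  shows "emb a \<otimes>\<^bsub>At\<^esub> emb b = emb (a \<otimes>\<^bsub>R\<^esub> b)"
  using A_carrier[OF assms(1)] A_carrier[OF assms(2)]
  by (simp add: unitarization_def mult_closed)

lemma one_closed_At: "\<one>\<^bsub>At\<^esub> \<in> carrier At"
  using submodule_zero[OF sub_submodule] by (simp add: unitarization_def)

text \<open>Every generator has the unit in its first tensor slot, so this evaluates that slot of a
  product of two generators.\<close>

lemma one_mult_At: "\<one>\<^bsub>At\<^esub> \<otimes>\<^bsub>At\<^esub> \<one>\<^bsub>At\<^esub> = \<one>\<^bsub>At\<^esub>"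
  using smult_mult[of "\<zero>\<^bsub>K\<^esub>" "\<zero>\<^bsub>R\<^esub>" "\<zero>\<^bsub>R\<^esub>"] mult_closed[of "\<zero>\<^bsub>R\<^esub>" "\<zero>\<^bsub>R\<^esub>"]
  by (simp add: unitarization_def)

section \<open>Admissible words and their values\<close>

lemma admD:
  assumes "fs \<in> adm"
  shows "fs \<noteq> []" "set fs \<subseteq> A" "set (map emb fs) \<subseteq> carrier At" "map emb fs \<noteq> []"
proof -
  show fs: "fs \<noteq> []" "set fs \<subseteq> A" using assms by (simp_all add: admissible_def)
  show "set (map emb fs) \<subseteq> carrier At" using fs(2) emb_closed by auto
  show "map emb fs \<noteq> []" using fs(1) by simp
qed

lemma adm_ConsD:
  assumes "a # fs \<in> adm"
  shows "a \<in> A" "fs = [] \<Longrightarrow> a \<in> Fil k" "fs \<noteq> [] \<Longrightarrow> fs \<in> adm"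
  using assms by (simp_all add: admissible_def)

lemma adm_ConsI: "a \<in> A \<Longrightarrow> fs \<in> adm \<Longrightarrow> a # fs \<in> adm"
  by (simp add: admissible_def)

lemma adm_single: "a \<in> Fil k \<Longrightarrow> [a] \<in> adm"
  using Fil_subset[of k] by (auto simp: admissible_def)

text \<open>The element to which the outermost \<open>P\<close> of an iterated value is applied. It
  makes words of length one look like all others, so that the Rota--Baxter identity can be used
  without distinguishing lengths.\<close>

definition arg where
  "arg fs = (if tl fs = [] then hd fs else hd fs \<otimes>\<^bsub>R\<^esub> iter (tl fs))"

lemma arg_Cons: "arg [a] = a" "fs \<noteq> [] \<Longrightarrow> arg (a # fs) = a \<otimes>\<^bsub>R\<^esub> iter fs"
  by (simp_all add: arg_def)

lemma arg_domain:
  assumes "fs \<in> adm"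
  shows "arg fs \<in> D" "iter fs = P (arg fs)"
proof -
  have "P_iter_defined R D P fs"
    using summable assms by (simp add: iteratedly_summable_def)
  then have "arg fs \<in> D \<and> iter fs = P (arg fs)"
    by (cases "(R, D, P, fs)" rule: P_iter_defined.cases) (simp_all add: arg_def)
  then show "arg fs \<in> D" "iter fs = P (arg fs)" by blast+
qed

lemma iter_closed: "fs \<in> adm \<Longrightarrow> iter fs \<in> carrier R"
  using arg_domain[of fs] P_closed by simp

lemma iter_Cons:
  assumes "a \<in> A" "fs \<in> adm"
  shows "a \<otimes>\<^bsub>R\<^esub> iter fs \<in> D" "iter (a # fs) = P (a \<otimes>\<^bsub>R\<^esub> iter fs)"
  using arg_domain[OF adm_ConsI[OF assms]] arg_Cons(2)[OF admD(1)[OF assms(2)], of a] by simp_all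

text \<open>The linear extension of \<open>f\<^sub>1 \<dots> f\<^sub>n \<mapsto> P\<^bsub>(f\<^sub>1, \<dots>, f\<^sub>n)\<^esub>\<close> to the free module on admissible words,
  as the graph of a linear map. Unlike the map on \<open>\<MM>(A)\<^sub>k\<close>, it is compatible with prepending a
  letter, which is what an induction along the shuffle recursion needs.\<close>

inductive value_of :: "(('a \<times> 'c) list \<Rightarrow> 'a) \<Rightarrow> 'c \<Rightarrow> bool" where
  word: "fs \<in> adm \<Longrightarrow> value_of (delta K (map emb fs)) (iter fs)"
| add: "value_of f r \<Longrightarrow> value_of g s \<Longrightarrow> value_of (f \<oplus>\<^bsub>words.W\<^esub> g) (r \<oplus>\<^bsub>R\<^esub> s)"
| smult: "c \<in> carrier K \<Longrightarrow> value_of f r \<Longrightarrow> value_of (c \<odot>\<^bsub>words.W\<^esub> f) (c \<odot>\<^bsub>R\<^esub> r)"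

abbreviation MZVs where "MZVs \<equiv> span_of K R (iter ` adm)"

lemma MZVs_submodule: "submodule MZVs K R"
  by (rule span_of_submodule) (use iter_closed in blast)

lemma value_of_closed:
  assumes "value_of f r"
  shows "f \<in> carrier words.W" "r \<in> MZVs" "r \<in> carrier R"
proof -
  have "f \<in> carrier words.W \<and> r \<in> MZVs"
    using assms
  proof induction
    case (word fs)
    have "iter fs \<in> MZVs"
      using word by (intro subsetD[OF span_of_superset] imageI)
    then show ?case
      using words.delta_in[OF admD(4,3)[OF word]] by blast
  next
    case (add f r g s)
    then show ?case
      using words.W.M.a_closed submoduleE(5)[OF MZVs_submodule] by blast
  next
    case (smult c f r)
    then show ?case
      using words.W.smult_closed submoduleE(4)[OF MZVs_submodule] by blast
  qed
  then show "f \<in> carrier words.W" "r \<in> MZVs" "r \<in> carrier R"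
    using submoduleE(1)[OF MZVs_submodule] by blast+
qed

text \<open>For a single word both claims are summability of the longer word. They extend to
  combinations because \<open>D\<close> is a submodule and \<open>P\<close> is linear on it;
  membership in \<open>D\<close> must travel along, as \<open>P\<close> can be split only
  there.\<close>

lemma value_of_prepend:
  assumes "value_of f r" and a: "a \<in> A"
  shows "a \<otimes>\<^bsub>R\<^esub> r \<in> D" "value_of (prepend K (emb a) f) (P (a \<otimes>\<^bsub>R\<^esub> r))"
proof -
  note p = module_homD[OF words.prepend_hom_W[OF emb_closed[OF a]]]
  note a' = A_carrier[OF a]
  interpret RR: comm_nonassoc_algebra K R by (rule comm_nonassoc_algebra)
  have "a \<otimes>\<^bsub>R\<^esub> r \<in> D \<and> value_of (prepend K (emb a) f) (P (a \<otimes>\<^bsub>R\<^esub> r))"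
    using assms(1)
  proof induction
    case (word fs)
    have "value_of (delta K (map emb (a # fs))) (iter (a # fs))"
      by (rule value_of.word[OF adm_ConsI[OF a word]])
    then show ?case
      using iter_Cons[OF a word] by (simp only: words.prepend_delta list.map)
  next
    case (add f r g s)
    note f = value_of_closed[OF add.hyps(1)] and g = value_of_closed[OF add.hyps(2)]
    have IH: "a \<otimes>\<^bsub>R\<^esub> r \<in> D" "a \<otimes>\<^bsub>R\<^esub> s \<in> D" using add.IH by blast+
    show ?case
      unfolding p(2)[OF f(1) g(1)] RR.mult_r_distr[OF f(3) g(3) a'] P_add[OF IH]
      using add.IH D_submodule(5) value_of.add by blast
  next
    case (smult c f r)
    note f = value_of_closed[OF smult.hyps(2)]
    have IH: "a \<otimes>\<^bsub>R\<^esub> r \<in> D" using smult.IH by blast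
    show ?case
      unfolding p(3)[OF smult.hyps(1) f(1)] RR.mult_smult[OF smult.hyps(1) a' f(3)]
        P_smult[OF smult.hyps(1) IH]
      using smult.IH smult.hyps(1) D_submodule(4) value_of.smult by blast
  qed
  then show "a \<otimes>\<^bsub>R\<^esub> r \<in> D" "value_of (prepend K (emb a) f) (P (a \<otimes>\<^bsub>R\<^esub> r))"
    by blast+
qed

abbreviation shuffle where "shuffle u v \<equiv> words.sh (map emb u) (map emb v)"

text \<open>The first term of the recursion. By associativity in \<open>R\<close>, the argument of
  \<open>P\<close> is the letter \<open>a\<close> times the value of a shorter shuffle; if
  \<open>u\<close> is empty, that shuffle is the word \<open>v\<close>.\<close>

lemma value_of_prepend_shuffle:
  assumes u: "a # u \<in> adm" and v: "v \<in> adm"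
    and IH: "u \<noteq> [] \<Longrightarrow> value_of (shuffle u v) (iter u \<otimes>\<^bsub>R\<^esub> iter v)"
  shows "arg (a # u) \<otimes>\<^bsub>R\<^esub> iter v \<in> D"
    and "value_of (prepend K (emb a) (shuffle u v)) (P (arg (a # u) \<otimes>\<^bsub>R\<^esub> iter v))"
proof -
  note a = adm_ConsD[OF u]
  obtain r where r: "value_of (shuffle u v) r" "a \<otimes>\<^bsub>R\<^esub> r = arg (a # u) \<otimes>\<^bsub>R\<^esub> iter v"
  proof (cases "u = []")
    case True
    show ?thesis
      by (rule that[of "iter v"]) (use value_of.word[OF v] in \<open>simp_all add: True arg_Cons\<close>)
  next
    case False
    show ?thesis
      using mult_assoc[OF A_carrier[OF a(1)] iter_closed[OF a(3)[OF False]] iter_closed[OF v]]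
      by (intro that[OF IH[OF False]]) (simp only: arg_Cons(2)[OF False])
  qed
  from value_of_prepend[OF r(1) a(1)]
  show "arg (a # u) \<otimes>\<^bsub>R\<^esub> iter v \<in> D"
    "value_of (prepend K (emb a) (shuffle u v)) (P (arg (a # u) \<otimes>\<^bsub>R\<^esub> iter v))"
    unfolding r(2) .
qed

text \<open>The weight term. The argument of \<open>P\<close> is regrouped as the merged letter
  times the value of the shuffle of the tails, with separate cases for empty tails because
  \<open>iter\<close> has no meaningful value there.\<close>

lemma value_of_prepend_mult_shuffle:
  assumes u: "a # u \<in> adm" and v: "b # v \<in> adm"
    and IH: "u \<noteq> [] \<Longrightarrow> v \<noteq> [] \<Longrightarrow> value_of (shuffle u v) (iter u \<otimes>\<^bsub>R\<^esub> iter v)"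
  shows "arg (a # u) \<otimes>\<^bsub>R\<^esub> arg (b # v) \<in> D"
    and "value_of (prepend K (emb a \<otimes>\<^bsub>At\<^esub> emb b) (shuffle u v)) (P (arg (a # u) \<otimes>\<^bsub>R\<^esub> arg (b # v)))"
proof -
  note a = adm_ConsD[OF u] and b = adm_ConsD[OF v]
  note a' = A_carrier[OF a(1)] and b' = A_carrier[OF b(1)]
  have ab: "a \<otimes>\<^bsub>R\<^esub> b \<in> A" by (rule sub_mult[OF a(1) b(1)])
  have "arg (a # u) \<otimes>\<^bsub>R\<^esub> arg (b # v) \<in> D \<and>
    value_of (prepend K (emb (a \<otimes>\<^bsub>R\<^esub> b)) (shuffle u v)) (P (arg (a # u) \<otimes>\<^bsub>R\<^esub> arg (b # v)))"
  proof (cases "u = [] \<and> v = []")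
    case True
    \<comment> \<open>Both letters are last letters, so \<open>b\<close> lies in
      \<open>Fil k\<close>, and the ideal property keeps the merged letter there.\<close>
    have "[a \<otimes>\<^bsub>R\<^esub> b] \<in> adm"
      using True b a(1) by (intro adm_single Fil_ideal) simp_all
    from value_of.word[OF this] arg_domain[OF this] show ?thesis
      using True by (simp add: arg_Cons words.prepend_delta)
  next
    case False
    obtain r where r: "value_of (shuffle u v) r"
      "(a \<otimes>\<^bsub>R\<^esub> b) \<otimes>\<^bsub>R\<^esub> r = arg (a # u) \<otimes>\<^bsub>R\<^esub> arg (b # v)"
    proof -
      consider "u = []" "v \<noteq> []" | "u \<noteq> []" "v = []" | "u \<noteq> []" "v \<noteq> []"
        using False by blast
      then show ?thesis
      proof cases
        case 1
        have "value_of (shuffle u v) (iter v)"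
          using value_of.word[OF b(3)[OF 1(2)]] 1(1) by simp
        moreover have "(a \<otimes>\<^bsub>R\<^esub> b) \<otimes>\<^bsub>R\<^esub> iter v = arg (a # u) \<otimes>\<^bsub>R\<^esub> arg (b # v)"
          using mult_assoc[OF a' b' iter_closed[OF b(3)[OF 1(2)]]] 1
          by (simp add: arg_Cons)
        ultimately show ?thesis by (rule that)
      next
        case 2
        have "value_of (shuffle u v) (iter u)"
          using value_of.word[OF a(3)[OF 2(1)]] 2(2) by (simp add: words.shuffle_Nil_right)
        moreover have "(a \<otimes>\<^bsub>R\<^esub> b) \<otimes>\<^bsub>R\<^esub> iter u = arg (a # u) \<otimes>\<^bsub>R\<^esub> arg (b # v)"
          using mult_assoc[OF a' b' iter_closed[OF a(3)[OF 2(1)]]]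
            mult_assoc[OF a' iter_closed[OF a(3)[OF 2(1)]] b']
            mult_comm[OF b' iter_closed[OF a(3)[OF 2(1)]]] 2
          by (simp add: arg_Cons)
        ultimately show ?thesis by (rule that)
      next
        case 3
        note U = iter_closed[OF a(3)[OF 3(1)]] and V = iter_closed[OF b(3)[OF 3(2)]]
        have "(a \<otimes>\<^bsub>R\<^esub> b) \<otimes>\<^bsub>R\<^esub> (iter u \<otimes>\<^bsub>R\<^esub> iter v) = a \<otimes>\<^bsub>R\<^esub> (b \<otimes>\<^bsub>R\<^esub> (iter u \<otimes>\<^bsub>R\<^esub> iter v))"
          by (rule mult_assoc[OF a' b' mult_closed[OF U V]])
        also have "b \<otimes>\<^bsub>R\<^esub> (iter u \<otimes>\<^bsub>R\<^esub> iter v) = iter u \<otimes>\<^bsub>R\<^esub> (b \<otimes>\<^bsub>R\<^esub> iter v)"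
          by (simp only: mult_assoc[OF b' U V, symmetric] mult_assoc[OF U b' V, symmetric]
              mult_comm[OF b' U])
        also have "a \<otimes>\<^bsub>R\<^esub> (iter u \<otimes>\<^bsub>R\<^esub> (b \<otimes>\<^bsub>R\<^esub> iter v)) = arg (a # u) \<otimes>\<^bsub>R\<^esub> arg (b # v)"
          by (simp only: arg_Cons(2)[OF 3(1)] arg_Cons(2)[OF 3(2)] mult_assoc[OF a' U mult_closed[OF b' V]])
        finally show ?thesis by (rule that[OF IH[OF 3]])
      qed
    qed
    from value_of_prepend[OF r(1) ab] show ?thesis unfolding r(2) by blast
  qed
  then show "arg (a # u) \<otimes>\<^bsub>R\<^esub> arg (b # v) \<in> D"
    "value_of (prepend K (emb a \<otimes>\<^bsub>At\<^esub> emb b) (shuffle u v)) (P (arg (a # u) \<otimes>\<^bsub>R\<^esub> arg (b # v)))"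
    unfolding emb_mult[OF a(1) b(1)] by blast+
qed

text \<open>With \<open>iter u = P (arg u)\<close> and \<open>iter v = P (arg v)\<close>, the
  Rota--Baxter identity has the same three terms as the shuffle recursion. The facts
  \<open>1\<close>, \<open>2\<close> and \<open>3\<close> supply the value of each term together
  with the three mixed domain conditions of the identity.\<close>

lemma value_of_shuffle:
  assumes "u \<in> adm" "v \<in> adm"
  shows "value_of (shuffle u v) (iter u \<otimes>\<^bsub>R\<^esub> iter v)"
  using assms
proof (induction "length u + length v" arbitrary: u v rule: less_induct)
  case less
  obtain a u' b v' where uv: "u = a # u'" "v = b # v'"
    using admD(1)[OF less.prems(1)] admD(1)[OF less.prems(2)] by (meson neq_Nil_conv)
  note u = less.prems(1)[unfolded uv] and v = less.prems(2)[unfolded uv]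
  note u' = adm_ConsD(3)[OF u] and v' = adm_ConsD(3)[OF v]
  have 1: "arg u \<otimes>\<^bsub>R\<^esub> iter v \<in> D" "value_of (prepend K (emb a) (shuffle u' v)) (P (arg u \<otimes>\<^bsub>R\<^esub> iter v))"
    unfolding uv(1)
    by (rule value_of_prepend_shuffle[OF u less.prems(2)], rule less.hyps;
        use uv u' less.prems in simp)+
  \<comment> \<open>The middle term is the first one with the two words exchanged; commutativity of
    \<open>R\<close> and of the shuffle restores the order below.\<close>
  have 2: "arg v \<otimes>\<^bsub>R\<^esub> iter u \<in> D" "value_of (prepend K (emb b) (shuffle v' u)) (P (arg v \<otimes>\<^bsub>R\<^esub> iter u))"
    unfolding uv(2)
    by (rule value_of_prepend_shuffle[OF v less.prems(1)], rule less.hyps;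
        use uv v' less.prems in simp)+
  have 3: "arg u \<otimes>\<^bsub>R\<^esub> arg v \<in> D"
    "value_of (prepend K (emb a \<otimes>\<^bsub>At\<^esub> emb b) (shuffle u' v')) (P (arg u \<otimes>\<^bsub>R\<^esub> arg v))"
    unfolding uv
    by (rule value_of_prepend_mult_shuffle[OF u v], rule less.hyps; use uv u' v' in simp)+
  note fu = arg_domain[OF less.prems(1)] and fv = arg_domain[OF less.prems(2)]
  have comm: "arg v \<otimes>\<^bsub>R\<^esub> iter u = iter u \<otimes>\<^bsub>R\<^esub> arg v"
    using fv(1) D_submodule(1) iter_closed[OF less.prems(1)] by (intro mult_comm) blast+
  have set_v': "set (map emb v') \<subseteq> carrier At"
    using admD(3)[OF less.prems(2)] unfolding uv by simp
  have sh: "shuffle v' u = shuffle u v'"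
    by (rule words.shuffle_comm[OF set_v' admD(3)[OF less.prems(1)]])
  have "iter u \<otimes>\<^bsub>R\<^esub> iter v = P (arg u \<otimes>\<^bsub>R\<^esub> iter v) \<oplus>\<^bsub>R\<^esub> P (arg v \<otimes>\<^bsub>R\<^esub> iter u)
      \<oplus>\<^bsub>R\<^esub> lam \<odot>\<^bsub>R\<^esub> P (arg u \<otimes>\<^bsub>R\<^esub> arg v)"
    by (rule rota_baxter[OF fu(1) fv(1), folded fu(2) fv(2), OF 1(1) 2(1)[unfolded comm] 3(1), folded comm])
  moreover have "shuffle u v = prepend K (emb a) (shuffle u' v) \<oplus>\<^bsub>words.W\<^esub>
      prepend K (emb b) (shuffle v' u) \<oplus>\<^bsub>words.W\<^esub>
      lam \<odot>\<^bsub>words.W\<^esub> prepend K (emb a \<otimes>\<^bsub>At\<^esub> emb b) (shuffle u' v')"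
    unfolding sh by (simp only: uv list.map words.shuffle_Cons)
  ultimately show ?case
    using value_of.add[OF value_of.add[OF 1(2) 2(2)] value_of.smult[OF weight_closed 3(2)]] by (simp only:)
qed

section \<open>The two MZV algebras\<close>

abbreviation abstract_MZVs where
  "abstract_MZVs \<equiv> span_of K (Sh K lam At) (one_tensor K lam R A ` adm)"

text \<open>Linear on all of \<open>words.W\<close>, being composed of the quotient map, the
  embedding into the unitarization and one tensor slot. Thus a whole shuffle can be carried into
  \<open>Sh\<close>.\<close>

abbreviation realize where
  "realize f \<equiv> ten.pure \<one>\<^bsub>At\<^esub> (\<zero>\<^bsub>K\<^esub>, words.cls f)"

lemma Sh_algebra: "comm_nonassoc_algebra K (Sh K lam At)"
  unfolding Sh_def by (rule ten.quot_algebra)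

lemma emb_hom: "(\<lambda>y. (\<zero>\<^bsub>K\<^esub>, y)) \<in> module_hom K words.Q (unitarization K words.Q)"
  by (rule module_homI) (simp_all add: unitarization_def)

lemma realize_hom: "realize \<in> module_hom K words.W (Sh K lam At)"
  unfolding Sh_def
  by (rule module_hom_compose[OF module_hom_compose[OF words.quot_hom emb_hom]
        ten.tensor_hom_right[OF one_closed_At]])

lemma one_tensor_eq: "one_tensor K lam R A fs = realize (delta K (map emb fs))"
  by (simp only: one_tensor_def Sh_tensor_def word_tensor_def)

lemma one_tensor_closed: "fs \<in> adm \<Longrightarrow> one_tensor K lam R A fs \<in> carrier (Sh K lam At)"
  unfolding one_tensor_eq by (rule module_homD(1)[OF realize_hom words.delta_in[OF admD(4,3)]])

text \<open>The layers are peeled off in turn: the tensor product multiplies slotwise, the first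
  slot gives the unit, the zero scalar components remove the mixed terms of the unitarization, and
  the product of word classes is the class of the shuffle.\<close>

lemma one_tensor_mult:
  assumes u: "u \<in> adm" and v: "v \<in> adm"
  shows "one_tensor K lam R A u \<otimes>\<^bsub>Sh K lam At\<^esub> one_tensor K lam R A v = realize (shuffle u v)"
proof -
  interpret Q: comm_nonassoc_algebra K words.Q by (rule words.quot_algebra)
  have cls: "words.cls (delta K (map emb fs)) \<in> carrier words.Q" if "fs \<in> adm" for fs
    by (rule module_homD(1)[OF words.quot_hom words.delta_in[OF admD(4,3)[OF that]]])
  note emb = module_homD(1)[OF emb_hom cls]
  have "(\<zero>\<^bsub>K\<^esub>, words.cls (delta K (map emb u))) \<otimes>\<^bsub>unitarization K words.Q\<^esub>
      (\<zero>\<^bsub>K\<^esub>, words.cls (delta K (map emb v))) =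
      (\<zero>\<^bsub>K\<^esub>, words.cls (delta K (map emb u)) \<otimes>\<^bsub>words.Q\<^esub> words.cls (delta K (map emb v)))"
    by (rule Q.unitarization_mult[OF cls[OF u] cls[OF v]])
  also have "words.cls (delta K (map emb u)) \<otimes>\<^bsub>words.Q\<^esub> words.cls (delta K (map emb v)) =
      words.cls (shuffle u v)"
    by (rule words.word_tensor_mult[OF admD(4,3)[OF u] admD(4,3)[OF v], unfolded word_tensor_def])
  finally show ?thesis
    unfolding one_tensor_eq Sh_def ten.tensor_mult[OF one_closed_At emb[OF u] one_closed_At emb[OF v]]
      one_mult_At by (simp only:)
qed

lemma abstract_MZVs_submodule: "submodule abstract_MZVs K (Sh K lam At)"
proof -
  interpret S: comm_nonassoc_algebra K "Sh K lam At" by (rule Sh_algebra)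
  show ?thesis
    by (rule S.span_of_submodule) (use one_tensor_closed in blast)
qed

lemma abstract_MZV_alg_eq: "abstract_MZV_alg K lam R A Fil k = (Sh K lam At)\<lparr>carrier := abstract_MZVs\<rparr>"
  by (simp only: abstract_MZV_alg_def Let_def)

lemma MZV_alg_eq: "MZV_alg K R P A Fil k = R\<lparr>carrier := MZVs\<rparr>"
  by (simp only: MZV_alg_def)

text \<open>A product of two iterated values is the value of a shuffle, hence lies in the span. The
  general lemma on spans, applied to the inclusion into \<open>R\<close>, extends this from the
  generators.\<close>

lemma MZV_algebra: "comm_nonassoc_algebra K (MZV_alg K R P A Fil k)"
  unfolding MZV_alg_eq
proof (rule comm_nonassoc_algebra.subalgebra[OF comm_nonassoc_algebra MZVs_submodule])
  have id: "(\<lambda>x. x) \<in> module_hom K (R\<lparr>carrier := MZVs\<rparr>) R"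
    using submoduleE(1)[OF MZVs_submodule] by (intro module_homI) auto
  fix x y assume "x \<in> MZVs" "y \<in> MZVs"
  then have "x \<otimes>\<^bsub>R\<^esub> y \<in> MZVs \<and> x \<otimes>\<^bsub>R\<^esub> y = x \<otimes>\<^bsub>R\<^esub> y"
  proof (rule span_mult_hom[OF comm_nonassoc_algebra comm_nonassoc_algebra _ id, rotated 2])
    show "iter ` adm \<subseteq> carrier R" using iter_closed by blast
    fix x y assume "x \<in> iter ` adm" "y \<in> iter ` adm"
    then show "x \<otimes>\<^bsub>R\<^esub> y \<in> MZVs \<and> x \<otimes>\<^bsub>R\<^esub> y = x \<otimes>\<^bsub>R\<^esub> y"
      using value_of_closed(2)[OF value_of_shuffle] by blast
  qed
  then show "x \<otimes>\<^bsub>R\<^esub> y \<in> MZVs" by blast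
qed

section \<open>The MZV map is multiplicative\<close>

context
  fixes PP
  assumes PP: "is_MZV_map K lam R P A Fil k PP"
begin

lemma PP_hom: "PP \<in> module_hom K ((Sh K lam At)\<lparr>carrier := abstract_MZVs\<rparr>) (R\<lparr>carrier := MZVs\<rparr>)"
  using PP unfolding is_MZV_map_def abstract_MZV_alg_eq MZV_alg_eq by blast

lemma PP_hom_R: "PP \<in> module_hom K ((Sh K lam At)\<lparr>carrier := abstract_MZVs\<rparr>) R"
proof (rule module_homI)
  fix x assume x: "x \<in> carrier ((Sh K lam At)\<lparr>carrier := abstract_MZVs\<rparr>)"
  show "PP x \<in> carrier R"
    using module_homD(1)[OF PP_hom x] submoduleE(1)[OF MZVs_submodule] by auto
  show "PP (c \<odot>\<^bsub>(Sh K lam At)\<lparr>carrier := abstract_MZVs\<rparr>\<^esub> x) = c \<odot>\<^bsub>R\<^esub> PP x" if "c \<in> carrier K" for c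
    using module_homD(3)[OF PP_hom that x] by simp
  show "PP (x \<oplus>\<^bsub>(Sh K lam At)\<lparr>carrier := abstract_MZVs\<rparr>\<^esub> y) = PP x \<oplus>\<^bsub>R\<^esub> PP y"
    if "y \<in> carrier ((Sh K lam At)\<lparr>carrier := abstract_MZVs\<rparr>)" for y
    using module_homD(2)[OF PP_hom x that] by simp
qed

lemma PP_one_tensor: "fs \<in> adm \<Longrightarrow> PP (one_tensor K lam R A fs) = iter fs"
  using PP unfolding is_MZV_map_def by blast

text \<open>Connects the linear extension on words with \<open>PP\<close>. Membership in the span is
  part of the induction because \<open>PP\<close> is known to be linear only there.\<close>

lemma PP_realize:
  assumes "value_of f r"
  shows "realize f \<in> abstract_MZVs" "PP (realize f) = r"
proof -
  interpret S: comm_nonassoc_algebra K "Sh K lam At" by (rule Sh_algebra)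
  note L = module_homD[OF realize_hom] and E = S.submoduleE[OF abstract_MZVs_submodule]
  have "realize f \<in> abstract_MZVs \<and> PP (realize f) = r"
    using assms
  proof induction
    case (word fs)
    have "one_tensor K lam R A fs \<in> abstract_MZVs"
      using word by (intro subsetD[OF span_of_superset] imageI)
    then show ?case
      using PP_one_tensor[OF word] unfolding one_tensor_eq by blast
  next
    case (add f r g s)
    then have fg: "realize f \<in> abstract_MZVs" "realize g \<in> abstract_MZVs"
      "PP (realize f) = r" "PP (realize g) = s"
      by blast+
    have "PP (realize f \<oplus>\<^bsub>Sh K lam At\<^esub> realize g) = r \<oplus>\<^bsub>R\<^esub> s"
      using module_homD(2)[OF PP_hom_R, of "realize f" "realize g"] fg by simp
    then show ?case
      using E(5)[OF fg(1,2)]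
      unfolding L(2)[OF value_of_closed(1)[OF add.hyps(1)] value_of_closed(1)[OF add.hyps(2)]] by blast
  next
    case (smult c f r)
    then have f: "realize f \<in> abstract_MZVs" "PP (realize f) = r"
      by blast+
    have "PP (c \<odot>\<^bsub>Sh K lam At\<^esub> realize f) = c \<odot>\<^bsub>R\<^esub> r"
      using module_homD(3)[OF PP_hom_R, of c "realize f"] f smult.hyps(1) by simp
    then show ?case
      using E(4)[OF smult.hyps(1) f(1)]
      unfolding L(3)[OF smult.hyps(1) value_of_closed(1)[OF smult.hyps(2)]] by blast
  qed
  then show "realize f \<in> abstract_MZVs" "PP (realize f) = r" by blast+
qed

text \<open>On generators the product is a realized shuffle, and the value of that shuffle is the
  product of the two iterated values; bilinearity does the rest.\<close>

lemma PP_mult: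
  assumes "x \<in> abstract_MZVs" "y \<in> abstract_MZVs"
  shows "x \<otimes>\<^bsub>Sh K lam At\<^esub> y \<in> abstract_MZVs \<and> PP (x \<otimes>\<^bsub>Sh K lam At\<^esub> y) = PP x \<otimes>\<^bsub>R\<^esub> PP y"
  using assms
proof (rule span_mult_hom[OF Sh_algebra comm_nonassoc_algebra _ PP_hom_R, rotated 2])
  show "one_tensor K lam R A ` adm \<subseteq> carrier (Sh K lam At)"
    using one_tensor_closed by blast
  fix x y assume "x \<in> one_tensor K lam R A ` adm" "y \<in> one_tensor K lam R A ` adm"
  then obtain u v where xy: "x = one_tensor K lam R A u" "y = one_tensor K lam R A v"
    and uv: "u \<in> adm" "v \<in> adm"
    by blast
  show "x \<otimes>\<^bsub>Sh K lam At\<^esub> y \<in> abstract_MZVs \<and> PP (x \<otimes>\<^bsub>Sh K lam At\<^esub> y) = PP x \<otimes>\<^bsub>R\<^esub> PP y"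
    unfolding xy one_tensor_mult[OF uv] PP_one_tensor[OF uv(1)] PP_one_tensor[OF uv(2)]
    using PP_realize[OF value_of_shuffle[OF uv]] by blast
qed

lemma abstract_MZV_algebra: "comm_nonassoc_algebra K (abstract_MZV_alg K lam R A Fil k)"
  unfolding abstract_MZV_alg_eq
  by (rule comm_nonassoc_algebra.subalgebra[OF Sh_algebra abstract_MZVs_submodule conjunct1[OF PP_mult]])

lemma PP_alg_hom: "PP \<in> alg_hom K (abstract_MZV_alg K lam R A Fil k) (MZV_alg K R P A Fil k)"
  unfolding abstract_MZV_alg_eq MZV_alg_eq alg_hom_def
  using PP_hom PP_mult by simp

end

end

theorem corollary3p3:
  fixes K :: "('a, 'k) ring_scheme"
    and R :: "('a, 'b, 'm) module_scheme"
    and lam :: 'a and D :: "'b set" and P :: "'b \<Rightarrow> 'b"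
    and A :: "'b set" and Fil :: "nat \<Rightarrow> 'b set" and k n :: nat
    and PP :: "(('a \<times> 'b) \<times> ('a \<times> (('a \<times> 'b) list \<Rightarrow> 'a) set) \<Rightarrow> 'a) set \<Rightarrow> 'b"
    and \<nu> :: "'b \<Rightarrow> 'a"
    and F :: "nat multiset \<Rightarrow> 'a"
    and x :: "nat \<Rightarrow> (('a \<times> 'b) \<times> ('a \<times> (('a \<times> 'b) list \<Rightarrow> 'a) set) \<Rightarrow> 'a) set"
  assumes "partial_rota_baxter K R lam D P"
    and "k \<ge> 1"
    and "filtered_subalgebra K R A Fil"
    and "iteratedly_summable R D P A Fil k"
    and "is_MZV_map K lam R P A Fil k PP"
    and "\<nu> \<in> alg_hom K (MZV_alg K R P A Fil k) (self_algebra K)"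
    and "F \<in> ring.indexed_pset K {1..n} (carrier K)"
    and "F {#} = \<zero>\<^bsub>K\<^esub>"
    and "\<And>i. i \<in> {1..n} \<Longrightarrow> x i \<in> carrier (abstract_MZV_alg K lam R A Fil k)"
    and "poly_eval K (abstract_MZV_alg K lam R A Fil k) F x
      = \<zero>\<^bsub>abstract_MZV_alg K lam R A Fil k\<^esub>"
  shows "poly_eval K (MZV_alg K R P A Fil k) F (\<lambda>i. PP (x i)) = \<zero>\<^bsub>MZV_alg K R P A Fil k\<^esub>
    \<and> poly_eval K (self_algebra K) F (\<lambda>i. (\<nu> \<circ> PP) (x i)) = \<zero>\<^bsub>self_algebra K\<^esub>"
proof -
  interpret iteratedly_summable_subalgebra K R lam D P A Fil k
    using assms(1,3,4)
    by (intro iteratedly_summable_subalgebra.intro iteratedly_summable_subalgebra_axioms.intro)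
  let ?M = "abstract_MZV_alg K lam R A Fil k" and ?N = "MZV_alg K R P A Fil k"
  note M = abstract_MZV_algebra[OF assms(5)] and N = MZV_algebra and S = R.self_algebra
  note hom = PP_alg_hom[OF assms(5)]
  have "poly_eval K ?N F (\<lambda>i. PP (x i)) = PP (poly_eval K ?M F x)"
    by (rule poly_eval_hom[OF M N hom assms(7,8,9), symmetric])
  also have "\<dots> = \<zero>\<^bsub>?N\<^esub>"
    unfolding assms(10) by (rule alg_hom_zero[OF M N hom])
  finally have 1: "poly_eval K ?N F (\<lambda>i. PP (x i)) = \<zero>\<^bsub>?N\<^esub>" .
  have PPx: "PP (x i) \<in> carrier ?N" if "i \<in> {1..n}" for i
    using module_homD(1)[of PP K ?M ?N] hom assms(9)[OF that] unfolding alg_hom_def by blast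
  \<comment> \<open>The scalar relation is the image under \<nu> of the relation just
    obtained.\<close>
  have "poly_eval K (self_algebra K) F (\<lambda>i. \<nu> (PP (x i))) = \<nu> (poly_eval K ?N F (\<lambda>i. PP (x i)))"
    by (rule poly_eval_hom[OF N S assms(6,7,8) PPx, symmetric])
  also have "\<dots> = \<zero>\<^bsub>self_algebra K\<^esub>"
    unfolding 1 by (rule alg_hom_zero[OF N S assms(6)])
  finally show ?thesis
    using 1 by (simp only: comp_apply)
qed

end
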